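(* Let $R$ be a commutative Noetherian local ring, let $N$ be a nonzero finitely generated $R$-module, and let $M=\Omega_R^n N$ for some integer $n\geq 1$. Assume there is an $R$-regular sequence $\underline{x}=x_1,\ldots,x_n$ of length $n$ such that $\underline{x}\cdot\operatorname{Ext}^1_R(N,\Omega_R N)=0$ (that is, each $x_i$ annihilates $\operatorname{Ext}^1_R(N,\Omega_RN)$). Then there is a short exact sequence of $R$-modules $$0\longrightarrow F\longrightarrow \bigoplus_{i=0}^{n}\left(\Omega_R^{i+n-1}N\right)^{\oplus\binom{n}{i}}\longrightarrow \Omega_R^{n-1}(M/\underline{x}M)\longrightarrow 0,$$ where $F$ is free.
   Context: All rings are commutative Noetherian local and all modules are finitely generated. Syzygy: for $n\ge 1$, $\Omega_R^n N$ is the image of the $n$-th differential in a minimal free resolution of $N$; $\Omega_R^0N=N$, $\Omega_RN=\Omega_R^1N$. Convention: modules $X,Y$ with $X\oplus F\cong Y\oplus G$ for finitely generated free modules $F,G$ (stably isomorphic modules) are not distinguished; thus the syzygy modules appearing in the exact sequence are to be understood up to finitely generated free direct summands. *)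

theory Defs
  imports "HOL-Algebra.Ring_Divisibility" "HOL-Algebra.Module" Complex_Main
begin

locale noetherian_local_ring = cring R + noetherian_ring R for R (structure) +
  assumes unique_maximal: "\<exists>!m. maximalideal m R"

definition max_ideal :: "('a, 'r) ring_scheme \<Rightarrow> 'a set"
  where "max_ideal R = (THE m. maximalideal m R)"

text \<open>The last clause is the usual properness condition \<open>R/(x\<^sub>1,\<dots>,x\<^sub>n) \<noteq> 0\<close>; the clause before it says
  that \<open>x\<^sub>i\<^sub>+\<^sub>1\<close> is a nonzerodivisor on \<open>R/(x\<^sub>1,\<dots>,x\<^sub>i)\<close>.\<close>

definition regular_seq :: "('a, 'r) ring_scheme \<Rightarrow> 'a list \<Rightarrow> bool"
  where "regular_seq R xs \<longleftrightarrow>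
    set xs \<subseteq> carrier R \<and>
    (\<forall>i<length xs. \<forall>r\<in>carrier R.
       xs ! i \<otimes>\<^bsub>R\<^esub> r \<in> genideal R (set (take i xs)) \<longrightarrow> r \<in> genideal R (set (take i xs))) \<and>
    genideal R (set xs) \<noteq> carrier R"

definition lin_maps ::
    "('a, 'r) ring_scheme \<Rightarrow> ('a, 'b, 'm) module_scheme \<Rightarrow> ('a, 'c, 'n) module_scheme \<Rightarrow> ('b \<Rightarrow> 'c) set"
  where "lin_maps R M N = {f \<in> carrier M \<rightarrow> carrier N.
    (\<forall>x\<in>carrier M. \<forall>y\<in>carrier M. f (x \<oplus>\<^bsub>M\<^esub> y) = f x \<oplus>\<^bsub>N\<^esub> f y) \<and>
    (\<forall>a\<in>carrier R. \<forall>x\<in>carrier M. f (a \<odot>\<^bsub>M\<^esub> x) = a \<odot>\<^bsub>N\<^esub> f x)}"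

definition module_iso ::
    "('a, 'r) ring_scheme \<Rightarrow> ('a, 'b, 'm) module_scheme \<Rightarrow> ('a, 'c, 'n) module_scheme \<Rightarrow> bool"
  where "module_iso R M N \<longleftrightarrow> module R M \<and> module R N \<and>
    (\<exists>f\<in>lin_maps R M N. bij_betw f (carrier M) (carrier N))"

definition short_exact ::
    "('a, 'r) ring_scheme \<Rightarrow> ('a, 'b, 'l) module_scheme \<Rightarrow> ('b \<Rightarrow> 'c) \<Rightarrow> ('a, 'c, 'm) module_scheme \<Rightarrow>
     ('c \<Rightarrow> 'd) \<Rightarrow> ('a, 'd, 'n) module_scheme \<Rightarrow> bool"
  where "short_exact R A f B g C \<longleftrightarrow> module R A \<and> module R B \<and> module R C \<and>
    f \<in> lin_maps R A B \<and> g \<in> lin_maps R B C \<and>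
    inj_on f (carrier A) \<and> f ` carrier A = a_kernel B C g \<and> g ` carrier B = carrier C"

definition module_span :: "('a, 'r) ring_scheme \<Rightarrow> ('a, 'b, 'm) module_scheme \<Rightarrow> 'b set \<Rightarrow> 'b set"
  where "module_span R M S = \<Inter>{H. submodule H R M \<and> S \<subseteq> H}"

definition fin_gen :: "('a, 'r) ring_scheme \<Rightarrow> ('a, 'b, 'm) module_scheme \<Rightarrow> bool"
  where "fin_gen R M \<longleftrightarrow> (\<exists>S\<subseteq>carrier M. finite S \<and> module_span R M S = carrier M)"

definition ideal_smult :: "('a, 'r) ring_scheme \<Rightarrow> 'a set \<Rightarrow> ('a, 'b, 'm) module_scheme \<Rightarrow> 'b set"
  where "ideal_smult R I M = module_span R M {a \<odot>\<^bsub>M\<^esub> x | a x. a \<in> I \<and> x \<in> carrier M}"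

text \<open>A module record extends a ring record; the fields \<open>mult\<close> and \<open>one\<close> carry no meaning for
  a module and are left undefined below. The scalar action on cosets follows the pattern of
  \<^const>\<open>rcoset_mult\<close>.\<close>

definition quot_module :: "('a, 'b, 'm) module_scheme \<Rightarrow> 'b set \<Rightarrow> ('a, 'b set) module"
  where "quot_module M H =
    \<lparr>carrier = a_rcosets\<^bsub>M\<^esub> H, mult = undefined, one = undefined, zero = H, add = set_add M,
     smult = \<lambda>a K. \<Union>x\<in>K. H +>\<^bsub>M\<^esub> (a \<odot>\<^bsub>M\<^esub> x)\<rparr>"

definition hom_module ::
    "('a, 'r) ring_scheme \<Rightarrow> ('a, 'b, 'm) module_scheme \<Rightarrow> ('a, 'c, 'n) module_scheme \<Rightarrow> ('a, 'b \<Rightarrow> 'c) module"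
  where "hom_module R M N =
    \<lparr>carrier = lin_maps R M N \<inter> extensional (carrier M), mult = undefined, one = undefined,
     zero = (\<lambda>x\<in>carrier M. \<zero>\<^bsub>N\<^esub>),
     add = (\<lambda>f g. \<lambda>x\<in>carrier M. f x \<oplus>\<^bsub>N\<^esub> g x),
     smult = (\<lambda>a f. \<lambda>x\<in>carrier M. a \<odot>\<^bsub>N\<^esub> f x)\<rparr>"

text \<open>Used only for finite \<open>I\<close>, where the direct product is the direct sum.\<close>

definition finite_sum_module :: "'i set \<Rightarrow> ('i \<Rightarrow> ('a, 'b, 'm) module_scheme) \<Rightarrow> ('a, 'i \<Rightarrow> 'b) module"
  where "finite_sum_module I A =
    \<lparr>carrier = (\<Pi>\<^sub>E i\<in>I. carrier (A i)), mult = undefined, one = undefined,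
     zero = (\<lambda>i\<in>I. \<zero>\<^bsub>A i\<^esub>),
     add = (\<lambda>u v. \<lambda>i\<in>I. u i \<oplus>\<^bsub>A i\<^esub> v i),
     smult = (\<lambda>a u. \<lambda>i\<in>I. a \<odot>\<^bsub>A i\<^esub> u i)\<rparr>"

definition sum_module ::
    "('a, 'b, 'm) module_scheme \<Rightarrow> ('a, 'c, 'n) module_scheme \<Rightarrow> ('a, 'b \<times> 'c) module"
  where "sum_module M N =
    \<lparr>carrier = carrier M \<times> carrier N, mult = undefined, one = undefined,
     zero = (\<zero>\<^bsub>M\<^esub>, \<zero>\<^bsub>N\<^esub>),
     add = (\<lambda>u v. (fst u \<oplus>\<^bsub>M\<^esub> fst v, snd u \<oplus>\<^bsub>N\<^esub> snd v)),
     smult = (\<lambda>a u. (a \<odot>\<^bsub>M\<^esub> fst u, a \<odot>\<^bsub>N\<^esub> snd u))\<rparr>"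

definition ring_module :: "('a, 'r) ring_scheme \<Rightarrow> ('a, 'a) module"
  where "ring_module R =
    \<lparr>carrier = carrier R, mult = undefined, one = undefined, zero = \<zero>\<^bsub>R\<^esub>, add = add R,
     smult = mult R\<rparr>"

definition free_module :: "('a, 'r) ring_scheme \<Rightarrow> nat \<Rightarrow> ('a, nat \<Rightarrow> 'a) module"
  where "free_module R b = finite_sum_module {..<b} (\<lambda>_. ring_module R)"

definition stably_iso ::
    "('a, 'r) ring_scheme \<Rightarrow> ('a, 'b, 'm) module_scheme \<Rightarrow> ('a, 'c, 'n) module_scheme \<Rightarrow> bool"
  where "stably_iso R X Y \<longleftrightarrow> module R X \<and> module R Y \<and>
    (\<exists>p q. module_iso R (sum_module X (free_module R p)) (sum_module Y (free_module R q)))"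

text \<open>A resolution \<open>\<dots> \<rightarrow> F\<^sub>2 \<rightarrow> F\<^sub>1 \<rightarrow> F\<^sub>0 \<rightarrow> N \<rightarrow> 0\<close> by free modules of finite rank is given by the ranks
  \<open>b k\<close> of \<open>F\<^sub>k\<close>, the differentials \<open>d k : F\<^sub>k \<rightarrow> F\<^sub>k\<^sub>-\<^sub>1\<close> for \<open>k \<ge> 1\<close> (\<open>d 0\<close> is not used), and the
  augmentation \<open>e : F\<^sub>0 \<rightarrow> N\<close>.\<close>

definition free_resolution ::
    "('a, 'r) ring_scheme \<Rightarrow> ('a, 'b, 'm) module_scheme \<Rightarrow> (nat \<Rightarrow> nat) \<Rightarrow>
     (nat \<Rightarrow> (nat \<Rightarrow> 'a) \<Rightarrow> (nat \<Rightarrow> 'a)) \<Rightarrow> ((nat \<Rightarrow> 'a) \<Rightarrow> 'b) \<Rightarrow> bool"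
  where "free_resolution R N b d e \<longleftrightarrow>
    (let F = \<lambda>k. free_module R (b k) in
      e \<in> lin_maps R (F 0) N \<and> e ` carrier (F 0) = carrier N \<and>
      (\<forall>k. d (Suc k) \<in> lin_maps R (F (Suc k)) (F k)) \<and>
      d 1 ` carrier (F 1) = a_kernel (F 0) N e \<and>
      (\<forall>k. d (Suc (Suc k)) ` carrier (F (Suc (Suc k))) = a_kernel (F (Suc k)) (F k) (d (Suc k))))"

definition minimal_free_resolution ::
    "('a, 'r) ring_scheme \<Rightarrow> ('a, 'b, 'm) module_scheme \<Rightarrow> (nat \<Rightarrow> nat) \<Rightarrow>
     (nat \<Rightarrow> (nat \<Rightarrow> 'a) \<Rightarrow> (nat \<Rightarrow> 'a)) \<Rightarrow> ((nat \<Rightarrow> 'a) \<Rightarrow> 'b) \<Rightarrow> bool"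
  where "minimal_free_resolution R N b d e \<longleftrightarrow>
    free_resolution R N b d e \<and>
    (\<forall>k. d (Suc k) ` carrier (free_module R (b (Suc k)))
           \<subseteq> ideal_smult R (max_ideal R) (free_module R (b k)))"

text \<open>Syzygies are taken up to isomorphism, as a relation, so that the case \<open>k = 0\<close> (where the syzygy
  is \<open>N\<close> itself) and the case \<open>k \<ge> 1\<close> can be realised on a common carrier type.\<close>

definition is_syzygy ::
    "('a, 'r) ring_scheme \<Rightarrow> nat \<Rightarrow> ('a, 'b, 'm) module_scheme \<Rightarrow> ('a, 'c, 'n) module_scheme \<Rightarrow> bool"
  where "is_syzygy R k N X \<longleftrightarrow>
    (case k of
       0 \<Rightarrow> module_iso R N X
     | Suc j \<Rightarrow> \<exists>b d e. minimal_free_resolution R N b d e \<and>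
         module_iso R
           ((free_module R (b j))\<lparr>carrier := d (Suc j) ` carrier (free_module R (b (Suc j)))\<rparr>) X)"

definition ext_cocycles ::
    "('a, 'r) ring_scheme \<Rightarrow> (nat \<Rightarrow> nat) \<Rightarrow> (nat \<Rightarrow> (nat \<Rightarrow> 'a) \<Rightarrow> (nat \<Rightarrow> 'a)) \<Rightarrow> nat \<Rightarrow>
     ('a, 'c, 'n) module_scheme \<Rightarrow> ((nat \<Rightarrow> 'a) \<Rightarrow> 'c) set"
  where "ext_cocycles R b d i Y =
    {h \<in> carrier (hom_module R (free_module R (b i)) Y).
       compose (carrier (free_module R (b (Suc i)))) h (d (Suc i))
         = \<zero>\<^bsub>hom_module R (free_module R (b (Suc i))) Y\<^esub>}"

definition ext_coboundaries ::
    "('a, 'r) ring_scheme \<Rightarrow> (nat \<Rightarrow> nat) \<Rightarrow> (nat \<Rightarrow> (nat \<Rightarrow> 'a) \<Rightarrow> (nat \<Rightarrow> 'a)) \<Rightarrow> nat \<Rightarrow>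
     ('a, 'c, 'n) module_scheme \<Rightarrow> ((nat \<Rightarrow> 'a) \<Rightarrow> 'c) set"
  where "ext_coboundaries R b d i Y =
    (case i of
       0 \<Rightarrow> {\<zero>\<^bsub>hom_module R (free_module R (b 0)) Y\<^esub>}
     | Suc j \<Rightarrow> (\<lambda>g. compose (carrier (free_module R (b i))) g (d i)) `
         carrier (hom_module R (free_module R (b j)) Y))"

text \<open>\<open>Ext\<^sup>i\<^sub>R(N,Y)\<close> is the \<open>i\<close>-th cohomology module of \<open>Hom(F\<^sub>\<bullet>,Y)\<close>, computed with some (not necessarily
  minimal) resolution of \<open>N\<close> by free modules of finite rank; up to isomorphism it does not depend
  on the resolution chosen. Such a resolution exists whenever \<open>N\<close> is finitely generated over
  Noetherian \<open>R\<close>, the only case in which this is meant to be used.\<close>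

definition ext_module ::
    "('a, 'r) ring_scheme \<Rightarrow> nat \<Rightarrow> ('a, 'b, 'm) module_scheme \<Rightarrow> ('a, 'c, 'n) module_scheme \<Rightarrow>
     ('a, ((nat \<Rightarrow> 'a) \<Rightarrow> 'c) set) module"
  where "ext_module R i N Y =
    (case SOME (b, d, e). free_resolution R N b d e of
       (b, d, e) \<Rightarrow> quot_module
         ((hom_module R (free_module R (b i)) Y)\<lparr>carrier := ext_cocycles R b d i Y\<rparr>)
         (ext_coboundaries R b d i Y))"

definition annihilates :: "'a \<Rightarrow> ('a, 'b, 'm) module_scheme \<Rightarrow> bool"
  where "annihilates a M \<longleftrightarrow> (\<forall>x\<in>carrier M. a \<odot>\<^bsub>M\<^esub> x = \<zero>\<^bsub>M\<^esub>)"

end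

theory Submission
  imports Defs
begin

text \<open>Write \<open>\<Omega>\<close> for syzygies, which are determined up to free summands by Schanuel's lemma (\<open>schanuel\<close>).

  That \<open>x\<close> annihilates \<open>Ext\<^sup>1(N, \<Omega>N)\<close> means that it annihilates the class of \<open>0 \<rightarrow> \<Omega>N \<rightarrow> F \<rightarrow> N \<rightarrow> 0\<close>, that is,
  that multiplication by \<open>x\<close> on \<open>N\<close> factors through a free module (\<open>ext_annihilator_factors_free\<close>). This
  property passes to all \<open>\<Omega>\<^sup>iN\<close>, to direct sums and to stably isomorphic modules.

  The modules \<open>M\<^sub>j = M / (x\<^sub>1, \<dots>, x\<^sub>j) M\<close> are treated one after the other. As \<open>M\<close> is an \<open>n\<close>-th syzygy, the
  \<open>R\<close>-regular sequence is regular on \<open>M\<close> as well (\<open>regular_seq_syzygy\<close>). For each \<open>j \<ge> 1\<close> there is an exact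
  sequence \<open>0 \<rightarrow> R\<^sup>r \<rightarrow> B\<^sub>j \<rightarrow> \<Omega>\<^sup>j\<^sup>-\<^sup>1M\<^sub>j \<rightarrow> 0\<close> in which \<open>B\<^sub>j\<close> is stably the sum of \<open>(j choose i)\<close> copies of \<open>\<Omega>\<^sup>n\<^sup>-\<^sup>1\<^sup>+\<^sup>iN\<close>
  for \<open>i \<le> j\<close>; the theorem is the case \<open>j = n\<close>.

  For \<open>j = 1\<close>, the pushout of \<open>0 \<rightarrow> M \<rightarrow> F \<rightarrow> \<Omega>\<^sup>n\<^sup>-\<^sup>1N \<rightarrow> 0\<close> along \<open>x\<^sub>1 : M \<rightarrow> M\<close> splits, so it is \<open>M \<oplus> \<Omega>\<^sup>n\<^sup>-\<^sup>1N\<close>, and it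
  contains \<open>F\<close> with cokernel \<open>M / x\<^sub>1M\<close> (\<open>short_exact_pushout_multiplication\<close>).

  For the step, put \<open>Z = \<Omega>\<^sup>j\<^sup>-\<^sup>1M\<^sub>j\<close> and \<open>x = x\<^sub>j\<^sub>+\<^sub>1\<close>. The mapping cone of \<open>x\<close> on a resolution of \<open>M\<^sub>j\<close> resolves \<open>M\<^sub>j\<^sub>+\<^sub>1\<close>,
  and it exhibits \<open>\<Omega>\<^sup>jM\<^sub>j\<^sub>+\<^sub>1\<close> as the pullback of a cover \<open>H \<rightarrow> Z\<close> along \<open>x : Z \<rightarrow> Z\<close> (\<open>nth_syzygy_quotient\<close>). This is an
  extension of \<open>Z\<close> by \<open>\<Omega>Z\<close>, which is stably \<open>\<Omega>B\<^sub>j\<close> because \<open>B\<^sub>j \<rightarrow> Z\<close> has a free kernel. The extension need not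
  split, but its pullback to \<open>B\<^sub>j\<close> does, because \<open>x\<close> factors through a free module on \<open>B\<^sub>j\<close>. Hence
  \<open>B\<^sub>j\<^sub>+\<^sub>1 = \<Omega>B\<^sub>j \<oplus> B\<^sub>j\<close> maps onto \<open>\<Omega>\<^sup>jM\<^sub>j\<^sub>+\<^sub>1\<close> with the same free kernel (\<open>short_exact_pullback_multiplication\<close>), and
  Pascal's rule (\<open>subset_sum_Suc\<close>) gives the multiplicities.\<close>

section \<open>Linear maps and constructions of modules\<close>

lemma (in abelian_group) diff_zero_iff:
  assumes "x \<in> carrier G" "y \<in> carrier G"
  shows "x \<ominus> y = \<zero> \<longleftrightarrow> x = y"
proof
  assume "x \<ominus> y = \<zero>"
  then have "(x \<ominus> y) \<oplus> y = \<zero> \<oplus> y" by simp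
  then show "x = y" using assms by (simp add: minus_eq a_assoc l_neg)
qed (use assms in \<open>simp add: minus_eq r_neg\<close>)

lemma (in abelian_group) diff_eq_iff:
  assumes "x \<in> carrier G" "y \<in> carrier G" "z \<in> carrier G"
  shows "x \<ominus> y = z \<longleftrightarrow> x = z \<oplus> y"
proof
  assume "x \<ominus> y = z"
  then have "(x \<ominus> y) \<oplus> y = z \<oplus> y" by simp
  then show "x = z \<oplus> y" using assms by (simp add: minus_eq a_assoc l_neg)
qed (use assms in \<open>simp add: minus_eq r_neg a_assoc\<close>)

text \<open>These rules let the method \<open>algebra\<close> normalise terms in the additive group of a module, not only
  in rings.\<close>

lemmas (in module) module_simprules
  [algebra add: module "zero M" "add M" "a_inv M" "a_minus M" "smult M"] =
  M.a_closed M.zero_closed M.a_inv_closed M.minus_closed smult_closed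
  M.a_assoc M.l_zero M.l_neg M.a_comm M.minus_eq M.r_zero M.r_neg M.r_neg2 M.r_neg1 M.minus_add
  M.minus_minus M.a_lcomm M.add.inv_one smult_r_distr smult_r_minus smult_r_null

lemma lin_mapsI:
  assumes "\<And>x. x \<in> carrier X \<Longrightarrow> f x \<in> carrier Y"
    and "\<And>x y. \<lbrakk>x \<in> carrier X; y \<in> carrier X\<rbrakk> \<Longrightarrow> f (x \<oplus>\<^bsub>X\<^esub> y) = f x \<oplus>\<^bsub>Y\<^esub> f y"
    and "\<And>a x. \<lbrakk>a \<in> carrier R; x \<in> carrier X\<rbrakk> \<Longrightarrow> f (a \<odot>\<^bsub>X\<^esub> x) = a \<odot>\<^bsub>Y\<^esub> f x"
  shows "f \<in> lin_maps R X Y"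
  using assms by (auto simp: lin_maps_def)

lemma lin_closed: "\<lbrakk>f \<in> lin_maps R X Y; x \<in> carrier X\<rbrakk> \<Longrightarrow> f x \<in> carrier Y"
  by (auto simp: lin_maps_def)

lemma lin_add:
  "\<lbrakk>f \<in> lin_maps R X Y; x \<in> carrier X; y \<in> carrier X\<rbrakk> \<Longrightarrow> f (x \<oplus>\<^bsub>X\<^esub> y) = f x \<oplus>\<^bsub>Y\<^esub> f y"
  by (auto simp: lin_maps_def)

lemma lin_smult:
  "\<lbrakk>f \<in> lin_maps R X Y; a \<in> carrier R; x \<in> carrier X\<rbrakk> \<Longrightarrow> f (a \<odot>\<^bsub>X\<^esub> x) = a \<odot>\<^bsub>Y\<^esub> f x"
  by (auto simp: lin_maps_def)

lemma lin_zero: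
  assumes "module R X" "module R Y" "f \<in> lin_maps R X Y"
  shows "f \<zero>\<^bsub>X\<^esub> = \<zero>\<^bsub>Y\<^esub>"
proof -
  interpret X: module R X by fact
  interpret Y: module R Y by fact
  have "f (\<zero>\<^bsub>R\<^esub> \<odot>\<^bsub>X\<^esub> \<zero>\<^bsub>X\<^esub>) = \<zero>\<^bsub>R\<^esub> \<odot>\<^bsub>Y\<^esub> f \<zero>\<^bsub>X\<^esub>"
    by (intro lin_smult[OF assms(3)]) auto
  then show ?thesis
    using lin_closed[OF assms(3)] by simp
qed

lemma lin_neg:
  assumes "module R X" "module R Y" "f \<in> lin_maps R X Y" "x \<in> carrier X"
  shows "f (\<ominus>\<^bsub>X\<^esub> x) = \<ominus>\<^bsub>Y\<^esub> f x"
proof -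
  interpret X: module R X by fact
  interpret Y: module R Y by fact
  have "f (\<ominus>\<^bsub>X\<^esub> x) \<oplus>\<^bsub>Y\<^esub> f x = \<zero>\<^bsub>Y\<^esub>"
    using assms(4) lin_add[OF assms(3), of "\<ominus>\<^bsub>X\<^esub> x" x] lin_zero[OF assms(1-3)] by (simp add: X.M.l_neg)
  then show ?thesis
    using assms(4) lin_closed[OF assms(3)] by (intro Y.M.minus_equality[symmetric]) simp_all
qed

lemma lin_minus:
  assumes "module R X" "module R Y" "f \<in> lin_maps R X Y" "x \<in> carrier X" "y \<in> carrier X"
  shows "f (x \<ominus>\<^bsub>X\<^esub> y) = f x \<ominus>\<^bsub>Y\<^esub> f y"
proof -
  interpret X: module R X by fact
  show ?thesis
    using assms by (simp add: a_minus_def lin_add[OF assms(3)] lin_neg[OF assms(1-3)])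
qed

lemmas lin_simps = lin_closed lin_add lin_smult

lemma lin_comp:
  assumes "f \<in> lin_maps R X Y" "g \<in> lin_maps R Y Z"
  shows "(\<lambda>x. g (f x)) \<in> lin_maps R X Z"
  using assms by (auto simp: lin_maps_def Pi_iff)

lemma lin_cong:
  assumes "f \<in> lin_maps R X Y" "module R X" "\<And>x. x \<in> carrier X \<Longrightarrow> g x = f x"
  shows "g \<in> lin_maps R X Y"
proof -
  interpret X: module R X by fact
  show ?thesis using assms(1,3) by (auto simp: lin_maps_def Pi_iff)
qed

lemma lin_id: "(\<lambda>x. x) \<in> lin_maps R X X"
  by (auto simp: lin_maps_def)

lemma lin_zero_map:
  assumes "module R Y" shows "(\<lambda>_. \<zero>\<^bsub>Y\<^esub>) \<in> lin_maps R X Y"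
proof -
  interpret Y: module R Y by fact
  show ?thesis by (rule lin_mapsI) auto
qed

lemma lin_plus:
  assumes "module R Y" "f \<in> lin_maps R X Y" "g \<in> lin_maps R X Y"
  shows "(\<lambda>x. f x \<oplus>\<^bsub>Y\<^esub> g x) \<in> lin_maps R X Y"
proof -
  interpret Y: module R Y by fact
  show ?thesis
    by (rule lin_mapsI)
      (simp_all add: lin_simps[OF assms(2)] lin_simps[OF assms(3)] Y.M.a_ac Y.smult_r_distr)
qed

lemma lin_scale:
  assumes "module R Y" "f \<in> lin_maps R X Y" "a \<in> carrier R"
  shows "(\<lambda>x. a \<odot>\<^bsub>Y\<^esub> f x) \<in> lin_maps R X Y"
proof -
  interpret Y: module R Y by fact
  show ?thesis
    by (rule lin_mapsI)
      (simp_all add: lin_simps[OF assms(2)] assms(3) Y.smult_r_distr Y.smult_assoc1[symmetric] Y.R.m_comm[of a])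
qed

lemma lin_neg_map:
  assumes "module R Y" "f \<in> lin_maps R X Y"
  shows "(\<lambda>x. \<ominus>\<^bsub>Y\<^esub> f x) \<in> lin_maps R X Y"
proof -
  interpret Y: module R Y by fact
  show ?thesis
    by (rule lin_mapsI)
      (simp_all add: lin_simps[OF assms(2)] Y.M.minus_add Y.smult_r_minus Y.M.a_comm)
qed

lemma lin_diff:
  assumes "module R Y" "f \<in> lin_maps R X Y" "g \<in> lin_maps R X Y"
  shows "(\<lambda>x. f x \<ominus>\<^bsub>Y\<^esub> g x) \<in> lin_maps R X Y"
  using lin_plus[OF assms(1,2) lin_neg_map[OF assms(1,3)]] by (simp add: a_minus_def)

lemma mem_a_kernel: "x \<in> a_kernel X Y f \<longleftrightarrow> x \<in> carrier X \<and> f x = \<zero>\<^bsub>Y\<^esub>"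
  by (simp add: a_kernel_def kernel_def)

lemma inj_on_linI:
  assumes "module R X" "module R Y" "f \<in> lin_maps R X Y"
    and "\<And>x. \<lbrakk>x \<in> carrier X; f x = \<zero>\<^bsub>Y\<^esub>\<rbrakk> \<Longrightarrow> x = \<zero>\<^bsub>X\<^esub>"
  shows "inj_on f (carrier X)"
proof (rule inj_onI)
  interpret X: module R X by fact
  interpret Y: module R Y by fact
  fix x y assume xy: "x \<in> carrier X" "y \<in> carrier X" "f x = f y"
  then have "f (x \<ominus>\<^bsub>X\<^esub> y) = \<zero>\<^bsub>Y\<^esub>"
    using lin_closed[OF assms(3)] by (simp add: lin_minus[OF assms(1-3)] Y.M.diff_zero_iff)
  then have "x \<ominus>\<^bsub>X\<^esub> y = \<zero>\<^bsub>X\<^esub>" using xy by (intro assms(4)) simp_all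
  then show "x = y" using xy by (simp add: X.M.diff_zero_iff)
qed

lemma sum_module_simps [simp]:
  "carrier (sum_module A B) = carrier A \<times> carrier B"
  "\<zero>\<^bsub>sum_module A B\<^esub> = (\<zero>\<^bsub>A\<^esub>, \<zero>\<^bsub>B\<^esub>)"
  "u \<oplus>\<^bsub>sum_module A B\<^esub> v = (fst u \<oplus>\<^bsub>A\<^esub> fst v, snd u \<oplus>\<^bsub>B\<^esub> snd v)"
  "a \<odot>\<^bsub>sum_module A B\<^esub> u = (a \<odot>\<^bsub>A\<^esub> fst u, a \<odot>\<^bsub>B\<^esub> snd u)"
  by (simp_all add: sum_module_def)

lemma finite_sum_module_simps [simp]:
  "carrier (finite_sum_module I A) = (\<Pi>\<^sub>E i\<in>I. carrier (A i))"
  "\<zero>\<^bsub>finite_sum_module I A\<^esub> = (\<lambda>i\<in>I. \<zero>\<^bsub>A i\<^esub>)"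
  "u \<oplus>\<^bsub>finite_sum_module I A\<^esub> v = (\<lambda>i\<in>I. u i \<oplus>\<^bsub>A i\<^esub> v i)"
  "a \<odot>\<^bsub>finite_sum_module I A\<^esub> u = (\<lambda>i\<in>I. a \<odot>\<^bsub>A i\<^esub> u i)"
  by (simp_all add: finite_sum_module_def)

lemma ring_module_simps [simp]:
  "carrier (ring_module R) = carrier R" "\<zero>\<^bsub>ring_module R\<^esub> = \<zero>\<^bsub>R\<^esub>"
  "u \<oplus>\<^bsub>ring_module R\<^esub> v = u \<oplus>\<^bsub>R\<^esub> v" "a \<odot>\<^bsub>ring_module R\<^esub> u = a \<otimes>\<^bsub>R\<^esub> u"
  by (simp_all add: ring_module_def)

lemma module_sum:
  assumes "module R A" "module R B"
  shows "module R (sum_module A B)"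
proof -
  let ?S = "sum_module A B"
  interpret A: module R A by fact
  interpret B: module R B by fact
  have "abelian_group ?S"
  proof (rule abelian_groupI)
    show "\<exists>y\<in>carrier ?S. y \<oplus>\<^bsub>?S\<^esub> x = \<zero>\<^bsub>?S\<^esub>"
      if "x \<in> carrier ?S" for x
      using that by (intro bexI[of _ "(\<ominus>\<^bsub>A\<^esub> fst x, \<ominus>\<^bsub>B\<^esub> snd x)"]) (auto simp: A.M.l_neg B.M.l_neg)
  qed (simp_all add: mem_Times_iff A.M.a_ac B.M.a_ac)
  then show ?thesis
    by (intro moduleI A.R.is_cring)
      (simp_all add: mem_Times_iff A.smult_l_distr A.smult_r_distr A.smult_assoc1
        B.smult_l_distr B.smult_r_distr B.smult_assoc1)
qed

lemma restrict_eqI: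
  assumes "v \<in> Pi\<^sub>E I B" "\<And>i. i \<in> I \<Longrightarrow> u i = v i"
  shows "(\<lambda>i\<in>I. u i) = v"
  using assms by (metis PiE_restrict restrict_ext)

lemma module_finite_sum:
  assumes "cring R" "\<And>i. i \<in> I \<Longrightarrow> module R (A i)"
  shows "module R (finite_sum_module I A)"
proof -
  let ?S = "finite_sum_module I A"
  have ab: "abelian_group (A i)" if "i \<in> I" for i
    using assms(2)[OF that] by (simp add: module_def)
  then have am: "abelian_monoid (A i)" if "i \<in> I" for i
    using that by (simp add: abelian_group_def)
  note grp = abelian_monoid.a_closed[OF am] abelian_monoid.zero_closed[OF am]
    abelian_monoid.a_assoc[OF am] abelian_monoid.a_comm[OF am] abelian_monoid.l_zero[OF am] abelian_monoid.r_zero[OF am]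
    abelian_group.l_neg[OF ab] abelian_group.r_neg[OF ab] abelian_group.a_inv_closed[OF ab]
  note mdl = module.smult_closed[OF assms(2)] module.smult_l_distr[OF assms(2)]
    module.smult_r_distr[OF assms(2)] module.smult_assoc1[OF assms(2)] module.smult_one[OF assms(2)]
  have "abelian_group ?S"
  proof (rule abelian_groupI)
    fix x y z assume x: "x \<in> carrier ?S"
    then have x': "x i \<in> carrier (A i)" if "i \<in> I" for i using that by auto
    show "\<zero>\<^bsub>?S\<^esub> \<oplus>\<^bsub>?S\<^esub> x = x"
      unfolding finite_sum_module_simps by (rule restrict_eqI) (use x x' in \<open>simp_all add: grp\<close>)
    show "\<exists>y\<in>carrier ?S. y \<oplus>\<^bsub>?S\<^esub> x = \<zero>\<^bsub>?S\<^esub>"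
      by (intro bexI[of _ "\<lambda>i\<in>I. \<ominus>\<^bsub>A i\<^esub> x i"])
        (simp_all add: x' grp restrict_PiE_iff cong: restrict_cong)
    assume y: "y \<in> carrier ?S"
    then have y': "y i \<in> carrier (A i)" if "i \<in> I" for i using that by auto
    show "x \<oplus>\<^bsub>?S\<^esub> y \<in> carrier ?S"
      by (simp add: x' y' grp)
    show "x \<oplus>\<^bsub>?S\<^esub> y = y \<oplus>\<^bsub>?S\<^esub> x"
      by (simp add: x' y' grp cong: restrict_cong)
    assume z: "z \<in> carrier ?S"
    then have z': "z i \<in> carrier (A i)" if "i \<in> I" for i using that by auto
    show "(x \<oplus>\<^bsub>?S\<^esub> y) \<oplus>\<^bsub>?S\<^esub> z = x \<oplus>\<^bsub>?S\<^esub> (y \<oplus>\<^bsub>?S\<^esub> z)"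
      by (simp add: x' y' z' abelian_monoid.a_assoc[OF am] cong: restrict_cong)
  qed (simp add: grp)
  then show ?thesis
  proof (intro moduleI assms(1))
    fix a b x y assume x: "x \<in> carrier ?S"
    then have x': "x i \<in> carrier (A i)" if "i \<in> I" for i using that by auto
    show "\<one>\<^bsub>R\<^esub> \<odot>\<^bsub>?S\<^esub> x = x"
      unfolding finite_sum_module_simps by (rule restrict_eqI) (use x x' in \<open>simp_all add: mdl\<close>)
    assume a: "a \<in> carrier R"
    show "a \<odot>\<^bsub>?S\<^esub> x \<in> carrier ?S"
      by (simp add: a x' mdl)
    { assume b: "b \<in> carrier R"
      show "(a \<oplus>\<^bsub>R\<^esub> b) \<odot>\<^bsub>?S\<^esub> x = a \<odot>\<^bsub>?S\<^esub> x \<oplus>\<^bsub>?S\<^esub> b \<odot>\<^bsub>?S\<^esub> x"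
        by (simp add: a b x' mdl cong: restrict_cong)
      show "(a \<otimes>\<^bsub>R\<^esub> b) \<odot>\<^bsub>?S\<^esub> x = a \<odot>\<^bsub>?S\<^esub> (b \<odot>\<^bsub>?S\<^esub> x)"
        by (simp add: a b x' mdl cong: restrict_cong) }
    assume y: "y \<in> carrier ?S"
    then have y': "y i \<in> carrier (A i)" if "i \<in> I" for i using that by auto
    show "a \<odot>\<^bsub>?S\<^esub> (x \<oplus>\<^bsub>?S\<^esub> y) = a \<odot>\<^bsub>?S\<^esub> x \<oplus>\<^bsub>?S\<^esub> a \<odot>\<^bsub>?S\<^esub> y"
      by (simp add: a x' y' mdl cong: restrict_cong)
  qed
qed

lemma module_ring: "cring R \<Longrightarrow> module R (ring_module R)"
proof -
  assume "cring R"
  then interpret cring R .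
  have "abelian_group (ring_module R)"
  proof (rule abelian_groupI)
    show "\<exists>y\<in>carrier (ring_module R). y \<oplus>\<^bsub>ring_module R\<^esub> x = \<zero>\<^bsub>ring_module R\<^esub>"
      if "x \<in> carrier (ring_module R)" for x
      using that by (intro bexI[of _ "\<ominus>\<^bsub>R\<^esub> x"]) (simp_all add: l_neg)
  qed (simp_all add: a_ac)
  then show ?thesis
    by (intro moduleI is_cring) (auto simp: l_distr r_distr m_assoc)
qed

lemma module_free: "cring R \<Longrightarrow> module R (free_module R b)"
  unfolding free_module_def by (intro module_finite_sum module_ring)

lemma submodule_kernel:
  assumes "module R X" "module R Y" "f \<in> lin_maps R X Y"
  shows "submodule (a_kernel X Y f) R X"
proof -
  interpret X: module R X by fact
  interpret Y: module R Y by fact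
  show ?thesis
    by (rule X.submoduleI)
      (auto simp: mem_a_kernel lin_zero[OF assms] lin_neg[OF assms] lin_add[OF assms(3)] lin_smult[OF assms(3)])
qed

lemma submodule_image:
  assumes "module R X" "module R Y" "f \<in> lin_maps R X Y"
  shows "submodule (f ` carrier X) R Y"
proof -
  interpret X: module R X by fact
  interpret Y: module R Y by fact
  show ?thesis
  proof (rule Y.submoduleI)
    show "\<zero>\<^bsub>Y\<^esub> \<in> f ` carrier X" using lin_zero[OF assms] by (metis X.M.zero_closed imageI)
    show "\<ominus>\<^bsub>Y\<^esub> a \<in> f ` carrier X" if "a \<in> f ` carrier X" for a
      using that by (auto simp: lin_neg[OF assms, symmetric])
    show "a \<oplus>\<^bsub>Y\<^esub> b \<in> f ` carrier X" if "a \<in> f ` carrier X" "b \<in> f ` carrier X" for a b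
      using that by (auto simp: lin_add[OF assms(3), symmetric])
    show "c \<odot>\<^bsub>Y\<^esub> a \<in> f ` carrier X" if "c \<in> carrier R" "a \<in> f ` carrier X" for c a
      using that by (auto simp: lin_smult[OF assms(3), symmetric])
  qed (auto simp: lin_closed[OF assms(3)])
qed

definition kernel_module :: "('a, 'b, 'm) module_scheme \<Rightarrow> ('a, 'c, 'n) module_scheme \<Rightarrow> ('b \<Rightarrow> 'c) \<Rightarrow> ('a, 'b, 'm) module_scheme"
  where "kernel_module X Y f = X\<lparr>carrier := a_kernel X Y f\<rparr>"

definition fiber_prod :: "('a, 'b, 'm) module_scheme \<Rightarrow> ('a, 'c, 'n) module_scheme \<Rightarrow> ('b \<Rightarrow> 'd) \<Rightarrow> ('c \<Rightarrow> 'd)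
    \<Rightarrow> ('a, 'b \<times> 'c) module"
  where "fiber_prod X Y f g = (sum_module X Y)\<lparr>carrier := {(x, y). x \<in> carrier X \<and> y \<in> carrier Y \<and> f x = g y}\<rparr>"

lemma kernel_module_simps [simp]:
  "carrier (kernel_module X Y f) = a_kernel X Y f"
  "\<zero>\<^bsub>kernel_module X Y f\<^esub> = \<zero>\<^bsub>X\<^esub>"
  "u \<oplus>\<^bsub>kernel_module X Y f\<^esub> v = u \<oplus>\<^bsub>X\<^esub> v"
  "a \<odot>\<^bsub>kernel_module X Y f\<^esub> u = a \<odot>\<^bsub>X\<^esub> u"
  by (simp_all add: kernel_module_def)

lemma fiber_prod_simps [simp]:
  "carrier (fiber_prod X Y f g) = {(x, y). x \<in> carrier X \<and> y \<in> carrier Y \<and> f x = g y}"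
  "\<zero>\<^bsub>fiber_prod X Y f g\<^esub> = (\<zero>\<^bsub>X\<^esub>, \<zero>\<^bsub>Y\<^esub>)"
  "u \<oplus>\<^bsub>fiber_prod X Y f g\<^esub> v = (fst u \<oplus>\<^bsub>X\<^esub> fst v, snd u \<oplus>\<^bsub>Y\<^esub> snd v)"
  "a \<odot>\<^bsub>fiber_prod X Y f g\<^esub> u = (a \<odot>\<^bsub>X\<^esub> fst u, a \<odot>\<^bsub>Y\<^esub> snd u)"
  by (simp_all add: fiber_prod_def)

lemma module_kernel:
  assumes "module R X" "module R Y" "f \<in> lin_maps R X Y"
  shows "module R (kernel_module X Y f)"
  unfolding kernel_module_def
  by (rule submodule.submodule_is_module[OF submodule_kernel[OF assms] assms(1)])

lemma module_fiber_prod: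
  assumes "module R X" "module R Y" "module R Z" "f \<in> lin_maps R X Z" "g \<in> lin_maps R Y Z"
  shows "module R (fiber_prod X Y f g)"
proof -
  interpret X: module R X by fact
  interpret Y: module R Y by fact
  interpret XY: module R "sum_module X Y" by (rule module_sum) fact+
  have neg: "\<ominus>\<^bsub>sum_module X Y\<^esub> u = (\<ominus>\<^bsub>X\<^esub> fst u, \<ominus>\<^bsub>Y\<^esub> snd u)"
    if "u \<in> carrier X \<times> carrier Y" for u
    using that by (intro XY.M.minus_equality) (auto simp: X.M.l_neg Y.M.l_neg)
  have "submodule {(x, y). x \<in> carrier X \<and> y \<in> carrier Y \<and> f x = g y} R (sum_module X Y)"
  proof (rule XY.submoduleI)
    show "{(x, y). x \<in> carrier X \<and> y \<in> carrier Y \<and> f x = g y} \<subseteq> carrier (sum_module X Y)" by auto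
  qed (simp_all add: case_prod_beta mem_Times_iff neg lin_zero[OF assms(1,3,4)] lin_zero[OF assms(2,3,5)]
      lin_neg[OF assms(1,3,4)] lin_neg[OF assms(2,3,5)] lin_add[OF assms(4)] lin_add[OF assms(5)]
      lin_smult[OF assms(4)] lin_smult[OF assms(5)])
  from submodule.submodule_is_module[OF this XY.module_axioms] show ?thesis
    unfolding fiber_prod_def .
qed

lemma quot_module_simps [simp]:
  "carrier (quot_module X H) = a_rcosets\<^bsub>X\<^esub> H" "\<zero>\<^bsub>quot_module X H\<^esub> = H"
  "K \<oplus>\<^bsub>quot_module X H\<^esub> L = K <+>\<^bsub>X\<^esub> L"
  "a \<odot>\<^bsub>quot_module X H\<^esub> K = (\<Union>x\<in>K. H +>\<^bsub>X\<^esub> (a \<odot>\<^bsub>X\<^esub> x))"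
  by (simp_all add: quot_module_def)

text \<open>Everything about quotients is read off from the two facts that \<open>x \<mapsto> H + x\<close> is a surjective
  linear map and that its kernel is \<open>H\<close>.\<close>

lemma quot_module:
  assumes "module R X" "submodule H R X"
  shows module_quot: "module R (quot_module X H)"
    and quot_map_lin: "(\<lambda>x. H +>\<^bsub>X\<^esub> x) \<in> lin_maps R X (quot_module X H)"
    and quot_map_surj: "(\<lambda>x. H +>\<^bsub>X\<^esub> x) ` carrier X = carrier (quot_module X H)"
    and quot_map_zero_iff: "x \<in> carrier X \<Longrightarrow> H +>\<^bsub>X\<^esub> x = H \<longleftrightarrow> x \<in> H"
proof -
  interpret X: module R X by fact
  have sg: "subgroup H (add_monoid X)" using assms(2) by (rule submodule.axioms(1))
  interpret H: abelian_subgroup H X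
    by (rule abelian_subgroupI3) (use sg X.M.abelian_group_axioms in \<open>auto simp: additive_subgroup_def\<close>)
  have sub: "H \<subseteq> carrier X" by (rule H.a_subset)
  let ?p = "\<lambda>x. H +>\<^bsub>X\<^esub> x" and ?Q = "quot_module X H"
  show surj: "?p ` carrier X = carrier ?Q"
    by (auto simp: A_RCOSETS_def')
  have add: "?p x <+>\<^bsub>X\<^esub> ?p y = ?p (x \<oplus>\<^bsub>X\<^esub> y)" if "x \<in> carrier X" "y \<in> carrier X" for x y
    using that by (rule H.a_rcos_sum)
  have smult: "(\<Union>y\<in>?p x. H +>\<^bsub>X\<^esub> (a \<odot>\<^bsub>X\<^esub> y)) = ?p (a \<odot>\<^bsub>X\<^esub> x)"
    if "a \<in> carrier R" "x \<in> carrier X" for a x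
  proof -
    have "?p (a \<odot>\<^bsub>X\<^esub> y) = ?p (a \<odot>\<^bsub>X\<^esub> x)" if y: "y \<in> ?p x" for y
    proof -
      obtain h where h: "h \<in> H" "y = h \<oplus>\<^bsub>X\<^esub> x" using y by (auto simp: a_r_coset_def')
      then have "a \<odot>\<^bsub>X\<^esub> y = a \<odot>\<^bsub>X\<^esub> h \<oplus>\<^bsub>X\<^esub> a \<odot>\<^bsub>X\<^esub> x"
        using sub \<open>a \<in> carrier R\<close> \<open>x \<in> carrier X\<close> by (simp add: X.smult_r_distr subsetD)
      moreover have "a \<odot>\<^bsub>X\<^esub> h \<in> H"
        using h \<open>a \<in> carrier R\<close> submodule.smult_closed[OF assms(2)] by simp
      ultimately have "a \<odot>\<^bsub>X\<^esub> y \<in> ?p (a \<odot>\<^bsub>X\<^esub> x)" by (auto simp: a_r_coset_def')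
      then show ?thesis
        using X.M.a_repr_independence[OF _ _ sg] \<open>a \<in> carrier R\<close> \<open>x \<in> carrier X\<close> by simp
    qed
    moreover have "x \<in> ?p x" using \<open>x \<in> carrier X\<close> by (rule H.a_rcos_self)
    ultimately show ?thesis by (intro SUP_eq_const) blast+
  qed
  have zero: "?p \<zero>\<^bsub>X\<^esub> = H" using sub by (rule X.M.a_coset_add_zero)
  have "abelian_group ?Q"
  proof (rule abelian_groupI)
    fix K L P assume "K \<in> carrier ?Q"
    then obtain x where x: "K = ?p x" "x \<in> carrier X" unfolding surj[symmetric] by blast
    show "\<zero>\<^bsub>?Q\<^esub> \<oplus>\<^bsub>?Q\<^esub> K = K"
      using add[of "\<zero>\<^bsub>X\<^esub>" x] x by (simp add: zero)
    show "\<exists>y\<in>carrier ?Q. y \<oplus>\<^bsub>?Q\<^esub> K = \<zero>\<^bsub>?Q\<^esub>"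
      unfolding surj[symmetric]
      by (rule bexI[of _ "?p (\<ominus>\<^bsub>X\<^esub> x)"]) (simp_all add: x add X.M.l_neg zero)
    assume "L \<in> carrier ?Q"
    then obtain y where y: "L = ?p y" "y \<in> carrier X" unfolding surj[symmetric] by blast
    show "K \<oplus>\<^bsub>?Q\<^esub> L \<in> carrier ?Q"
      unfolding surj[symmetric] by (simp add: x y add)
    show "K \<oplus>\<^bsub>?Q\<^esub> L = L \<oplus>\<^bsub>?Q\<^esub> K" by (simp add: x y add X.M.a_comm)
    assume "P \<in> carrier ?Q"
    then obtain z where z: "P = ?p z" "z \<in> carrier X" unfolding surj[symmetric] by blast
    show "(K \<oplus>\<^bsub>?Q\<^esub> L) \<oplus>\<^bsub>?Q\<^esub> P = K \<oplus>\<^bsub>?Q\<^esub> (L \<oplus>\<^bsub>?Q\<^esub> P)" by (simp add: x y z add X.M.a_assoc)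
  next
    show "\<zero>\<^bsub>?Q\<^esub> \<in> carrier ?Q" unfolding surj[symmetric] using zero by auto
  qed
  then show "module R ?Q"
  proof (intro moduleI X.R.is_cring)
    fix a b K L assume "K \<in> carrier ?Q"
    then obtain x where x: "K = ?p x" "x \<in> carrier X" unfolding surj[symmetric] by blast
    show "\<one>\<^bsub>R\<^esub> \<odot>\<^bsub>?Q\<^esub> K = K" using x by (simp add: smult)
    assume a: "a \<in> carrier R"
    show "a \<odot>\<^bsub>?Q\<^esub> K \<in> carrier ?Q"
      unfolding surj[symmetric] using x a by (simp add: smult)
    { assume b: "b \<in> carrier R"
      show "(a \<oplus>\<^bsub>R\<^esub> b) \<odot>\<^bsub>?Q\<^esub> K = a \<odot>\<^bsub>?Q\<^esub> K \<oplus>\<^bsub>?Q\<^esub> b \<odot>\<^bsub>?Q\<^esub> K"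
        using x a b by (simp add: smult add X.smult_l_distr)
      show "(a \<otimes>\<^bsub>R\<^esub> b) \<odot>\<^bsub>?Q\<^esub> K = a \<odot>\<^bsub>?Q\<^esub> (b \<odot>\<^bsub>?Q\<^esub> K)"
        using x a b by (simp add: smult X.smult_assoc1) }
    assume "L \<in> carrier ?Q"
    then obtain y where y: "L = ?p y" "y \<in> carrier X" unfolding surj[symmetric] by blast
    show "a \<odot>\<^bsub>?Q\<^esub> (K \<oplus>\<^bsub>?Q\<^esub> L) = a \<odot>\<^bsub>?Q\<^esub> K \<oplus>\<^bsub>?Q\<^esub> a \<odot>\<^bsub>?Q\<^esub> L"
      using x y a by (simp add: smult add X.smult_r_distr)
  qed
  show "?p \<in> lin_maps R X ?Q"
    by (rule lin_mapsI) (auto simp: add smult surj[symmetric, simplified])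
  show "x \<in> carrier X \<Longrightarrow> ?p x = H \<longleftrightarrow> x \<in> H"
    using X.M.a_coset_join1[OF _ _ sg] X.M.a_coset_join2[OF _ sg] by blast
qed

section \<open>Isomorphisms and exact sequences\<close>

lemma bij_lin_inverse:
  assumes "module R X" "f \<in> lin_maps R X Y" "bij_betw f (carrier X) (carrier Y)"
  obtains g where "g \<in> lin_maps R Y X" "\<And>x. x \<in> carrier X \<Longrightarrow> g (f x) = x"
    "\<And>y. y \<in> carrier Y \<Longrightarrow> f (g y) = y"
proof
  interpret X: module R X by fact
  let ?g = "inv_into (carrier X) f"
  have inj: "inj_on f (carrier X)" and surj: "f ` carrier X = carrier Y"
    using assms(3) by (auto simp: bij_betw_def)
  show gf: "?g (f x) = x" if "x \<in> carrier X" for x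
    using inj that by (rule inv_into_f_f)
  show fg: "f (?g y) = y" if "y \<in> carrier Y" for y
    using that by (simp add: f_inv_into_f surj)
  have mem: "?g y \<in> carrier X" if "y \<in> carrier Y" for y
    using that by (simp add: inv_into_into surj)
  show "?g \<in> lin_maps R Y X"
  proof (rule lin_mapsI)
    fix x y a assume x: "x \<in> carrier Y"
    show "?g x \<in> carrier X" using x by (rule mem)
    { assume y: "y \<in> carrier Y"
      have "?g (f (?g x \<oplus>\<^bsub>X\<^esub> ?g y)) = ?g x \<oplus>\<^bsub>X\<^esub> ?g y"
        using x y by (intro gf) (simp add: mem)
      then show "?g (x \<oplus>\<^bsub>Y\<^esub> y) = ?g x \<oplus>\<^bsub>X\<^esub> ?g y"
        using x y by (simp add: lin_add[OF assms(2)] mem fg) }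
    { assume a: "a \<in> carrier R"
      have "?g (f (a \<odot>\<^bsub>X\<^esub> ?g x)) = a \<odot>\<^bsub>X\<^esub> ?g x"
        using x a by (intro gf) (simp add: mem)
      then show "?g (a \<odot>\<^bsub>Y\<^esub> x) = a \<odot>\<^bsub>X\<^esub> ?g x"
        using x a by (simp add: lin_smult[OF assms(2)] mem fg) }
  qed
qed

lemma module_isoI:
  assumes "module R X" "module R Y" "f \<in> lin_maps R X Y"
    and "\<And>y. y \<in> carrier Y \<Longrightarrow> g y \<in> carrier X"
    and "\<And>x. x \<in> carrier X \<Longrightarrow> g (f x) = x" "\<And>y. y \<in> carrier Y \<Longrightarrow> f (g y) = y"
  shows "module_iso R X Y"
proof -
  have "bij_betw f (carrier X) (carrier Y)"
    using assms lin_closed[OF assms(3)] by (intro bij_betwI[where g = g]) auto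
  then show ?thesis using assms unfolding module_iso_def by blast
qed

lemma module_isoE:
  assumes "module_iso R X Y"
  obtains f g where "module R X" "module R Y" "f \<in> lin_maps R X Y" "g \<in> lin_maps R Y X"
    "\<And>x. x \<in> carrier X \<Longrightarrow> g (f x) = x" "\<And>y. y \<in> carrier Y \<Longrightarrow> f (g y) = y"
proof -
  obtain f where f: "module R X" "module R Y" "f \<in> lin_maps R X Y" "bij_betw f (carrier X) (carrier Y)"
    using assms unfolding module_iso_def by blast
  obtain g where "g \<in> lin_maps R Y X" "\<And>x. x \<in> carrier X \<Longrightarrow> g (f x) = x"
    "\<And>y. y \<in> carrier Y \<Longrightarrow> f (g y) = y"
    using bij_lin_inverse[OF f(1,3,4)] by blast
  with f that show thesis by blast
qed

lemma module_iso_refl: "module R X \<Longrightarrow> module_iso R X X"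
  by (rule module_isoI[where f = "\<lambda>x. x" and g = "\<lambda>x. x"]) (auto intro: lin_id)

lemma module_iso_sym: "module_iso R X Y \<Longrightarrow> module_iso R Y X"
  by (elim module_isoE, rule module_isoI) (auto intro: lin_closed)

lemma module_iso_trans [trans]:
  assumes "module_iso R X Y" "module_iso R Y Z"
  shows "module_iso R X Z"
proof -
  obtain f g where f: "module R X" "module R Y" "f \<in> lin_maps R X Y" "g \<in> lin_maps R Y X"
    "\<And>x. x \<in> carrier X \<Longrightarrow> g (f x) = x" "\<And>y. y \<in> carrier Y \<Longrightarrow> f (g y) = y"
    using module_isoE[OF assms(1)] by blast
  obtain h k where h: "module R Y" "module R Z" "h \<in> lin_maps R Y Z" "k \<in> lin_maps R Z Y"
    "\<And>x. x \<in> carrier Y \<Longrightarrow> k (h x) = x" "\<And>y. y \<in> carrier Z \<Longrightarrow> h (k y) = y"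
    using module_isoE[OF assms(2)] by blast
  show ?thesis
    by (rule module_isoI[where f = "\<lambda>x. h (f x)" and g = "\<lambda>z. g (k z)"])
      (simp_all add: f h lin_comp[OF f(3) h(3)] lin_closed[OF f(3)] lin_closed[OF f(4)] lin_closed[OF h(4)])
qed

lemma module_iso_modules: "module_iso R X Y \<Longrightarrow> module R X" "module_iso R X Y \<Longrightarrow> module R Y"
  by (auto simp: module_iso_def)

lemma short_exactI:
  assumes "module R A" "module R B" "module R C" "f \<in> lin_maps R A B" "g \<in> lin_maps R B C"
    and "\<And>a. \<lbrakk>a \<in> carrier A; f a = \<zero>\<^bsub>B\<^esub>\<rbrakk> \<Longrightarrow> a = \<zero>\<^bsub>A\<^esub>"
    and "\<And>a. a \<in> carrier A \<Longrightarrow> g (f a) = \<zero>\<^bsub>C\<^esub>"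
    and "\<And>b. \<lbrakk>b \<in> carrier B; g b = \<zero>\<^bsub>C\<^esub>\<rbrakk> \<Longrightarrow> \<exists>a\<in>carrier A. f a = b"
    and "\<And>c. c \<in> carrier C \<Longrightarrow> \<exists>b\<in>carrier B. g b = c"
  shows "short_exact R A f B g C"
  unfolding short_exact_def
proof (intro conjI assms(1-5))
  show "inj_on f (carrier A)" using assms by (intro inj_on_linI)
  show "f ` carrier A = a_kernel B C g"
    using assms(7,8) lin_closed[OF assms(4)] by (force simp: mem_a_kernel)
  show "g ` carrier B = carrier C" using assms(9) lin_closed[OF assms(5)] by force
qed

lemma short_exactD:
  assumes "short_exact R A f B g C"
  shows "module R A" "module R B" "module R C" "f \<in> lin_maps R A B" "g \<in> lin_maps R B C"
    and "\<And>a. \<lbrakk>a \<in> carrier A; f a = \<zero>\<^bsub>B\<^esub>\<rbrakk> \<Longrightarrow> a = \<zero>\<^bsub>A\<^esub>"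
    and "\<And>a. a \<in> carrier A \<Longrightarrow> g (f a) = \<zero>\<^bsub>C\<^esub>"
    and "\<And>b. \<lbrakk>b \<in> carrier B; g b = \<zero>\<^bsub>C\<^esub>\<rbrakk> \<Longrightarrow> \<exists>a\<in>carrier A. f a = b"
    and "\<And>c. c \<in> carrier C \<Longrightarrow> \<exists>b\<in>carrier B. g b = c"
    and "inj_on f (carrier A)"
proof -
  show mods: "module R A" "module R B" "module R C" "f \<in> lin_maps R A B" "g \<in> lin_maps R B C"
    and inj: "inj_on f (carrier A)"
    using assms by (auto simp: short_exact_def)
  interpret A: module R A by fact
  have ker: "f ` carrier A = a_kernel B C g" and surj: "g ` carrier B = carrier C"
    using assms by (auto simp: short_exact_def)
  show "a = \<zero>\<^bsub>A\<^esub>" if "a \<in> carrier A" "f a = \<zero>\<^bsub>B\<^esub>" for a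
    using inj that lin_zero[OF mods(1,2,4)] by (metis A.M.zero_closed inj_onD)
  show "g (f a) = \<zero>\<^bsub>C\<^esub>" if "a \<in> carrier A" for a
    using ker that by (metis imageI mem_a_kernel)
  show "\<exists>a\<in>carrier A. f a = b" if "b \<in> carrier B" "g b = \<zero>\<^bsub>C\<^esub>" for b
    using ker that by (metis (no_types, lifting) imageE mem_a_kernel)
  show "\<exists>b\<in>carrier B. g b = c" if "c \<in> carrier C" for c
    using surj that by (metis (no_types, lifting) imageE)
qed

lemma short_exact_kernel:
  assumes "module R B" "module R C" "g \<in> lin_maps R B C" "g ` carrier B = carrier C"
  shows "short_exact R (kernel_module B C g) (\<lambda>x. x) B g C"
proof (rule short_exactI)
  show "(\<lambda>x. x) \<in> lin_maps R (kernel_module B C g) B"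
    by (rule lin_mapsI) (simp_all add: mem_a_kernel)
  show "\<exists>b\<in>carrier B. g b = c" if "c \<in> carrier C" for c
    using that assms(4) by (metis (no_types, lifting) imageE)
qed (use assms module_kernel in \<open>auto simp: mem_a_kernel\<close>)

lemma short_exact_quot:
  assumes "module R X" "submodule H R X"
  shows "short_exact R (X\<lparr>carrier := H\<rparr>) (\<lambda>x. x) X (\<lambda>x. H +>\<^bsub>X\<^esub> x) (quot_module X H)"
proof -
  interpret X: module R X by fact
  have sub: "H \<subseteq> carrier X" using X.submoduleE(1)[OF assms(2)] .
  show ?thesis
  proof (rule short_exactI)
    show "(\<lambda>x. x) \<in> lin_maps R (X\<lparr>carrier := H\<rparr>) X"
      using sub by (intro lin_mapsI) auto
    show "module R (X\<lparr>carrier := H\<rparr>)" using submodule.submodule_is_module[OF assms(2,1)] .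
    show "\<exists>b\<in>carrier X. H +>\<^bsub>X\<^esub> b = c" if "c \<in> carrier (quot_module X H)" for c
      using that unfolding quot_map_surj[OF assms, symmetric] by blast
  qed (use sub quot_module[OF assms] assms in \<open>simp_all add: subsetD\<close>)
qed

text \<open>All later maps out of a quotient or into a submodule come from these two universal properties, so
  that cosets and representatives never have to be handled again.\<close>

lemma short_exact_factor_quot:
  assumes "short_exact R A f B g C" "module R D" "h \<in> lin_maps R B D"
    and "\<And>a. a \<in> carrier A \<Longrightarrow> h (f a) = \<zero>\<^bsub>D\<^esub>"
  obtains k where "k \<in> lin_maps R C D" "\<And>b. b \<in> carrier B \<Longrightarrow> k (g b) = h b"
proof
  note se = short_exactD[OF assms(1)]
  interpret B: module R B by (rule se)
  interpret C: module R C by (rule se)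
  interpret D: module R D by fact
  define s where "s = inv_into (carrier B) g"
  have surj: "g ` carrier B = carrier C" using assms(1) by (simp add: short_exact_def)
  have s: "s c \<in> carrier B" "g (s c) = c" if "c \<in> carrier C" for c
    using that surj by (auto simp: s_def inv_into_into f_inv_into_f)
  have eq: "h b = h b'" if b: "b \<in> carrier B" "b' \<in> carrier B" "g b = g b'" for b b'
  proof -
    have "g (b \<ominus>\<^bsub>B\<^esub> b') = \<zero>\<^bsub>C\<^esub>"
      using b lin_closed[OF se(5)] by (simp add: lin_minus[OF se(2,3,5)] C.M.diff_zero_iff)
    then obtain a where a: "a \<in> carrier A" "f a = b \<ominus>\<^bsub>B\<^esub> b'" using se(8) b by blast
    then have "h b \<ominus>\<^bsub>D\<^esub> h b' = \<zero>\<^bsub>D\<^esub>"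
      using assms(4)[of a] b by (simp add: lin_minus[OF se(2) assms(2,3)])
    then show ?thesis using b lin_closed[OF assms(3)] by (simp add: D.M.diff_zero_iff)
  qed
  show k: "h (s (g b)) = h b" if "b \<in> carrier B" for b
    using that s lin_closed[OF se(5)] by (intro eq) simp_all
  show "(\<lambda>c. h (s c)) \<in> lin_maps R C D"
  proof (rule lin_mapsI)
    fix x y a assume x: "x \<in> carrier C"
    show "h (s x) \<in> carrier D" using x s lin_closed[OF assms(3)] by simp
    { assume y: "y \<in> carrier C"
      have "h (s (x \<oplus>\<^bsub>C\<^esub> y)) = h (s x \<oplus>\<^bsub>B\<^esub> s y)"
        using x y s by (intro eq) (simp_all add: lin_add[OF se(5)])
      then show "h (s (x \<oplus>\<^bsub>C\<^esub> y)) = h (s x) \<oplus>\<^bsub>D\<^esub> h (s y)"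
        using x y s by (simp add: lin_add[OF assms(3)]) }
    { assume a: "a \<in> carrier R"
      have "h (s (a \<odot>\<^bsub>C\<^esub> x)) = h (a \<odot>\<^bsub>B\<^esub> s x)"
        using x a s by (intro eq) (simp_all add: lin_smult[OF se(5)])
      then show "h (s (a \<odot>\<^bsub>C\<^esub> x)) = a \<odot>\<^bsub>D\<^esub> h (s x)"
        using x a s by (simp add: lin_smult[OF assms(3)]) }
  qed
qed

lemma short_exact_factor_sub:
  assumes "short_exact R A f B g C" "module R D" "h \<in> lin_maps R D B"
    and "\<And>d. d \<in> carrier D \<Longrightarrow> g (h d) = \<zero>\<^bsub>C\<^esub>"
  obtains k where "k \<in> lin_maps R D A" "\<And>d. d \<in> carrier D \<Longrightarrow> f (k d) = h d"
proof
  note se = short_exactD[OF assms(1)]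
  interpret A: module R A by (rule se)
  interpret D: module R D by fact
  define k where "k d = (SOME a. a \<in> carrier A \<and> f a = h d)" for d
  have k: "k d \<in> carrier A \<and> f (k d) = h d" if "d \<in> carrier D" for d
  proof -
    have "\<exists>a. a \<in> carrier A \<and> f a = h d"
      using se(8)[of "h d"] assms(4)[OF that] lin_closed[OF assms(3) that] by auto
    then show ?thesis unfolding k_def by (rule someI_ex)
  qed
  then show "f (k d) = h d" if "d \<in> carrier D" for d using that by simp
  show "k \<in> lin_maps R D A"
  proof (rule lin_mapsI)
    fix x y a assume x: "x \<in> carrier D"
    show "k x \<in> carrier A" using x k by simp
    { assume y: "y \<in> carrier D"
      show "k (x \<oplus>\<^bsub>D\<^esub> y) = k x \<oplus>\<^bsub>A\<^esub> k y"
        using x y k by (intro inj_onD[OF se(10)]) (simp_all add: lin_add[OF se(4)] lin_add[OF assms(3)]) }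
    { assume a: "a \<in> carrier R"
      show "k (a \<odot>\<^bsub>D\<^esub> x) = a \<odot>\<^bsub>A\<^esub> k x"
        using x a k by (intro inj_onD[OF se(10)]) (simp_all add: lin_smult[OF se(4)] lin_smult[OF assms(3)]) }
  qed
qed

lemma short_exact_sub_unique:
  assumes A: "short_exact R A f B g C" and A': "short_exact R A' f' B g C"
  shows "module_iso R A A'"
proof -
  note se = short_exactD[OF A] and se' = short_exactD[OF A']
  obtain k where k: "k \<in> lin_maps R A A'" "\<And>a. a \<in> carrier A \<Longrightarrow> f' (k a) = f a"
    using short_exact_factor_sub[OF A' se(1,4)] se(7) by blast
  obtain k' where k': "k' \<in> lin_maps R A' A" "\<And>a. a \<in> carrier A' \<Longrightarrow> f (k' a) = f' a"
    using short_exact_factor_sub[OF A se'(1,4)] se'(7) by blast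
  show ?thesis
  proof (rule module_isoI[OF se(1) se'(1) k(1), of k'])
    show "k' (k a) = a" if "a \<in> carrier A" for a
      using that lin_closed[OF k(1)] lin_closed[OF k'(1)] k(2) k'(2) by (intro inj_onD[OF se(10)]) simp_all
    show "k (k' a) = a" if "a \<in> carrier A'" for a
      using that lin_closed[OF k(1)] lin_closed[OF k'(1)] k(2) k'(2) by (intro inj_onD[OF se'(10)]) simp_all
  qed (rule lin_closed[OF k'(1)])
qed

text \<open>Here the two submodules may have different carrier types; only their images count.\<close>

lemma short_exact_quot_unique:
  assumes C: "short_exact R A f B g C" and C': "short_exact R A' f' B g' C'"
    and "f ` carrier A = f' ` carrier A'"
  shows "module_iso R C C'"
proof -
  note se = short_exactD[OF C] and se' = short_exactD[OF C']
  have z: "g' (f a) = \<zero>\<^bsub>C'\<^esub>" if "a \<in> carrier A" for a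
    using that assms(3) se'(7) by (metis (no_types, lifting) imageE imageI)
  have z': "g (f' a) = \<zero>\<^bsub>C\<^esub>" if "a \<in> carrier A'" for a
    using that assms(3) se(7) by (metis (no_types, lifting) imageE imageI)
  obtain k where k: "k \<in> lin_maps R C C'" "\<And>b. b \<in> carrier B \<Longrightarrow> k (g b) = g' b"
    using short_exact_factor_quot[OF C se'(3,5)] z by blast
  obtain k' where k': "k' \<in> lin_maps R C' C" "\<And>b. b \<in> carrier B \<Longrightarrow> k' (g' b) = g b"
    using short_exact_factor_quot[OF C' se(3,5)] z' by blast
  show ?thesis
  proof (rule module_isoI[OF se(3) se'(3) k(1), of k'])
    show "k' (k c) = c" if "c \<in> carrier C" for c
      using se(9)[OF that] k(2) k'(2) by auto
    show "k (k' c) = c" if "c \<in> carrier C'" for c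
      using se'(9)[OF that] k(2) k'(2) by auto
  qed (rule lin_closed[OF k'(1)])
qed

lemma short_exact_iso:
  assumes "short_exact R A f B g C" "module_iso R A A'" "module_iso R B B'" "module_iso R C C'"
  obtains f' g' where "short_exact R A' f' B' g' C'"
proof -
  note se = short_exactD[OF assms(1)]
  obtain hA kA where A: "module R A" "module R A'" "hA \<in> lin_maps R A A'" "kA \<in> lin_maps R A' A"
    "\<And>x. x \<in> carrier A \<Longrightarrow> kA (hA x) = x" "\<And>y. y \<in> carrier A' \<Longrightarrow> hA (kA y) = y"
    by (rule module_isoE[OF assms(2)]) (rule that)
  obtain hB kB where B: "module R B" "module R B'" "hB \<in> lin_maps R B B'" "kB \<in> lin_maps R B' B"
    "\<And>x. x \<in> carrier B \<Longrightarrow> kB (hB x) = x" "\<And>y. y \<in> carrier B' \<Longrightarrow> hB (kB y) = y"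
    by (rule module_isoE[OF assms(3)]) (rule that)
  obtain hC kC where C: "module R C" "module R C'" "hC \<in> lin_maps R C C'" "kC \<in> lin_maps R C' C"
    "\<And>x. x \<in> carrier C \<Longrightarrow> kC (hC x) = x" "\<And>y. y \<in> carrier C' \<Longrightarrow> hC (kC y) = y"
    by (rule module_isoE[OF assms(4)]) (rule that)
  have "short_exact R A' (\<lambda>a. hB (f (kA a))) B' (\<lambda>b. hC (g (kB b))) C'"
  proof (rule short_exactI[OF A(2) B(2) C(2) lin_comp[OF lin_comp[OF A(4) se(4)] B(3)]
        lin_comp[OF lin_comp[OF B(4) se(5)] C(3)]])
    fix a assume a: "a \<in> carrier A'"
    note ka = lin_closed[OF A(4) a] and fka = lin_closed[OF se(4) lin_closed[OF A(4) a]]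
    show "hC (g (kB (hB (f (kA a))))) = \<zero>\<^bsub>C'\<^esub>"
      using B(5)[OF fka] se(7)[OF ka] lin_zero[OF C(1-3)] by simp
    assume "hB (f (kA a)) = \<zero>\<^bsub>B'\<^esub>"
    then have "f (kA a) = \<zero>\<^bsub>B\<^esub>" using B(5)[OF fka] lin_zero[OF B(2,1,4)] by simp
    then show "a = \<zero>\<^bsub>A'\<^esub>" using se(6)[OF ka] A(6)[OF a] lin_zero[OF A(1-3)] by simp
  next
    fix b assume b: "b \<in> carrier B'" "hC (g (kB b)) = \<zero>\<^bsub>C'\<^esub>"
    note kb = lin_closed[OF B(4) b(1)]
    have "g (kB b) = \<zero>\<^bsub>C\<^esub>" using C(5)[OF lin_closed[OF se(5) kb]] b(2) lin_zero[OF C(2,1,4)] by simp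
    then obtain a where "a \<in> carrier A" "f a = kB b" using se(8)[OF kb] by blast
    then show "\<exists>a\<in>carrier A'. hB (f (kA a)) = b"
      using A(5) B(6)[OF b(1)] lin_closed[OF A(3)] by (intro bexI[of _ "hA a"]) simp_all
  next
    fix c assume c: "c \<in> carrier C'"
    then obtain b where "b \<in> carrier B" "g b = kC c" using se(9) lin_closed[OF C(4)] by blast
    then show "\<exists>b\<in>carrier B'. hC (g (kB b)) = c"
      using B(5) C(6)[OF c] lin_closed[OF B(3)] by (intro bexI[of _ "hB b"]) simp_all
  qed
  then show thesis by (rule that)
qed

section \<open>Direct sums, free modules and stable isomorphism\<close>

lemma module_iso_sum:
  assumes "module_iso R A A'" "module_iso R B B'"
  shows "module_iso R (sum_module A B) (sum_module A' B')"
proof -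
  obtain f g where f: "module R A" "module R A'" "f \<in> lin_maps R A A'" "g \<in> lin_maps R A' A"
    "\<And>x. x \<in> carrier A \<Longrightarrow> g (f x) = x" "\<And>y. y \<in> carrier A' \<Longrightarrow> f (g y) = y"
    using module_isoE[OF assms(1)] by blast
  obtain h k where h: "module R B" "module R B'" "h \<in> lin_maps R B B'" "k \<in> lin_maps R B' B"
    "\<And>x. x \<in> carrier B \<Longrightarrow> k (h x) = x" "\<And>y. y \<in> carrier B' \<Longrightarrow> h (k y) = y"
    using module_isoE[OF assms(2)] by blast
  have "(\<lambda>u. (f (fst u), h (snd u))) \<in> lin_maps R (sum_module A B) (sum_module A' B')"
    by (rule lin_mapsI) (simp_all add: mem_Times_iff lin_simps[OF f(3)] lin_simps[OF h(3)])
  then show ?thesis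
    by (rule module_isoI[where g = "\<lambda>u. (g (fst u), k (snd u))", rotated 2])
      (auto simp: f h module_sum lin_closed[OF f(4)] lin_closed[OF h(4)])
qed

lemma module_iso_sum_assoc:
  assumes "module R A" "module R B" "module R C"
  shows "module_iso R (sum_module (sum_module A B) C) (sum_module A (sum_module B C))"
  by (rule module_isoI[where f = "\<lambda>u. (fst (fst u), (snd (fst u), snd u))"
        and g = "\<lambda>u. ((fst u, fst (snd u)), snd (snd u))"])
    (auto simp: module_sum assms intro!: lin_mapsI)

lemma module_iso_sum_interchange:
  assumes "module R A" "module R B" "module R C" "module R D"
  shows "module_iso R (sum_module (sum_module A B) (sum_module C D))
    (sum_module (sum_module A C) (sum_module B D))"
  by (rule module_isoI[where f = "\<lambda>u. ((fst (fst u), fst (snd u)), (snd (fst u), snd (snd u)))"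
        and g = "\<lambda>u. ((fst (fst u), fst (snd u)), (snd (fst u), snd (snd u)))"])
    (auto simp: module_sum assms intro!: lin_mapsI)

lemma module_iso_sum_empty:
  assumes "module R X"
  shows "module_iso R (sum_module X (finite_sum_module {} A)) X"
proof -
  interpret X: module R X by fact
  have "module R (finite_sum_module {} A)"
    by (intro module_finite_sum X.R.is_cring) simp
  then show ?thesis
    by (intro module_isoI[where f = fst and g = "\<lambda>x. (x, \<lambda>_. undefined)"])
      (auto simp: module_sum assms intro!: lin_mapsI)
qed

lemma module_iso_sum_free_0:
  "module R X \<Longrightarrow> module_iso R (sum_module X (free_module R 0)) X"
  using module_iso_sum_empty by (simp add: free_module_def)

lemma finite_sum_module_Un:
  assumes "cring R" "\<And>i. i \<in> I \<union> J \<Longrightarrow> module R (A i)" "I \<inter> J = {}"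
  shows "module_iso R (finite_sum_module (I \<union> J) A) (sum_module (finite_sum_module I A) (finite_sum_module J A))"
    (is "module_iso R ?U ?S")
proof (rule module_isoI[where f = "\<lambda>u. (restrict u I, restrict u J)"
      and g = "\<lambda>v. \<lambda>i\<in>I \<union> J. if i \<in> I then fst v i else snd v i"])
  let ?g = "\<lambda>v. \<lambda>i\<in>I \<union> J. if i \<in> I then fst v i else snd v i"
  show "(\<lambda>u. (restrict u I, restrict u J)) \<in> lin_maps R ?U
      ?S"
  proof (rule lin_mapsI)
    fix u assume "u \<in> carrier ?U"
    then have "u i \<in> carrier (A i)" if "i \<in> I \<union> J" for i using that by auto
    then show "(restrict u I, restrict u J) \<in> carrier ?S"
      by simp
  qed (simp_all cong: restrict_cong)
  show "(?g v) \<in> carrier ?U"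
    if "v \<in> carrier ?S" for v
  proof -
    have "fst v i \<in> carrier (A i)" if "i \<in> I" for i using that \<open>v \<in> _\<close> by auto
    moreover have "snd v i \<in> carrier (A i)" if "i \<in> J" for i using that \<open>v \<in> _\<close> by auto
    ultimately show ?thesis by auto
  qed
  show "(\<lambda>i\<in>I \<union> J. if i \<in> I then fst (restrict u I, restrict u J) i else snd (restrict u I, restrict u J) i) = u"
    if "u \<in> carrier ?U" for u
    using that unfolding finite_sum_module_simps by (rule restrict_eqI) auto
  show "(restrict (?g v) I,
      restrict (?g v) J) = v"
    if "v \<in> carrier ?S" for v
  proof -
    have v: "fst v \<in> (\<Pi>\<^sub>E i\<in>I. carrier (A i))" "snd v \<in> (\<Pi>\<^sub>E i\<in>J. carrier (A i))"
      using that by auto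
    have "restrict (?g v) I = fst v"
      by (rule restrict_eqI[OF v(1)]) simp
    moreover have "restrict (?g v) J = snd v"
      by (rule restrict_eqI[OF v(2)]) (use assms(3) in auto)
    ultimately show ?thesis by simp
  qed
  show "module R ?U"
    "module R ?S"
    using assms(1,2) by (auto intro!: module_sum module_finite_sum)
qed

lemma finite_sum_module_reindex:
  assumes "cring R" "\<And>j. j \<in> J \<Longrightarrow> module R (A j)" "bij_betw p I J"
  shows "module_iso R (finite_sum_module I (\<lambda>i. A (p i))) (finite_sum_module J A)"
proof (rule module_isoI[where f = "\<lambda>u. \<lambda>j\<in>J. u (inv_into I p j)" and g = "\<lambda>v. \<lambda>i\<in>I. v (p i)"])
  have p: "p i \<in> J" if "i \<in> I" for i using assms(3) that by (auto simp: bij_betw_def)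
  have q: "inv_into I p j \<in> I" "p (inv_into I p j) = j" if "j \<in> J" for j
    using assms(3) that by (auto simp: bij_betw_def inv_into_into f_inv_into_f)
  have qp: "inv_into I p (p i) = i" if "i \<in> I" for i
    using assms(3) that by (simp add: bij_betw_def)
  show "(\<lambda>u. \<lambda>j\<in>J. u (inv_into I p j)) \<in> lin_maps R (finite_sum_module I (\<lambda>i. A (p i))) (finite_sum_module J A)"
  proof (rule lin_mapsI)
    show "(\<lambda>j\<in>J. u (inv_into I p j)) \<in> carrier (finite_sum_module J A)"
      if "u \<in> carrier (finite_sum_module I (\<lambda>i. A (p i)))" for u
    proof -
      have "u (inv_into I p j) \<in> carrier (A j)" if "j \<in> J" for j
        using PiE_mem[of u I "\<lambda>i. carrier (A (p i))" "inv_into I p j"] \<open>u \<in> _\<close> q that by simp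
      then show ?thesis by simp
    qed
  qed (simp_all add: q cong: restrict_cong)
  show "(\<lambda>i\<in>I. v (p i)) \<in> carrier (finite_sum_module I (\<lambda>i. A (p i)))"
    if "v \<in> carrier (finite_sum_module J A)" for v
  proof -
    have "v j \<in> carrier (A j)" if "j \<in> J" for j using \<open>v \<in> _\<close> that by auto
    then show ?thesis using p by simp
  qed
  show "(\<lambda>i\<in>I. (\<lambda>j\<in>J. u (inv_into I p j)) (p i)) = u" if "u \<in> carrier (finite_sum_module I (\<lambda>i. A (p i)))" for u
    using that unfolding finite_sum_module_simps by (rule restrict_eqI) (simp add: p qp)
  show "(\<lambda>j\<in>J. (\<lambda>i\<in>I. v (p i)) (inv_into I p j)) = v" if "v \<in> carrier (finite_sum_module J A)" for v
    using that unfolding finite_sum_module_simps by (rule restrict_eqI) (simp add: q)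
  show "module R (finite_sum_module I (\<lambda>i. A (p i)))" "module R (finite_sum_module J A)"
    using assms(1,2) p by (simp_all add: module_finite_sum)
qed

lemma finite_sum_module_iso:
  assumes "cring R" "\<And>i. i \<in> I \<Longrightarrow> module_iso R (A i) (B i)"
  shows "module_iso R (finite_sum_module I A) (finite_sum_module I B)"
proof -
  have "\<exists>f g. f \<in> lin_maps R (A i) (B i) \<and> g \<in> lin_maps R (B i) (A i) \<and>
     (\<forall>x\<in>carrier (A i). g (f x) = x) \<and> (\<forall>y\<in>carrier (B i). f (g y) = y)" if "i \<in> I" for i
    by (rule module_isoE[OF assms(2)[OF that]]) blast
  then obtain f g where f: "\<And>i. i \<in> I \<Longrightarrow> f i \<in> lin_maps R (A i) (B i)"
    and g: "\<And>i. i \<in> I \<Longrightarrow> g i \<in> lin_maps R (B i) (A i)"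
    and gf: "\<And>i x. i \<in> I \<Longrightarrow> x \<in> carrier (A i) \<Longrightarrow> g i (f i x) = x"
    and fg: "\<And>i x. i \<in> I \<Longrightarrow> x \<in> carrier (B i) \<Longrightarrow> f i (g i x) = x"
    by metis
  let ?A = "finite_sum_module I A" and ?B = "finite_sum_module I B"
  have mem: "u i \<in> carrier (A i)" if "u \<in> carrier (finite_sum_module I A)" "i \<in> I" for u i A
    using that by auto
  have ext: "restrict u I = u" if "u \<in> carrier (finite_sum_module I A)" for u A
    using that by (simp add: PiE_restrict)
  show ?thesis
  proof (rule module_isoI[where f = "\<lambda>u. \<lambda>i\<in>I. f i (u i)" and g = "\<lambda>u. \<lambda>i\<in>I. g i (u i)"])
    show "(\<lambda>u. \<lambda>i\<in>I. f i (u i)) \<in> lin_maps R ?A ?B"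
    proof (rule lin_mapsI)
      fix u v a assume u: "u \<in> carrier ?A"
      show "(\<lambda>i\<in>I. f i (u i)) \<in> carrier ?B"
        using mem[OF u] lin_closed[OF f] by simp
      { assume v: "v \<in> carrier ?A"
        show "(\<lambda>i\<in>I. f i ((u \<oplus>\<^bsub>?A\<^esub> v) i))
            = (\<lambda>i\<in>I. f i (u i)) \<oplus>\<^bsub>?B\<^esub> (\<lambda>i\<in>I. f i (v i))"
          using mem[OF u] mem[OF v] by (simp add: lin_add[OF f] cong: restrict_cong) }
      { assume a: "a \<in> carrier R"
        show "(\<lambda>i\<in>I. f i ((a \<odot>\<^bsub>?A\<^esub> u) i))
            = a \<odot>\<^bsub>?B\<^esub> (\<lambda>i\<in>I. f i (u i))"
          using mem[OF u] a by (simp add: lin_smult[OF f] cong: restrict_cong) }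
    qed
    show "(\<lambda>i\<in>I. g i (u i)) \<in> carrier ?A" if "u \<in> carrier ?B" for u
      using mem[OF that] lin_closed[OF g] by simp
    show "(\<lambda>i\<in>I. g i ((\<lambda>i\<in>I. f i (u i)) i)) = u" if "u \<in> carrier ?A" for u
      using mem[OF that] ext[OF that] by (simp add: gf cong: restrict_cong)
    show "(\<lambda>i\<in>I. f i ((\<lambda>i\<in>I. g i (u i)) i)) = u" if "u \<in> carrier ?B" for u
      using mem[OF that] ext[OF that] by (simp add: fg cong: restrict_cong)
  qed (use assms module_iso_modules in \<open>blast intro: module_finite_sum\<close>)+
qed

lemma finite_sum_module_single:
  assumes "module R (A i)"
  shows "module_iso R (finite_sum_module {i} A) (A i)"
proof -
  interpret A: module R "A i" by fact
  show ?thesis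
  proof (rule module_isoI[where f = "\<lambda>u. u i" and g = "\<lambda>x. \<lambda>j\<in>{i}. x"])
    show "(\<lambda>j\<in>{i}. u i) = u" if "u \<in> carrier (finite_sum_module {i} A)" for u
      using that unfolding finite_sum_module_simps by (rule restrict_eqI) simp
  qed (use assms A.R.is_cring in \<open>auto intro!: module_finite_sum lin_mapsI\<close>)
qed

lemma finite_sum_module_insert:
  assumes "cring R" "\<And>j. j \<in> insert i I \<Longrightarrow> module R (A j)" "i \<notin> I"
  shows "module_iso R (finite_sum_module (insert i I) A) (sum_module (A i) (finite_sum_module I A))"
proof -
  have "module_iso R (finite_sum_module ({i} \<union> I) A) (sum_module (finite_sum_module {i} A) (finite_sum_module I A))"
    using assms by (intro finite_sum_module_Un) auto
  also have "module_iso R \<dots> (sum_module (A i) (finite_sum_module I A))"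
    using assms by (intro module_iso_sum finite_sum_module_single module_iso_refl module_finite_sum) auto
  finally show ?thesis by simp
qed

lemma free_module_add:
  assumes "cring R"
  shows "module_iso R (sum_module (free_module R p) (free_module R q)) (free_module R (p + q))"
proof -
  let ?A = "\<lambda>_::nat. ring_module R"
  let ?P = "free_module R p" and ?Q = "free_module R q" and ?T = "finite_sum_module {p..<p + q} ?A"
  have un: "{..<p} \<union> {p..<p + q} = {..<p + q}" by auto
  have "module_iso R (free_module R (p + q)) (sum_module ?P ?T)"
    unfolding free_module_def un[symmetric]
    using assms by (intro finite_sum_module_Un module_ring) auto
  also have "module_iso R (finite_sum_module {..<q} ?A) ?T"
  proof (rule finite_sum_module_reindex)
    show "bij_betw ((+) p) {..<q} {p..<p + q}"
      by (rule bij_betw_byWitness[where f' = "\<lambda>j. j - p"]) auto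
  qed (use assms module_ring in auto)
  then have "module_iso R (sum_module ?P ?T)
      (sum_module ?P ?Q)"
    unfolding free_module_def[of R q]
    by (intro module_iso_sum module_iso_refl module_free assms) (rule module_iso_sym)
  finally show ?thesis by (rule module_iso_sym)
qed

text \<open>Free modules of finite rank are projective. Projectivity with respect to one fixed surjection
  passes to direct sums, so the rank one case suffices.\<close>

lemma free_module_lift:
  assumes "module R X" "module R Y" "g \<in> lin_maps R X Y"
    and surj: "\<And>y. y \<in> carrier Y \<Longrightarrow> \<exists>x\<in>carrier X. g x = y"
    and "f \<in> lin_maps R (free_module R b) Y"
  shows "\<exists>h\<in>lin_maps R (free_module R b) X. \<forall>u\<in>carrier (free_module R b). g (h u) = f u"
  using assms(5)
proof (induction b arbitrary: f)
  interpret X: module R X by fact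
  interpret Y: module R Y by fact
  case 0
  have "f u = \<zero>\<^bsub>Y\<^esub>" if "u \<in> carrier (free_module R 0)" for u
  proof -
    have "u = \<zero>\<^bsub>free_module R 0\<^esub>" using that by (auto simp: free_module_def fun_eq_iff)
    then show ?thesis using lin_zero[OF module_free[OF X.R.is_cring] assms(2) 0] by simp
  qed
  then show ?case
    using lin_zero[OF assms(1-3)] by (intro bexI[of _ "\<lambda>_. \<zero>\<^bsub>X\<^esub>"] lin_zero_map assms(1)) simp
next
  interpret X: module R X by fact
  interpret Y: module R Y by fact
  case (Suc b)
  let ?F = "free_module R"
  have fin: "{..<Suc b} = insert b {..<b}" by auto
  let ?S = "sum_module (ring_module R) (?F b)"
  have iso: "module_iso R (?F (Suc b)) ?S"
    unfolding free_module_def fin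
    using X.R.is_cring by (intro finite_sum_module_insert module_ring) auto
  obtain k l where k: "module R (?F (Suc b))" "module R ?S"
    "k \<in> lin_maps R (?F (Suc b)) ?S"
    "l \<in> lin_maps R ?S (?F (Suc b))"
    "\<And>u. u \<in> carrier (?F (Suc b)) \<Longrightarrow> l (k u) = u"
    by (rule module_isoE[OF iso]) (rule that)
  interpret F: module R "?F b" by (intro module_free X.R.is_cring)
  have "(\<lambda>v. (\<zero>\<^bsub>R\<^esub>, v)) \<in> lin_maps R (?F b) ?S"
    by (rule lin_mapsI) simp_all
  then have "(\<lambda>v. f (l (\<zero>\<^bsub>R\<^esub>, v))) \<in> lin_maps R (?F b) Y"
    by (rule lin_comp[OF lin_comp[OF _ k(4)] Suc.prems])
  then obtain h where h: "h \<in> lin_maps R (?F b) X" "\<And>v. v \<in> carrier (?F b) \<Longrightarrow> g (h v) = f (l (\<zero>\<^bsub>R\<^esub>, v))"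
    using Suc.IH by blast
  have l1: "(\<one>\<^bsub>R\<^esub>, \<zero>\<^bsub>?F b\<^esub>) \<in> carrier ?S" by simp
  then have "f (l (\<one>\<^bsub>R\<^esub>, \<zero>\<^bsub>?F b\<^esub>)) \<in> carrier Y"
    using lin_closed[OF k(4)] lin_closed[OF Suc.prems] by blast
  then obtain x where x: "x \<in> carrier X" "g x = f (l (\<one>\<^bsub>R\<^esub>, \<zero>\<^bsub>?F b\<^esub>))" using surj by blast
  have m: "(\<lambda>u. fst u \<odot>\<^bsub>X\<^esub> x \<oplus>\<^bsub>X\<^esub> h (snd u)) \<in> lin_maps R ?S X"
  proof (rule lin_plus[OF assms(1)])
    show "(\<lambda>u. fst u \<odot>\<^bsub>X\<^esub> x) \<in> lin_maps R ?S X"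
      using x by (intro lin_mapsI) (simp_all add: mem_Times_iff X.smult_l_distr X.smult_assoc1)
    have "snd \<in> lin_maps R ?S (?F b)"
      by (rule lin_mapsI) auto
    then show "(\<lambda>u. h (snd u)) \<in> lin_maps R ?S X"
      using h(1) by (rule lin_comp)
  qed
  note fl = lin_comp[OF k(4) Suc.prems]
  have val: "g (fst u \<odot>\<^bsub>X\<^esub> x \<oplus>\<^bsub>X\<^esub> h (snd u)) = f (l u)" if u: "u \<in> carrier ?S" for u
  proof -
    obtain r v where uv: "u = (r, v)" "r \<in> carrier R" "v \<in> carrier (?F b)" using u by auto
    have "f (l u) = f (l (r \<odot>\<^bsub>?S\<^esub> (\<one>\<^bsub>R\<^esub>, \<zero>\<^bsub>?F b\<^esub>)
        \<oplus>\<^bsub>?S\<^esub> (\<zero>\<^bsub>R\<^esub>, v)))"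
      using uv by simp
    also have "\<dots> = r \<odot>\<^bsub>Y\<^esub> f (l (\<one>\<^bsub>R\<^esub>, \<zero>\<^bsub>?F b\<^esub>)) \<oplus>\<^bsub>Y\<^esub> f (l (\<zero>\<^bsub>R\<^esub>, v))"
    proof -
      have v: "(\<zero>\<^bsub>R\<^esub>, v) \<in> carrier ?S" using uv by simp
      show ?thesis
        using lin_add[OF fl module.smult_closed[OF k(2) uv(2) l1] v] lin_smult[OF fl uv(2) l1] by simp
    qed
    finally show ?thesis
      using uv x h by (simp add: lin_add[OF assms(3)] lin_smult[OF assms(3)] lin_closed[OF h(1)])
  qed
  show ?case
  proof (intro bexI ballI)
    show "(\<lambda>u. fst (k u) \<odot>\<^bsub>X\<^esub> x \<oplus>\<^bsub>X\<^esub> h (snd (k u))) \<in> lin_maps R (?F (Suc b)) X"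
      using lin_comp[OF k(3) m] .
    show "g (fst (k u) \<odot>\<^bsub>X\<^esub> x \<oplus>\<^bsub>X\<^esub> h (snd (k u))) = f u" if "u \<in> carrier (?F (Suc b))" for u
      using val[OF lin_closed[OF k(3) that]] k(5)[OF that] by simp
  qed
qed

text \<open>The identity of \<open>R\<^sup>b\<close> lifts to a section \<open>s\<close> of \<open>g\<close>, and \<open>x - s (g x)\<close> lies in the image of \<open>f\<close>.\<close>

lemma short_exact_split:
  assumes "short_exact R A f X g (free_module R b)"
  shows "module_iso R X (sum_module A (free_module R b))"
proof -
  let ?F = "free_module R b"
  note se = short_exactD[OF assms]
  interpret A: module R A by (rule se)
  interpret X: module R X by (rule se)
  interpret F: module R "?F" by (rule se)
  obtain s where s: "s \<in> lin_maps R ?F X" "\<And>u. u \<in> carrier ?F \<Longrightarrow> g (s u) = u"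
    using free_module_lift[OF se(2,3,5,9) lin_id] by blast
  have "(\<lambda>x. x \<ominus>\<^bsub>X\<^esub> s (g x)) \<in> lin_maps R X X"
    by (rule lin_diff[OF se(2) lin_id lin_comp[OF se(5) s(1)]])
  moreover have "g (x \<ominus>\<^bsub>X\<^esub> s (g x)) = \<zero>\<^bsub>?F\<^esub>" if "x \<in> carrier X" for x
    using that lin_closed[OF se(5)] lin_closed[OF s(1)] s(2)
    by (simp add: lin_minus[OF se(2,3,5)] F.M.diff_zero_iff)
  ultimately obtain k where k: "k \<in> lin_maps R X A" "\<And>x. x \<in> carrier X \<Longrightarrow> f (k x) = x \<ominus>\<^bsub>X\<^esub> s (g x)"
    using short_exact_factor_sub[OF assms se(2)] by blast
  have kg: "(\<lambda>x. (k x, g x)) \<in> lin_maps R X (sum_module A ?F)"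
    by (rule lin_mapsI) (simp_all add: lin_simps[OF k(1)] lin_simps[OF se(5)])
  have mem: "f a \<in> carrier X" "s r \<in> carrier X" if "a \<in> carrier A" "r \<in> carrier ?F" for a r
    using that lin_closed[OF se(4)] lin_closed[OF s(1)] by auto
  have g: "g (f a \<oplus>\<^bsub>X\<^esub> s r) = r" if "a \<in> carrier A" "r \<in> carrier ?F" for a r
    using that mem by (simp add: lin_add[OF se(5)] se(7) s(2))
  have kk: "k (f a \<oplus>\<^bsub>X\<^esub> s r) = a" if ar: "a \<in> carrier A" "r \<in> carrier ?F" for a r
  proof (rule inj_onD[OF se(10)])
    show "f (k (f a \<oplus>\<^bsub>X\<^esub> s r)) = f a"
      using mem[OF ar] by (simp add: k(2) g[OF ar]) algebra
  qed (use ar mem lin_closed[OF k(1)] in auto)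
  show ?thesis
  proof (rule module_isoI[OF se(2) module_sum[OF se(1,3)] kg, of "\<lambda>u. f (fst u) \<oplus>\<^bsub>X\<^esub> s (snd u)"])
    show "f (fst u) \<oplus>\<^bsub>X\<^esub> s (snd u) \<in> carrier X" if "u \<in> carrier (sum_module A ?F)" for u
      using that mem by auto
    show "f (fst (k x, g x)) \<oplus>\<^bsub>X\<^esub> s (snd (k x, g x)) = x" if "x \<in> carrier X" for x
    proof -
      have "s (g x) \<in> carrier X" using that lin_closed[OF se(5)] lin_closed[OF s(1)] by simp
      then show ?thesis using that by (simp add: k(2)) algebra
    qed
    show "(k (f (fst u) \<oplus>\<^bsub>X\<^esub> s (snd u)), g (f (fst u) \<oplus>\<^bsub>X\<^esub> s (snd u))) = u"
      if "u \<in> carrier (sum_module A ?F)" for u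
      using that by (auto simp: g kk)
  qed
qed

lemma short_exact_sum:
  assumes "short_exact R A f B g C" "short_exact R A' f' B' g' C'"
  shows "short_exact R (sum_module A A') (\<lambda>u. (f (fst u), f' (snd u))) (sum_module B B')
    (\<lambda>u. (g (fst u), g' (snd u))) (sum_module C C')"
proof -
  note s = short_exactD[OF assms(1)] and t = short_exactD[OF assms(2)]
  show ?thesis
  proof (rule short_exactI)
    show "\<exists>a\<in>carrier (sum_module A A'). (f (fst a), f' (snd a)) = b"
      if b: "b \<in> carrier (sum_module B B')" "(g (fst b), g' (snd b)) = \<zero>\<^bsub>sum_module C C'\<^esub>" for b
    proof -
      obtain x y where "x \<in> carrier A" "f x = fst b" "y \<in> carrier A'" "f' y = snd b"
        using b s(8)[of "fst b"] t(8)[of "snd b"] by (auto simp: mem_Times_iff)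
      then show ?thesis by (intro bexI[of _ "(x, y)"]) simp_all
    qed
    show "\<exists>b\<in>carrier (sum_module B B'). (g (fst b), g' (snd b)) = c" if c: "c \<in> carrier (sum_module C C')" for c
    proof -
      obtain x y where "x \<in> carrier B" "g x = fst c" "y \<in> carrier B'" "g' y = snd c"
        using c s(9)[of "fst c"] t(9)[of "snd c"] by (auto simp: mem_Times_iff)
      then show ?thesis by (intro bexI[of _ "(x, y)"]) simp_all
    qed
  qed (auto intro!: module_sum lin_mapsI s t simp: lin_simps[OF s(4)] lin_simps[OF s(5)]
      lin_simps[OF t(4)] lin_simps[OF t(5)] s(7) t(7))
qed

lemma short_exact_id_quot:
  assumes "module R X"
  shows "short_exact R (free_module R 0) (\<lambda>_. \<zero>\<^bsub>X\<^esub>) X (\<lambda>x. x) X"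
proof -
  interpret X: module R X by fact
  show ?thesis
    using module_free[OF X.R.is_cring, of 0] assms
    by (intro short_exactI lin_id lin_zero_map) (auto simp: free_module_def fun_eq_iff)
qed

lemma short_exact_id_sub:
  assumes "module R X"
  shows "short_exact R X (\<lambda>x. x) X (\<lambda>_. \<zero>\<^bsub>free_module R 0\<^esub>) (free_module R 0)"
proof -
  interpret X: module R X by fact
  show ?thesis
    using module_free[OF X.R.is_cring, of 0] assms
    by (intro short_exactI lin_id lin_zero_map) (auto simp: free_module_def fun_eq_iff)
qed

lemma short_exact_fiber_prod:
  assumes "short_exact R K f Y q X" "module R Z" "h \<in> lin_maps R Z X"
  shows "short_exact R K (\<lambda>k. (\<zero>\<^bsub>Z\<^esub>, f k)) (fiber_prod Z Y h q) fst Z"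
proof -
  note se = short_exactD[OF assms(1)]
  interpret Z: module R Z by fact
  interpret X: module R X by (rule se)
  interpret Y: module R Y by (rule se)
  show ?thesis
  proof (rule short_exactI)
    show "module R (fiber_prod Z Y h q)" by (rule module_fiber_prod[OF assms(2) se(2,3) assms(3) se(5)])
    show "fst \<in> lin_maps R (fiber_prod Z Y h q) Z" by (rule lin_mapsI) auto
    show "(\<lambda>k. (\<zero>\<^bsub>Z\<^esub>, f k)) \<in> lin_maps R K (fiber_prod Z Y h q)"
      by (rule lin_mapsI) (auto simp: lin_simps[OF se(4)] se(7) lin_zero[OF assms(2) se(3) assms(3)])
    show "\<exists>a\<in>carrier K. (\<zero>\<^bsub>Z\<^esub>, f a) = b" if "b \<in> carrier (fiber_prod Z Y h q)" "fst b = \<zero>\<^bsub>Z\<^esub>" for b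
      using that se(8)[of "snd b"] by (auto simp: lin_zero[OF assms(2) se(3) assms(3)])
    show "\<exists>b\<in>carrier (fiber_prod Z Y h q). fst b = z" if "z \<in> carrier Z" for z
      using se(9)[of "h z"] that lin_closed[OF assms(3) that] by force
  qed (simp_all add: se(1,6) assms(2))
qed

lemma fiber_prod_swap:
  assumes "module R X" "module R Y" "module R Z" "f \<in> lin_maps R X Z" "g \<in> lin_maps R Y Z"
  shows "module_iso R (fiber_prod X Y f g) (fiber_prod Y X g f)"
proof (rule module_isoI[where f = "\<lambda>u. (snd u, fst u)" and g = "\<lambda>u. (snd u, fst u)"])
  show "module R (fiber_prod X Y f g)" by (rule module_fiber_prod[OF assms])
  show "module R (fiber_prod Y X g f)" by (rule module_fiber_prod[OF assms(2,1,3,5,4)])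
  show "(\<lambda>u. (snd u, fst u)) \<in> lin_maps R (fiber_prod X Y f g) (fiber_prod Y X g f)"
    by (rule lin_mapsI) auto
qed auto

text \<open>Schanuel's lemma: the fibre product of the two covers is an extension of either free module by
  the kernel of the other cover, and both extensions split.\<close>

lemma schanuel:
  assumes "short_exact R K f (free_module R b) q X" "short_exact R K' f' (free_module R b') q' X"
  shows "module_iso R (sum_module K (free_module R b')) (sum_module K' (free_module R b))"
proof -
  note s = short_exactD[OF assms(1)] and t = short_exactD[OF assms(2)]
  have "module_iso R (sum_module K (free_module R b')) (fiber_prod (free_module R b') (free_module R b) q' q)"
    by (rule module_iso_sym[OF short_exact_split[OF short_exact_fiber_prod[OF assms(1) t(2,5)]]])
  also have "module_iso R \<dots> (fiber_prod (free_module R b) (free_module R b') q q')"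
    by (rule fiber_prod_swap[OF t(2) s(2,3) t(5) s(5)])
  also have "module_iso R \<dots> (sum_module K' (free_module R b))"
    by (rule short_exact_split[OF short_exact_fiber_prod[OF assms(2) s(2,5)]])
  finally show ?thesis .
qed

text \<open>The kernel of a composite of two covers is an extension of the second kernel by the first. When \<open>A\<close> is
  free this extension splits, so covering \<open>C\<close> through \<open>B\<close> changes the syzygy of \<open>B\<close> by a free summand only.\<close>

lemma short_exact_compose:
  assumes "short_exact R K f H q B" "short_exact R A a B c C"
  obtains k where "short_exact R (kernel_module H C (\<lambda>h. c (q h))) (\<lambda>h. h) H (\<lambda>h. c (q h)) C"
    and "short_exact R K f (kernel_module H C (\<lambda>h. c (q h))) k A"
proof -
  note s = short_exactD[OF assms(1)] and t = short_exactD[OF assms(2)]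
  interpret B: module R B by (rule s)
  have cq: "(\<lambda>h. c (q h)) \<in> lin_maps R H C" by (rule lin_comp[OF s(5) t(5)])
  let ?K = "kernel_module H C (\<lambda>h. c (q h))"
  have K: "module R ?K" by (rule module_kernel[OF s(2) t(3) cq])
  have surj: "(\<lambda>h. c (q h)) ` carrier H = carrier C"
  proof
    show "carrier C \<subseteq> (\<lambda>h. c (q h)) ` carrier H"
    proof
      fix z assume "z \<in> carrier C"
      then obtain b where b: "b \<in> carrier B" "c b = z" using t(9) by blast
      then obtain h where "h \<in> carrier H" "q h = b" using s(9) by blast
      then show "z \<in> (\<lambda>h. c (q h)) ` carrier H" using b by blast
    qed
  qed (use lin_closed[OF cq] in blast)
  have q: "q \<in> lin_maps R ?K B"
    by (rule lin_mapsI) (simp_all add: mem_a_kernel lin_simps[OF s(5)])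
  obtain k where k: "k \<in> lin_maps R ?K A" "\<And>u. u \<in> carrier ?K \<Longrightarrow> a (k u) = q u"
    using short_exact_factor_sub[OF assms(2) K q] by (auto simp: mem_a_kernel)
  have "short_exact R K f ?K k A"
  proof (rule short_exactI[OF s(1) K t(1) _ k(1)])
    show "f \<in> lin_maps R K ?K"
      by (rule lin_mapsI) (simp_all add: mem_a_kernel lin_simps[OF s(4)] s(7) lin_zero[OF t(2,3,5)])
    fix x assume x: "x \<in> carrier K"
    show "f x = \<zero>\<^bsub>?K\<^esub> \<Longrightarrow> x = \<zero>\<^bsub>K\<^esub>" using x s(6) by simp
    have fx: "f x \<in> carrier ?K" using x by (simp add: mem_a_kernel lin_closed[OF s(4)] s(7) lin_zero[OF t(2,3,5)])
    show "k (f x) = \<zero>\<^bsub>A\<^esub>"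
      using k(2)[OF fx] s(7)[OF x] by (intro t(6) lin_closed[OF k(1) fx]) simp
  next
    fix u assume u: "u \<in> carrier ?K" "k u = \<zero>\<^bsub>A\<^esub>"
    then have "q u = \<zero>\<^bsub>B\<^esub>" using k(2)[OF u(1)] lin_zero[OF t(1,2,4)] by simp
    then show "\<exists>x\<in>carrier K. f x = u" using s(8) u(1) by (simp add: mem_a_kernel)
  next
    fix y assume y: "y \<in> carrier A"
    then obtain h where h: "h \<in> carrier H" "q h = a y" using s(9) lin_closed[OF t(4)] by blast
    then have hK: "h \<in> carrier ?K" using y t(7) by (simp add: mem_a_kernel)
    have "k h = y"
      using k(2)[OF hK] h y lin_closed[OF k(1) hK] by (intro inj_onD[OF t(10)]) simp_all
    then show "\<exists>u\<in>carrier ?K. k u = y" using hK by blast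
  qed
  with short_exact_kernel[OF s(2) t(3) cq surj] show thesis by (rule that)
qed

lemma stably_iso_modules: "stably_iso R X Y \<Longrightarrow> module R X" "stably_iso R X Y \<Longrightarrow> module R Y"
  by (auto simp: stably_iso_def)

lemma stably_iso_sym: "stably_iso R X Y \<Longrightarrow> stably_iso R Y X"
  using module_iso_sym unfolding stably_iso_def by blast

lemma stably_isoI:
  assumes "module R X" "module R Y"
    and "module_iso R (sum_module X (free_module R p)) (sum_module Y (free_module R q))"
  shows "stably_iso R X Y"
  using assms unfolding stably_iso_def by blast

lemma module_iso_sum_free_free:
  assumes "module R X"
  shows "module_iso R (sum_module (sum_module X (free_module R p)) (free_module R q))
    (sum_module X (free_module R (p + q)))"
proof -
  interpret X: module R X by fact
  note F = module_free[OF X.R.is_cring]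
  have "module_iso R (sum_module (sum_module X (free_module R p)) (free_module R q))
      (sum_module X (sum_module (free_module R p) (free_module R q)))"
    by (intro module_iso_sum_assoc assms F)
  also have "module_iso R \<dots> (sum_module X (free_module R (p + q)))"
    by (intro module_iso_sum module_iso_refl assms free_module_add X.R.is_cring)
  finally show ?thesis .
qed

lemma stably_iso_trans [trans]:
  assumes "stably_iso R X Y" "stably_iso R Y Z"
  shows "stably_iso R X Z"
proof -
  let ?F = "free_module R"
  note m = stably_iso_modules[OF assms(1)] stably_iso_modules[OF assms(2)]
  interpret X: module R X by (rule m)
  note F = module_free[OF X.R.is_cring]
  obtain p q where pq: "module_iso R (sum_module X (?F p)) (sum_module Y (?F q))"
    using assms(1) unfolding stably_iso_def by blast
  obtain s t where st: "module_iso R (sum_module Y (?F s)) (sum_module Z (?F t))"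
    using assms(2) unfolding stably_iso_def by blast
  have "module_iso R (sum_module X (?F (p + s))) (sum_module (sum_module X (?F p)) (?F s))"
    by (intro module_iso_sym[OF module_iso_sum_free_free] m)
  also have "module_iso R \<dots> (sum_module (sum_module Y (?F q)) (?F s))"
    by (intro module_iso_sum pq module_iso_refl F)
  also have "module_iso R \<dots> (sum_module Y (?F (q + s)))"
    by (intro module_iso_sum_free_free m)
  also have "module_iso R \<dots> (sum_module (sum_module Y (?F s)) (?F q))"
    unfolding add.commute[of q s] by (intro module_iso_sym[OF module_iso_sum_free_free] m)
  also have "module_iso R \<dots> (sum_module (sum_module Z (?F t)) (?F q))"
    by (intro module_iso_sum st module_iso_refl F)
  also have "module_iso R \<dots> (sum_module Z (?F (t + q)))"
    by (intro module_iso_sum_free_free m)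
  finally show ?thesis by (rule stably_isoI[OF m(1,4)])
qed

lemma module_iso_imp_stably_iso:
  assumes "module_iso R X Y" shows "stably_iso R X Y"
proof -
  note m = module_iso_modules[OF assms]
  interpret X: module R X by (rule m)
  show ?thesis
    by (intro stably_isoI[of R X Y 0 0] m module_iso_sum assms module_iso_refl module_free X.R.is_cring)
qed

lemma stably_iso_refl: "module R X \<Longrightarrow> stably_iso R X X"
  by (intro module_iso_imp_stably_iso module_iso_refl)

lemma stably_iso_sum_free:
  assumes "module R X" shows "stably_iso R (sum_module X (free_module R p)) X"
proof -
  interpret X: module R X by fact
  have "module R (sum_module X (free_module R p))"
    by (intro module_sum assms module_free X.R.is_cring)
  then show ?thesis
    by (intro stably_isoI[of _ _ _ 0 p] module_iso_sum_free_0 assms)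
qed

lemma stably_iso_sum:
  assumes "stably_iso R A A'" "stably_iso R B B'"
  shows "stably_iso R (sum_module A B) (sum_module A' B')"
proof -
  let ?F = "free_module R"
  note m = stably_iso_modules[OF assms(1)] stably_iso_modules[OF assms(2)]
  interpret A: module R A by (rule m)
  note F = module_free[OF A.R.is_cring]
  obtain p q where pq: "module_iso R (sum_module A (?F p)) (sum_module A' (?F q))"
    using assms(1) unfolding stably_iso_def by blast
  obtain s t where st: "module_iso R (sum_module B (?F s)) (sum_module B' (?F t))"
    using assms(2) unfolding stably_iso_def by blast
  have "module_iso R (sum_module (sum_module A B) (?F (p + s)))
      (sum_module (sum_module A B) (sum_module (?F p) (?F s)))"
    by (intro module_iso_sum module_iso_refl module_sum m module_iso_sym[OF free_module_add] A.R.is_cring)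
  also have "module_iso R \<dots> (sum_module (sum_module A (?F p)) (sum_module B (?F s)))"
    by (intro module_iso_sum_interchange m F)
  also have "module_iso R \<dots> (sum_module (sum_module A' (?F q)) (sum_module B' (?F t)))"
    by (intro module_iso_sum pq st)
  also have "module_iso R \<dots> (sum_module (sum_module A' B') (sum_module (?F q) (?F t)))"
    by (intro module_iso_sum_interchange m F)
  also have "module_iso R \<dots> (sum_module (sum_module A' B') (?F (q + t)))"
    by (intro module_iso_sum module_iso_refl module_sum m free_module_add A.R.is_cring)
  finally show ?thesis by (intro stably_isoI module_sum m)
qed

lemma stably_iso_finite_sum:
  assumes "cring R" "finite I" "\<And>i. i \<in> I \<Longrightarrow> stably_iso R (A i) (B i)"
  shows "stably_iso R (finite_sum_module I A) (finite_sum_module I B)"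
  using assms(2,3)
proof (induction I rule: finite_induct)
  case empty
  have "module R (finite_sum_module {} A)" "module R (finite_sum_module {} B)"
    by (intro module_finite_sum assms(1); simp)+
  then show ?case
    by (intro module_iso_imp_stably_iso
        module_isoI[where f = "\<lambda>_ _. undefined" and g = "\<lambda>_ _. undefined"] lin_mapsI) auto
next
  case (insert i I)
  note m = stably_iso_modules[OF insert.prems]
  have "stably_iso R (finite_sum_module (insert i I) A) (sum_module (A i) (finite_sum_module I A))"
    by (intro module_iso_imp_stably_iso finite_sum_module_insert assms m insert.hyps)
  also have "stably_iso R \<dots> (sum_module (B i) (finite_sum_module I B))"
    by (intro stably_iso_sum insert) auto
  also have "stably_iso R \<dots> (finite_sum_module (insert i I) B)"
    by (intro module_iso_imp_stably_iso module_iso_sym[OF finite_sum_module_insert] assms m insert.hyps)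
  finally show ?case .
qed

text \<open>The cover \<open>R\<^sup>b \<rightarrow> X\<close> may fail to be minimal; by Schanuel's lemma this affects \<open>K\<close> only by free summands.\<close>

definition first_syzygy :: "('a, 'r) ring_scheme \<Rightarrow> ('a, 'b, 'm) module_scheme \<Rightarrow> ('a, 'c, 'n) module_scheme \<Rightarrow> bool"
  where "first_syzygy R X K \<longleftrightarrow> (\<exists>b f g. short_exact R K f (free_module R b) g X)"

lemma first_syzygyI: "short_exact R K f (free_module R b) g X \<Longrightarrow> first_syzygy R X K"
  unfolding first_syzygy_def by blast

lemma first_syzygy_modules: "first_syzygy R X K \<Longrightarrow> module R X" "first_syzygy R X K \<Longrightarrow> module R K"
  by (auto simp: first_syzygy_def short_exact_def)

lemma first_syzygy_iso:
  assumes "first_syzygy R X K" "module_iso R X X'" "module_iso R K K'"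
  shows "first_syzygy R X' K'"
proof -
  obtain b f g where s: "short_exact R K f (free_module R b) g X" using assms(1) unfolding first_syzygy_def by blast
  show ?thesis
    by (rule short_exact_iso[OF s assms(3) module_iso_refl assms(2)]) (rule short_exactD[OF s] first_syzygyI)+
qed

lemma first_syzygy_sum:
  assumes "first_syzygy R X K" "first_syzygy R X' K'"
  shows "first_syzygy R (sum_module X X') (sum_module K K')"
proof -
  obtain b f g where s: "short_exact R K f (free_module R b) g X" using assms(1) unfolding first_syzygy_def by blast
  obtain b' f' g' where t: "short_exact R K' f' (free_module R b') g' X'" using assms(2) unfolding first_syzygy_def by blast
  interpret K: module R K by (rule short_exactD[OF s])
  show ?thesis
    by (rule short_exact_iso[OF short_exact_sum[OF s t] module_iso_refl free_module_add[OF K.R.is_cring] module_iso_refl])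
      (rule module_sum short_exactD[OF s] short_exactD[OF t] first_syzygyI)+
qed

lemma first_syzygy_free:
  assumes "cring R" shows "first_syzygy R (free_module R p) (free_module R 0)"
  by (rule first_syzygyI[OF short_exact_id_quot[OF module_free[OF assms]]])

lemma first_syzygy_sum_free:
  assumes "first_syzygy R X K"
  shows "first_syzygy R (sum_module X (free_module R p)) K"
proof -
  note m = first_syzygy_modules[OF assms]
  interpret K: module R K by (rule m)
  show ?thesis
    by (rule first_syzygy_iso[OF first_syzygy_sum[OF assms first_syzygy_free[OF K.R.is_cring]]
          module_iso_refl module_iso_sum_free_0])
      (intro module_sum m module_free K.R.is_cring)+
qed

text \<open>A free summand of \<open>X\<close> can be covered by itself, so both \<open>K\<close> and \<open>K'\<close> are kernels of covers of one module.\<close>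

lemma first_syzygy_stable:
  assumes "first_syzygy R X K" "first_syzygy R X' K'" "stably_iso R X X'"
  shows "stably_iso R K K'"
proof -
  obtain p q where pq: "module_iso R (sum_module X (free_module R p)) (sum_module X' (free_module R q))"
    using assms(3) unfolding stably_iso_def by blast
  note m = first_syzygy_modules[OF assms(1)] first_syzygy_modules[OF assms(2)]
  have "first_syzygy R (sum_module X' (free_module R q)) K"
    by (intro first_syzygy_iso[OF first_syzygy_sum_free[OF assms(1)] pq] module_iso_refl m)
  moreover have "first_syzygy R (sum_module X' (free_module R q)) K'"
    by (rule first_syzygy_sum_free[OF assms(2)])
  ultimately show ?thesis
    unfolding first_syzygy_def using schanuel stably_isoI m by blast
qed

section \<open>Higher syzygies\<close>

text \<open>Syzygies and quotients of free modules are, up to isomorphism, subquotients of some \<open>R\<^sup>b\<close> and so live on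
  the one carrier type \<open>(nat \<Rightarrow> 'a) set\<close>. On that type iterated syzygies can be defined inductively,
  which is impossible when each step changes the type.\<close>

lemma quotient_rep:
  fixes X :: "('a, nat \<Rightarrow> 'a, 'm) module_scheme"
  assumes "module R X" "module R Y" "q \<in> lin_maps R X Y" "q ` carrier X = carrier Y"
  obtains Z :: "('a, (nat \<Rightarrow> 'a) set) module" where "module_iso R Y Z"
proof -
  let ?H = "a_kernel X Y q"
  have H: "submodule ?H R X" by (rule submodule_kernel[OF assms(1-3)])
  have "module_iso R Y (quot_module X ?H)"
    by (rule short_exact_quot_unique[OF short_exact_kernel[OF assms] short_exact_quot[OF assms(1) H]]) simp
  then show thesis by (rule that)
qed

lemma submodule_rep:
  fixes B :: "('a, nat \<Rightarrow> 'a, 'm) module_scheme"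
  assumes "short_exact R A f B g C"
  obtains Z :: "('a, (nat \<Rightarrow> 'a) set) module" where "module_iso R A Z"
proof -
  note se = short_exactD[OF assms]
  have surj: "g ` carrier B = carrier C" using assms by (simp add: short_exact_def)
  have K: "module R (kernel_module B C g)" by (rule module_kernel[OF se(2,3,5)])
  obtain Z :: "('a, (nat \<Rightarrow> 'a) set) module" where "module_iso R (kernel_module B C g) Z"
    by (rule quotient_rep[OF K K lin_id image_ident])
  with short_exact_sub_unique[OF assms short_exact_kernel[OF se(2,3,5) surj]]
  show thesis using module_iso_trans that by blast
qed

inductive nth_syzygy :: "('a, 'r) ring_scheme \<Rightarrow> ('a, 'b, 'm) module_scheme \<Rightarrow> nat \<Rightarrow> ('a, (nat \<Rightarrow> 'a) set) module \<Rightarrow> bool"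
  for R :: "('a, 'r) ring_scheme" and X :: "('a, 'b, 'm) module_scheme"
  where
    zero: "module_iso R X Z \<Longrightarrow> nth_syzygy R X 0 Z"
  | Suc: "\<lbrakk>nth_syzygy R X k W; short_exact R Z f (free_module R b) g W\<rbrakk> \<Longrightarrow> nth_syzygy R X (Suc k) Z"

lemma nth_syzygy_stable:
  assumes "nth_syzygy R X k Z" "nth_syzygy R X' k Z'" "stably_iso R X X'"
  shows "stably_iso R Z Z'"
  using assms(1,2)
proof (induction arbitrary: Z' rule: nth_syzygy.induct)
  case (zero Z)
  from zero(2) have "module_iso R X' Z'" by cases
  then show ?case
    using zero(1) assms(3) by (meson module_iso_imp_stably_iso stably_iso_sym stably_iso_trans)
next
  case (Suc k W Z f b g)
  from Suc(4) obtain W' f' b' g' where W': "nth_syzygy R X' k W'" "short_exact R Z' f' (free_module R b') g' W'"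
    by cases
  show ?case
    by (rule first_syzygy_stable[OF first_syzygyI[OF Suc(2)] first_syzygyI[OF W'(2)] Suc(3)[OF W'(1)]])
qed

lemma lin_scalar:
  assumes "module R Z" "x \<in> carrier R"
  shows "(\<lambda>z. x \<odot>\<^bsub>Z\<^esub> z) \<in> lin_maps R Z Z"
  by (rule lin_scale[OF assms(1) lin_id assms(2)])

text \<open>If \<open>x\<close> is regular on \<open>X\<close> and \<open>F\<close> is a resolution of \<open>X\<close>, the mapping cone of \<open>x : F \<rightarrow> F\<close> resolves
  \<open>X' = X / xX\<close>. Its \<open>(k+1)\<close>-st syzygy is the pullback of the cover \<open>h : F\<^sub>k \<rightarrow> Z\<close> of the \<open>k\<close>-th syzygy \<open>Z\<close> of \<open>X\<close>
  along \<open>x : Z \<rightarrow> Z\<close>. For \<open>k = 0\<close> this is the kernel of \<open>F\<^sub>0 \<rightarrow> X \<rightarrow> X'\<close>, because \<open>x\<close> is injective on \<open>X\<close>.\<close>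

lemma nth_syzygy_quotient:
  fixes R :: "('a, 'r) ring_scheme"
  assumes x: "x \<in> carrier R" and quot: "short_exact R X (\<lambda>m. x \<odot>\<^bsub>X\<^esub> m) X p X'"
    and "nth_syzygy R X k Z"
    and "h \<in> lin_maps R (free_module R a) Z" "h ` carrier (free_module R a) = carrier Z"
  shows "\<exists>Z'. nth_syzygy R X' (Suc k) Z' \<and>
    module_iso R (fiber_prod (free_module R a) Z h (\<lambda>z. x \<odot>\<^bsub>Z\<^esub> z)) Z'"
  using assms(3-5)
proof (induction arbitrary: a h rule: nth_syzygy.induct)
  case (zero Z)
  let ?A = "free_module R a"
  note q = short_exactD[OF quot]
  interpret X: module R X by (rule q)
  note Fa = module_free[OF X.R.is_cring, of a] and Zm = module_iso_modules(2)[OF zero(1)]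
  note c = short_exactD[OF short_exact_kernel[OF Fa Zm zero(2,3)]]
  obtain \<phi> \<psi> where "module R Z" "module R X" and iso: "\<phi> \<in> lin_maps R Z X" "\<psi> \<in> lin_maps R X Z"
    "\<And>z. z \<in> carrier Z \<Longrightarrow> \<psi> (\<phi> z) = z" "\<And>m. m \<in> carrier X \<Longrightarrow> \<phi> (\<psi> m) = m"
    by (rule module_isoE[OF module_iso_sym[OF zero(1)]]) (rule that)
  let ?T = "fiber_prod ?A Z h (\<lambda>z. x \<odot>\<^bsub>Z\<^esub> z)"
  have T: "module R ?T" by (rule module_fiber_prod[OF c(2,3,3,5) lin_scalar[OF c(3) x]])
  have g: "(\<lambda>u. p (\<phi> (h u))) \<in> lin_maps R ?A X'"
    by (rule lin_comp[OF lin_comp[OF c(5) iso(1)] q(5)])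
  have cone: "short_exact R ?T fst ?A (\<lambda>u. p (\<phi> (h u))) X'"
  proof (rule short_exactI[OF T c(2) q(3) _ g])
    show "fst \<in> lin_maps R ?T ?A" by (rule lin_mapsI) auto
  next
    fix w assume "w \<in> carrier ?T" "fst w = \<zero>\<^bsub>?A\<^esub>"
    then obtain z where w: "w = (\<zero>\<^bsub>?A\<^esub>, z)" "z \<in> carrier Z" "x \<odot>\<^bsub>Z\<^esub> z = \<zero>\<^bsub>Z\<^esub>"
      using lin_zero[OF c(2,3,5)] by auto
    then have "x \<odot>\<^bsub>X\<^esub> \<phi> z = \<zero>\<^bsub>X\<^esub>"
      using lin_smult[OF iso(1) x] lin_zero[OF c(3) q(1) iso(1)] by force
    then have "\<phi> z = \<zero>\<^bsub>X\<^esub>" using q(6) lin_closed[OF iso(1) w(2)] by blast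
    then have "z = \<zero>\<^bsub>Z\<^esub>" using iso(3)[OF w(2)] lin_zero[OF q(1) c(3) iso(2)] by simp
    then show "w = \<zero>\<^bsub>?T\<^esub>" using w by simp
  next
    fix w assume "w \<in> carrier ?T"
    then obtain u z where w: "w = (u, z)" "z \<in> carrier Z" "h u = x \<odot>\<^bsub>Z\<^esub> z" by auto
    then show "p (\<phi> (h (fst w))) = \<zero>\<^bsub>X'\<^esub>"
      using q(7)[OF lin_closed[OF iso(1) w(2)]] lin_smult[OF iso(1) x w(2)] by simp
  next
    fix u assume u: "u \<in> carrier ?A" "p (\<phi> (h u)) = \<zero>\<^bsub>X'\<^esub>"
    have hu: "h u \<in> carrier Z" by (rule lin_closed[OF c(5) u(1)])
    then obtain m where m: "m \<in> carrier X" "x \<odot>\<^bsub>X\<^esub> m = \<phi> (h u)"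
      using q(8)[OF lin_closed[OF iso(1) hu] u(2)] by blast
    then have "h u = x \<odot>\<^bsub>Z\<^esub> \<psi> m" using iso(3)[OF hu] lin_smult[OF iso(2) x m(1)] by simp
    then show "\<exists>w\<in>carrier ?T. fst w = u"
      using u(1) lin_closed[OF iso(2) m(1)] by (intro bexI[of _ "(u, \<psi> m)"]) auto
  next
    fix y assume "y \<in> carrier X'"
    then obtain m where m: "m \<in> carrier X" "p m = y" using q(9) by blast
    then obtain u where "u \<in> carrier ?A" "h u = \<psi> m" using c(9) lin_closed[OF iso(2)] by blast
    then show "\<exists>u\<in>carrier ?A. p (\<phi> (h u)) = y" using m iso(4) by (intro bexI[of _ u]) simp_all
  qed
  have surj: "(\<lambda>u. p (\<phi> (h u))) ` carrier ?A = carrier X'"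
    using cone by (simp add: short_exact_def)
  obtain W :: "('a, (nat \<Rightarrow> 'a) set) module" where W: "module_iso R X' W"
    using quotient_rep[OF c(2) q(3) g surj] .
  obtain Z' :: "('a, (nat \<Rightarrow> 'a) set) module" where Z': "module_iso R ?T Z'"
    using submodule_rep[OF cone] .
  obtain f' g' where "short_exact R Z' f' ?A g' W"
    by (rule short_exact_iso[OF cone Z' module_iso_refl[OF c(2)] W])
  then show ?case using nth_syzygy.Suc[OF nth_syzygy.zero[OF W]] Z' by blast
next
  case (Suc k W Z f b q)
  let ?A = "free_module R a" and ?B = "free_module R b"
  note t = short_exactD[OF Suc.hyps(2)]
  interpret Z: module R Z by (rule t)
  note c = short_exactD[OF short_exact_kernel[OF module_free[OF Z.R.is_cring, of a] t(1) Suc.prems]]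
  let ?T = "fiber_prod ?A Z h (\<lambda>z. x \<odot>\<^bsub>Z\<^esub> z)"
  let ?U = "fiber_prod ?B W q (\<lambda>z. x \<odot>\<^bsub>W\<^esub> z)"
  let ?S = "sum_module ?A ?B"
  interpret W: module R W by (rule t)
  interpret A: module R "?A" by (rule c)
  interpret B: module R "?B" by (rule t)
  have T: "module R ?T" by (rule module_fiber_prod[OF c(2,3,3,5) lin_scalar[OF c(3) x]])
  have U: "module R ?U" by (rule module_fiber_prod[OF t(2,3,3,5) lin_scalar[OF t(3) x]])
  have S: "module R ?S" by (rule module_sum[OF c(2) t(2)])
  \<comment> \<open>\<open>G\<close> is the differential of the cone, corestricted to the pullback over \<open>W\<close>; its kernel consists of the
    pairs \<open>(u, - f z)\<close> with \<open>h u = x z\<close>, whence the sign in \<open>F\<close>.\<close>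
  define F where "F = (\<lambda>w. (fst w :: nat \<Rightarrow> 'a, \<ominus>\<^bsub>?B\<^esub> f (snd w)))"
  define G where "G = (\<lambda>w. (f (h (fst w)) \<oplus>\<^bsub>?B\<^esub> x \<odot>\<^bsub>?B\<^esub> snd w, q (snd w)))"
  note fh = lin_comp[OF c(5) t(4)]
  have qx: "q (f (h u) \<oplus>\<^bsub>?B\<^esub> x \<odot>\<^bsub>?B\<^esub> v) = x \<odot>\<^bsub>W\<^esub> q v"
    if "u \<in> carrier ?A" "v \<in> carrier ?B" for u v
    using that x lin_closed[OF c(5) that(1)] lin_closed[OF t(4)] lin_closed[OF t(5) that(2)]
    by (simp add: lin_add[OF t(5)] lin_smult[OF t(5)] t(7))
  have "short_exact R ?T F ?S G ?U"
  proof (rule short_exactI[OF T S U])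
    show "F \<in> lin_maps R ?T ?S"
      by (rule lin_mapsI)
        (auto simp: F_def lin_simps[OF t(4)] B.M.minus_add B.M.a_comm B.smult_r_minus)
    show "G \<in> lin_maps R ?S ?U"
    proof (rule lin_mapsI)
      fix w w' r assume w: "w \<in> carrier ?S"
      have m: "f (h (fst w)) \<in> carrier ?B" "q (snd w) \<in> carrier W" "x \<odot>\<^bsub>?B\<^esub> snd w \<in> carrier ?B"
        using w x lin_closed[OF fh] lin_closed[OF t(5)] by auto
      show "G w \<in> carrier ?U" using w m qx by (auto simp: G_def)
      { assume w': "w' \<in> carrier ?S"
        have m': "f (h (fst w')) \<in> carrier ?B" "q (snd w') \<in> carrier W" "x \<odot>\<^bsub>?B\<^esub> snd w' \<in> carrier ?B"
          using w' x lin_closed[OF fh] lin_closed[OF t(5)] by auto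
        show "G (w \<oplus>\<^bsub>?S\<^esub> w') = G w \<oplus>\<^bsub>?U\<^esub> G w'"
          using w w' m m' x
          by (simp add: G_def mem_Times_iff lin_add[OF fh] lin_add[OF t(5)] B.smult_r_distr B.M.a_ac W.M.a_comm) }
      { assume r: "r \<in> carrier R"
        show "G (r \<odot>\<^bsub>?S\<^esub> w) = r \<odot>\<^bsub>?U\<^esub> G w"
          using w r m x
          by (simp add: G_def mem_Times_iff lin_smult[OF fh] lin_smult[OF t(5)] B.smult_r_distr
              B.smult_assoc1[symmetric] Z.R.m_comm[of x]) }
    qed
  next
    fix w assume "w \<in> carrier ?T" "F w = \<zero>\<^bsub>?S\<^esub>"
    then obtain z where w: "w = (\<zero>\<^bsub>?A\<^esub>, z)" "z \<in> carrier Z"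
      "\<ominus>\<^bsub>?B\<^esub> f z = \<zero>\<^bsub>?B\<^esub>"
      by (auto simp: F_def)
    have "f z = \<ominus>\<^bsub>?B\<^esub> (\<ominus>\<^bsub>?B\<^esub> f z)"
      using lin_closed[OF t(4) w(2)] by (simp only: B.M.minus_minus)
    then have "f z = \<zero>\<^bsub>?B\<^esub>" 
      using B.M.minus_equality[of "\<zero>\<^bsub>?B\<^esub>" "\<zero>\<^bsub>?B\<^esub>"] by (simp add: w(3))
    then show "w = \<zero>\<^bsub>?T\<^esub>" using w t(6) by simp
  next
    fix w assume "w \<in> carrier ?T"
    then obtain u z where w: "w = (u, z)" "u \<in> carrier ?A" "z \<in> carrier Z" "h u = x \<odot>\<^bsub>Z\<^esub> z" by auto
    have "f z \<in> carrier ?B" by (rule lin_closed[OF t(4) w(3)])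
    then show "G (F w) = \<zero>\<^bsub>?U\<^esub>"
      using w(3,4) x lin_neg[OF t(2,3,5)]
      by (simp add: F_def G_def w(1) lin_smult[OF t(4)] t(7) B.smult_r_minus B.M.r_neg)
  next
    fix w assume "w \<in> carrier ?S" "G w = \<zero>\<^bsub>?U\<^esub>"
    then obtain u v where w: "w = (u, v)" "u \<in> carrier ?A" "v \<in> carrier ?B"
      "f (h u) \<oplus>\<^bsub>?B\<^esub> x \<odot>\<^bsub>?B\<^esub> v = \<zero>\<^bsub>?B\<^esub>" "q v = \<zero>\<^bsub>W\<^esub>"
      by (auto simp: G_def)
    obtain z where z: "z \<in> carrier Z" "f z = v" using t(8)[OF w(3,5)] by blast
    have hu: "h u \<in> carrier Z" by (rule lin_closed[OF c(5) w(2)])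
    have "f (h u \<oplus>\<^bsub>Z\<^esub> x \<odot>\<^bsub>Z\<^esub> z) = \<zero>\<^bsub>?B\<^esub>"
      using w(4) z x hu by (simp add: lin_add[OF t(4)] lin_smult[OF t(4)])
    then have "h u \<oplus>\<^bsub>Z\<^esub> x \<odot>\<^bsub>Z\<^esub> z = \<zero>\<^bsub>Z\<^esub>" using z x hu by (intro t(6)) simp_all
    then have "h u = x \<odot>\<^bsub>Z\<^esub> (\<ominus>\<^bsub>Z\<^esub> z)"
      using z x hu by (simp add: Z.smult_r_minus Z.M.minus_equality)
    then show "\<exists>w'\<in>carrier ?T. F w' = w"
      using z w(1-3) lin_closed[OF t(4) z(1)]
      by (intro bexI[of _ "(u, \<ominus>\<^bsub>Z\<^esub> z)"]) (simp_all add: F_def lin_neg[OF t(1,2,4)])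
  next
    fix w assume "w \<in> carrier ?U"
    then obtain v y where w: "w = (v, y)" "v \<in> carrier ?B" "y \<in> carrier W" "q v = x \<odot>\<^bsub>W\<^esub> y" by auto
    obtain v' where v': "v' \<in> carrier ?B" "q v' = y" using t(9)[OF w(3)] by blast
    have "q (v \<ominus>\<^bsub>?B\<^esub> x \<odot>\<^bsub>?B\<^esub> v') = \<zero>\<^bsub>W\<^esub>"
      using w v' x by (simp add: lin_minus[OF t(2,3,5)] lin_smult[OF t(5)] W.M.diff_zero_iff)
    then obtain z where z: "z \<in> carrier Z" "f z = v \<ominus>\<^bsub>?B\<^esub> x \<odot>\<^bsub>?B\<^esub> v'"
      using t(8) w v' x by (metis B.M.minus_closed B.smult_closed)
    obtain u where u: "u \<in> carrier ?A" "h u = z" using c(9)[OF z(1)] by blast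
    have xv: "x \<odot>\<^bsub>?B\<^esub> v' \<in> carrier ?B" using v' x by simp
    have "G (u, v') = (v \<ominus>\<^bsub>?B\<^esub> x \<odot>\<^bsub>?B\<^esub> v' \<oplus>\<^bsub>?B\<^esub> x \<odot>\<^bsub>?B\<^esub> v', y)"
      using u z v' by (simp add: G_def)
    also have "\<dots> = w" using w(1,2) xv by (simp add: B.M.minus_eq B.M.a_assoc B.M.l_neg)
    finally show "\<exists>w'\<in>carrier ?S. G w' = w"
      using u v' by (intro bexI[of _ "(u, v')"]) simp_all
  qed
  then obtain F' G' where cone: "short_exact R ?T F' (free_module R (a + b)) G' ?U"
    by (rule short_exact_iso[OF _ module_iso_refl[OF T] free_module_add[OF Z.R.is_cring] module_iso_refl[OF U]])
  have "q ` carrier ?B = carrier W" using Suc.hyps(2) by (simp add: short_exact_def)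
  from Suc.IH[OF t(5) this] obtain W' where
    W': "nth_syzygy R X' (Suc k) W'" "module_iso R ?U W'" by blast
  obtain Z' :: "('a, (nat \<Rightarrow> 'a) set) module" where Z': "module_iso R ?T Z'"
    using submodule_rep[OF cone] .
  obtain F'' G'' where "short_exact R Z' F'' (free_module R (a + b)) G'' W'"
    by (rule short_exact_iso[OF cone Z' module_iso_refl[OF module_free[OF Z.R.is_cring]] W'(2)])
  then show ?case using nth_syzygy.Suc[OF W'(1)] Z' by blast
qed

section \<open>Multiplications that factor through a free module\<close>

text \<open>Equivalently, \<open>x\<close> annihilates \<open>Ext\<^sup>1\<^sub>R(X, L)\<close> for the syzygy \<open>L\<close> in some cover of \<open>X\<close>; but in this form the
  property visibly passes to direct sums, stably isomorphic modules and syzygies.\<close>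

definition factors_free :: "('a, 'r) ring_scheme \<Rightarrow> 'a \<Rightarrow> ('a, 'b, 'm) module_scheme \<Rightarrow> bool"
  where "factors_free R x X \<longleftrightarrow> (\<exists>p t q. t \<in> lin_maps R X (free_module R p) \<and>
    q \<in> lin_maps R (free_module R p) X \<and> (\<forall>y\<in>carrier X. q (t y) = x \<odot>\<^bsub>X\<^esub> y))"

lemma factors_free_retract:
  assumes "factors_free R x Y" "x \<in> carrier R" "i \<in> lin_maps R X Y" "r \<in> lin_maps R Y X"
    and "\<And>u. u \<in> carrier X \<Longrightarrow> r (i u) = u"
  shows "factors_free R x X"
proof -
  obtain p t q where t: "t \<in> lin_maps R Y (free_module R p)" "q \<in> lin_maps R (free_module R p) Y"
    "\<And>y. y \<in> carrier Y \<Longrightarrow> q (t y) = x \<odot>\<^bsub>Y\<^esub> y"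
    using assms(1) unfolding factors_free_def by blast
  have "r (q (t (i u))) = x \<odot>\<^bsub>X\<^esub> u" if "u \<in> carrier X" for u
    using that lin_closed[OF assms(3) that] assms(2) by (simp add: t(3) lin_smult[OF assms(4)] assms(5))
  then show ?thesis
    unfolding factors_free_def using lin_comp[OF assms(3) t(1)] lin_comp[OF t(2) assms(4)] by blast
qed

lemma factors_free_iso:
  assumes "module_iso R X Y" "factors_free R x Y" "x \<in> carrier R"
  shows "factors_free R x X"
proof -
  obtain f g where "module R X" "module R Y" and f: "f \<in> lin_maps R X Y" "g \<in> lin_maps R Y X"
    "\<And>u. u \<in> carrier X \<Longrightarrow> g (f u) = u" "\<And>y. y \<in> carrier Y \<Longrightarrow> f (g y) = y"
    by (rule module_isoE[OF assms(1)]) (rule that)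
  show ?thesis by (rule factors_free_retract[OF assms(2,3) f(1-3)])
qed

lemma factors_free_sum:
  assumes "module R X" "module R Y" "factors_free R x X" "factors_free R x Y"
  shows "factors_free R x (sum_module X Y)"
proof -
  interpret X: module R X by fact
  obtain p t q where t: "t \<in> lin_maps R X (free_module R p)" "q \<in> lin_maps R (free_module R p) X"
    "\<And>y. y \<in> carrier X \<Longrightarrow> q (t y) = x \<odot>\<^bsub>X\<^esub> y"
    using assms(3) unfolding factors_free_def by blast
  obtain p' t' q' where t': "t' \<in> lin_maps R Y (free_module R p')" "q' \<in> lin_maps R (free_module R p') Y"
    "\<And>y. y \<in> carrier Y \<Longrightarrow> q' (t' y) = x \<odot>\<^bsub>Y\<^esub> y"
    using assms(4) unfolding factors_free_def by blast
  let ?S = "sum_module (free_module R p) (free_module R p')"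
  obtain f g where "module R ?S" "module R (free_module R (p + p'))"
    and f: "f \<in> lin_maps R ?S (free_module R (p + p'))" "g \<in> lin_maps R (free_module R (p + p')) ?S"
    "\<And>u. u \<in> carrier ?S \<Longrightarrow> g (f u) = u" "\<And>y. y \<in> carrier (free_module R (p + p')) \<Longrightarrow> f (g y) = y"
    by (rule module_isoE[OF free_module_add[OF X.R.is_cring]]) (rule that)
  have tt: "(\<lambda>u. (t (fst u), t' (snd u))) \<in> lin_maps R (sum_module X Y) ?S"
    by (rule lin_mapsI) (simp_all add: mem_Times_iff lin_simps[OF t(1)] lin_simps[OF t'(1)])
  have qq: "(\<lambda>u. (q (fst u), q' (snd u))) \<in> lin_maps R ?S (sum_module X Y)"
    by (rule lin_mapsI) (simp_all add: mem_Times_iff lin_simps[OF t(2)] lin_simps[OF t'(2)])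
  have "(q (fst (g (f (t (fst u), t' (snd u))))), q' (snd (g (f (t (fst u), t' (snd u)))))) = x \<odot>\<^bsub>sum_module X Y\<^esub> u"
    if "u \<in> carrier (sum_module X Y)" for u
    using that lin_closed[OF tt that] by (simp add: f(3) mem_Times_iff t(3) t'(3))
  then show ?thesis
    unfolding factors_free_def using lin_comp[OF tt f(1)] lin_comp[OF f(2) qq] by blast
qed

lemma factors_free_free:
  assumes "cring R" "x \<in> carrier R" shows "factors_free R x (free_module R p)"
  unfolding factors_free_def
  using lin_scalar[OF module_free[OF assms(1)] assms(2)] lin_id by blast

lemma factors_free_finite_sum:
  assumes "cring R" "x \<in> carrier R" "finite I"
    "\<And>i. i \<in> I \<Longrightarrow> module R (A i)" "\<And>i. i \<in> I \<Longrightarrow> factors_free R x (A i)"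
  shows "factors_free R x (finite_sum_module I A)"
  using assms(3-5)
proof (induction I rule: finite_induct)
  case empty
  have z: "module R (finite_sum_module {} A)" by (intro module_finite_sum assms(1)) simp
  have "(\<lambda>_. \<zero>\<^bsub>free_module R 0\<^esub>) \<in> lin_maps R (finite_sum_module {} A) (free_module R 0)"
    "(\<lambda>_. \<zero>\<^bsub>finite_sum_module {} A\<^esub>) \<in> lin_maps R (free_module R 0) (finite_sum_module {} A)"
    by (intro lin_zero_map module_free assms(1) z)+
  moreover have "\<forall>y\<in>carrier (finite_sum_module {} A). \<zero>\<^bsub>finite_sum_module {} A\<^esub> = x \<odot>\<^bsub>finite_sum_module {} A\<^esub> y"
    by (simp add: restrict_def)
  ultimately show ?case unfolding factors_free_def by blast
next
  case (insert i I)
  have "module_iso R (finite_sum_module (insert i I) A) (sum_module (A i) (finite_sum_module I A))"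
    by (intro finite_sum_module_insert assms(1) insert)
  moreover have "factors_free R x (sum_module (A i) (finite_sum_module I A))"
    using insert by (intro factors_free_sum module_finite_sum assms(1)) auto
  ultimately show ?case using assms(2) by (rule factors_free_iso)
qed

lemma factors_free_stable:
  assumes "stably_iso R X Y" "factors_free R x Y" "x \<in> carrier R"
  shows "factors_free R x X"
proof -
  note m = stably_iso_modules[OF assms(1)]
  interpret X: module R X by (rule m)
  note F = module_free[OF X.R.is_cring]
  obtain p q where "module_iso R (sum_module X (free_module R p)) (sum_module Y (free_module R q))"
    using assms(1) unfolding stably_iso_def by blast
  moreover have "factors_free R x (sum_module Y (free_module R q))"
    by (intro factors_free_sum m F assms factors_free_free X.R.is_cring)
  ultimately have *: "factors_free R x (sum_module X (free_module R p))" using assms(3) by (rule factors_free_iso)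
  interpret F: module R "free_module R p" by (rule F)
  show ?thesis
    by (rule factors_free_retract[OF * assms(3), of "\<lambda>u. (u, \<zero>\<^bsub>free_module R p\<^esub>)" _ fst])
      (auto intro!: lin_mapsI)
qed

lemma factors_free_lift:
  assumes "factors_free R x X" "short_exact R K f H g X"
  obtains t where "t \<in> lin_maps R X H" "\<And>y. y \<in> carrier X \<Longrightarrow> g (t y) = x \<odot>\<^bsub>X\<^esub> y"
proof -
  note se = short_exactD[OF assms(2)]
  obtain p t q where t: "t \<in> lin_maps R X (free_module R p)" "q \<in> lin_maps R (free_module R p) X"
    "\<And>y. y \<in> carrier X \<Longrightarrow> q (t y) = x \<odot>\<^bsub>X\<^esub> y"
    using assms(1) unfolding factors_free_def by blast
  obtain l where "l \<in> lin_maps R (free_module R p) H" "\<And>u. u \<in> carrier (free_module R p) \<Longrightarrow> g (l u) = q u"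
    using free_module_lift[OF se(2,3,5,9) t(2)] by blast
  with t show thesis by (intro that[of "\<lambda>y. l (t y)"] lin_comp[OF t(1)]) (simp_all add: lin_closed[OF t(1)])
qed

text \<open>If \<open>g t = x\<close> on \<open>X\<close> for the cover \<open>g : F \<rightarrow> X\<close>, then \<open>x - t g\<close> maps \<open>F\<close> into \<open>ker g\<close> and restricts to
  multiplication by \<open>x\<close> on \<open>ker g\<close>.\<close>

lemma factors_free_first_syzygy:
  assumes "factors_free R x X" "first_syzygy R X K" "x \<in> carrier R"
  shows "factors_free R x K"
proof -
  obtain b f g where s: "short_exact R K f (free_module R b) g X" using assms(2) unfolding first_syzygy_def by blast
  let ?F = "free_module R b"
  note se = short_exactD[OF s]
  interpret K: module R K by (rule se)
  interpret X: module R X by (rule se)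
  interpret F: module R "?F" by (rule se)
  obtain t where t: "t \<in> lin_maps R X ?F" "\<And>y. y \<in> carrier X \<Longrightarrow> g (t y) = x \<odot>\<^bsub>X\<^esub> y"
    using factors_free_lift[OF assms(1) s] by blast
  have "(\<lambda>u. x \<odot>\<^bsub>?F\<^esub> u \<ominus>\<^bsub>?F\<^esub> t (g u)) \<in> lin_maps R ?F ?F"
    by (rule lin_diff[OF se(2) lin_scalar[OF se(2) assms(3)] lin_comp[OF se(5) t(1)]])
  moreover have "g (x \<odot>\<^bsub>?F\<^esub> u \<ominus>\<^bsub>?F\<^esub> t (g u)) = \<zero>\<^bsub>X\<^esub>"
    if "u \<in> carrier ?F" for u
    using that lin_closed[OF se(5) that] lin_closed[OF t(1)] assms(3)
    by (simp add: lin_minus[OF se(2,3,5)] lin_smult[OF se(5)] t(2) X.M.diff_zero_iff)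
  ultimately obtain k where k: "k \<in> lin_maps R ?F K"
    "\<And>u. u \<in> carrier ?F \<Longrightarrow> f (k u) = x \<odot>\<^bsub>?F\<^esub> u \<ominus>\<^bsub>?F\<^esub> t (g u)"
    using short_exact_factor_sub[OF s se(2)] by blast
  have "k (f y) = x \<odot>\<^bsub>K\<^esub> y" if y: "y \<in> carrier K" for y
  proof (rule inj_onD[OF se(10)])
    have fy: "f y \<in> carrier ?F" by (rule lin_closed[OF se(4) y])
    show "f (k (f y)) = f (x \<odot>\<^bsub>K\<^esub> y)"
      using assms(3) y fy
      by (simp add: k(2)[OF fy] lin_smult[OF se(4)] se(7)[OF y] lin_zero[OF se(3,2) t(1)] F.M.diff_eq_iff)
  qed (use y assms(3) lin_closed[OF k(1) lin_closed[OF se(4) y]] in simp_all)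
  then show ?thesis unfolding factors_free_def using se(4) k(1) by blast
qed

text \<open>Let \<open>C\<close> be the kernel of the cover \<open>be q : H \<rightarrow> Z\<close>. The pullback of this cover along \<open>x : Z \<rightarrow> Z\<close> is an
  extension of \<open>Z\<close> by \<open>C\<close>. It splits after pulling it back further along \<open>be : B \<rightarrow> Z\<close>, because it contains
  \<open>(tau b, be b)\<close> for every \<open>b\<close>; hence \<open>C \<oplus> B\<close> maps onto it, with the same kernel \<open>A\<close> as \<open>be\<close>.\<close>

lemma short_exact_pullback_multiplication:
  assumes s: "short_exact R A al B be Z" and t: "short_exact R L l H q B"
    and tau: "tau \<in> lin_maps R B H" "\<And>b. b \<in> carrier B \<Longrightarrow> q (tau b) = x \<odot>\<^bsub>B\<^esub> b" and x: "x \<in> carrier R"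
  shows "short_exact R A (\<lambda>a. (\<ominus>\<^bsub>H\<^esub> tau (al a), al a)) (sum_module (kernel_module H Z (\<lambda>h. be (q h))) B)
    (\<lambda>u. (fst u \<oplus>\<^bsub>H\<^esub> tau (snd u), be (snd u)))
    (fiber_prod H Z (\<lambda>h. be (q h)) (\<lambda>z. x \<odot>\<^bsub>Z\<^esub> z))"
proof -
  note s = short_exactD[OF s] and t = short_exactD[OF t]
  interpret Z: module R Z by (rule s)
  interpret B: module R B by (rule s)
  interpret H: module R H by (rule t)
  note bq = lin_comp[OF t(5) s(5)]
  let ?C = "kernel_module H Z (\<lambda>h. be (q h))" and ?T = "fiber_prod H Z (\<lambda>h. be (q h)) (\<lambda>z. x \<odot>\<^bsub>Z\<^esub> z)"
  have C: "module R ?C" by (rule module_kernel[OF t(2) s(3) bq])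
  have bqt: "be (q (tau b)) = x \<odot>\<^bsub>Z\<^esub> be b" if "b \<in> carrier B" for b
    using that x by (simp add: tau(2) lin_smult[OF s(5)])
  show ?thesis
  proof (rule short_exactI[OF s(1) module_sum[OF C s(2)] module_fiber_prod[OF t(2) s(3,3) bq lin_scalar[OF s(3) x]]])
    note f1 = lin_neg_map[OF t(2) lin_comp[OF s(4) tau(1)]]
    show "(\<lambda>a. (\<ominus>\<^bsub>H\<^esub> tau (al a), al a)) \<in> lin_maps R A (sum_module ?C B)"
    proof (rule lin_mapsI)
      show "(\<ominus>\<^bsub>H\<^esub> tau (al a), al a) \<in> carrier (sum_module ?C B)" if "a \<in> carrier A" for a
        using lin_closed[OF f1 that] lin_closed[OF s(4) that] lin_closed[OF tau(1)] x
        by (simp add: mem_a_kernel lin_neg[OF t(2) s(3) bq] bqt s(7)[OF that] Z.smult_r_minus[symmetric]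
            Z.M.minus_equality)
    qed (simp_all add: lin_simps[OF tau(1)] lin_simps[OF s(4)] H.M.minus_add H.M.a_comm H.smult_r_minus)
    note c = lin_closed[OF tau(1)]
    show "(\<lambda>u. (fst u \<oplus>\<^bsub>H\<^esub> tau (snd u), be (snd u))) \<in> lin_maps R (sum_module ?C B) ?T"
      by (rule lin_mapsI)
        (use x in \<open>auto simp: mem_a_kernel c lin_simps[OF tau(1)] lin_simps[OF s(5)] lin_add[OF bq] bqt
          H.smult_r_distr H.M.a_ac\<close>)
  next
    fix a assume a: "a \<in> carrier A" "(\<ominus>\<^bsub>H\<^esub> tau (al a), al a) = \<zero>\<^bsub>sum_module ?C B\<^esub>"
    then show "a = \<zero>\<^bsub>A\<^esub>" using s(6) by simp
  next
    fix a assume a: "a \<in> carrier A"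
    then show "(fst (\<ominus>\<^bsub>H\<^esub> tau (al a), al a) \<oplus>\<^bsub>H\<^esub> tau (snd (\<ominus>\<^bsub>H\<^esub> tau (al a), al a)), be (snd (\<ominus>\<^bsub>H\<^esub> tau (al a), al a))) = \<zero>\<^bsub>?T\<^esub>"
      using lin_closed[OF tau(1) lin_closed[OF s(4) a]] s(7)[OF a] by (simp add: H.M.l_neg)
  next
    fix u assume u: "u \<in> carrier (sum_module ?C B)" "(fst u \<oplus>\<^bsub>H\<^esub> tau (snd u), be (snd u)) = \<zero>\<^bsub>?T\<^esub>"
    then obtain k b where kb: "u = (k, b)" "k \<in> carrier H" "b \<in> carrier B" "k \<oplus>\<^bsub>H\<^esub> tau b = \<zero>\<^bsub>H\<^esub>" "be b = \<zero>\<^bsub>Z\<^esub>"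
      by (auto simp: mem_a_kernel)
    obtain a where a: "a \<in> carrier A" "al a = b" using s(8)[OF kb(3,5)] by blast
    have "\<ominus>\<^bsub>H\<^esub> tau b = k" using kb lin_closed[OF tau(1) kb(3)] by (simp add: H.M.minus_equality)
    then show "\<exists>a\<in>carrier A. (\<ominus>\<^bsub>H\<^esub> tau (al a), al a) = u" using a kb(1) by (intro bexI[of _ a]) simp_all
  next
    fix w assume "w \<in> carrier ?T"
    then obtain h z where w: "w = (h, z)" "h \<in> carrier H" "z \<in> carrier Z" "be (q h) = x \<odot>\<^bsub>Z\<^esub> z" by auto
    obtain b where b: "b \<in> carrier B" "be b = z" using s(9)[OF w(3)] by blast
    have tb: "tau b \<in> carrier H" by (rule lin_closed[OF tau(1) b(1)])
    have "h \<ominus>\<^bsub>H\<^esub> tau b \<in> carrier ?C"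
      using w b tb x by (simp add: mem_a_kernel lin_minus[OF t(2) s(3) bq] bqt Z.M.diff_zero_iff)
    moreover have "h \<ominus>\<^bsub>H\<^esub> tau b \<oplus>\<^bsub>H\<^esub> tau b = h" using w(2) tb by (simp add: H.M.minus_eq H.M.a_assoc H.M.l_neg)
    ultimately show "\<exists>u\<in>carrier (sum_module ?C B). (fst u \<oplus>\<^bsub>H\<^esub> tau (snd u), be (snd u)) = w"
      using w(1) b by (intro bexI[of _ "(h \<ominus>\<^bsub>H\<^esub> tau b, b)"]) simp_all
  qed
qed

text \<open>The class of \<open>0 \<rightarrow> M \<rightarrow> H \<rightarrow> Z \<rightarrow> 0\<close> is annihilated by \<open>x\<close>, so its
  pushout along \<open>x : M \<rightarrow> M\<close> is \<open>M \<oplus> Z\<close>; it contains \<open>H\<close> with cokernel \<open>M / xM\<close>.\<close>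

lemma short_exact_pushout_multiplication:
  assumes s: "short_exact R M io H p Z" and quot: "short_exact R M (\<lambda>m. x \<odot>\<^bsub>M\<^esub> m) M pr M'"
    and tau: "tau \<in> lin_maps R Z H" "\<And>z. z \<in> carrier Z \<Longrightarrow> p (tau z) = x \<odot>\<^bsub>Z\<^esub> z" and x: "x \<in> carrier R"
    and reg: "\<And>u. \<lbrakk>u \<in> carrier H; x \<odot>\<^bsub>H\<^esub> u = \<zero>\<^bsub>H\<^esub>\<rbrakk> \<Longrightarrow> u = \<zero>\<^bsub>H\<^esub>"
  shows "\<exists>f g. short_exact R H f (sum_module M Z) g M'"
proof -
  note se = short_exactD[OF s] and q = short_exactD[OF quot]
  interpret M: module R M by (rule se)
  interpret H: module R H by (rule se)
  interpret Z: module R Z by (rule se)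
  interpret M': module R M' by (rule q)
  \<comment> \<open>The maps \<open>tau p\<close> and \<open>x\<close> from \<open>H\<close> to \<open>H\<close> agree modulo \<open>M\<close>; their difference \<open>k\<close> takes values in \<open>M\<close> and is \<open>-x\<close> on \<open>M\<close>.\<close>
  have "(\<lambda>u. tau (p u) \<ominus>\<^bsub>H\<^esub> x \<odot>\<^bsub>H\<^esub> u) \<in> lin_maps R H H"
    by (rule lin_diff[OF se(2) lin_comp[OF se(5) tau(1)] lin_scalar[OF se(2) x]])
  moreover have "p (tau (p u) \<ominus>\<^bsub>H\<^esub> x \<odot>\<^bsub>H\<^esub> u) = \<zero>\<^bsub>Z\<^esub>" if "u \<in> carrier H" for u
    using that lin_closed[OF se(5) that] lin_closed[OF tau(1)] x
    by (simp add: lin_minus[OF se(2,3,5)] lin_smult[OF se(5)] tau(2) Z.M.diff_zero_iff)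
  ultimately obtain k where k: "k \<in> lin_maps R H M"
    "\<And>u. u \<in> carrier H \<Longrightarrow> io (k u) = tau (p u) \<ominus>\<^bsub>H\<^esub> x \<odot>\<^bsub>H\<^esub> u"
    using short_exact_factor_sub[OF s se(2)] by blast
  have kio: "k (io m) = \<ominus>\<^bsub>M\<^esub> (x \<odot>\<^bsub>M\<^esub> m)" if m: "m \<in> carrier M" for m
  proof (rule inj_onD[OF se(10)])
    have im: "io m \<in> carrier H" by (rule lin_closed[OF se(4) m])
    show "io (k (io m)) = io (\<ominus>\<^bsub>M\<^esub> (x \<odot>\<^bsub>M\<^esub> m))"
      using m im x
      by (simp add: k(2) se(7) lin_zero[OF se(3,2) tau(1)] lin_neg[OF se(1,2,4)] lin_smult[OF se(4)] H.M.minus_eq)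
  qed (use m x lin_closed[OF k(1) lin_closed[OF se(4) m]] in simp_all)
  have pik: "pr (k (io m)) = \<zero>\<^bsub>M'\<^esub>" if m: "m \<in> carrier M" for m
    using q(7)[of "\<ominus>\<^bsub>M\<^esub> m"] m x by (simp add: kio M.smult_r_minus)
  obtain rho where rho: "rho \<in> lin_maps R Z M'" "\<And>u. u \<in> carrier H \<Longrightarrow> rho (p u) = pr (k u)"
    using short_exact_factor_quot[OF s q(3) lin_comp[OF k(1) q(5)]] pik by blast
  let ?f = "\<lambda>u. (\<ominus>\<^bsub>M\<^esub> k u, p u)" and ?g = "\<lambda>w. pr (fst w) \<oplus>\<^bsub>M'\<^esub> rho (snd w)"
  have "short_exact R H ?f (sum_module M Z) ?g M'"
  proof (rule short_exactI[OF se(2) module_sum[OF se(1,3)] q(3)])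
    show "?f \<in> lin_maps R H (sum_module M Z)"
      by (rule lin_mapsI)
        (simp_all add: lin_simps[OF lin_neg_map[OF se(1) k(1)]] lin_simps[OF se(5)] lin_closed[OF k(1)])
    show "?g \<in> lin_maps R (sum_module M Z) M'"
    proof (rule lin_plus[OF q(3)])
      show "(\<lambda>w. pr (fst w)) \<in> lin_maps R (sum_module M Z) M'"
        by (rule lin_mapsI) (simp_all add: mem_Times_iff lin_simps[OF q(5)])
      show "(\<lambda>w. rho (snd w)) \<in> lin_maps R (sum_module M Z) M'"
        by (rule lin_mapsI) (simp_all add: mem_Times_iff lin_simps[OF rho(1)])
    qed
  next
    fix u assume u: "u \<in> carrier H" "?f u = \<zero>\<^bsub>sum_module M Z\<^esub>"
    have ku: "k u \<in> carrier M" by (rule lin_closed[OF k(1) u(1)])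
    have "k u = \<ominus>\<^bsub>M\<^esub> (\<ominus>\<^bsub>M\<^esub> k u)" using ku by (simp only: M.M.minus_minus)
    then have "k u = \<zero>\<^bsub>M\<^esub>" using u(2) M.M.minus_equality[of "\<zero>\<^bsub>M\<^esub>" "\<zero>\<^bsub>M\<^esub>"] by simp
    then have "\<zero>\<^bsub>H\<^esub> = tau (p u) \<ominus>\<^bsub>H\<^esub> x \<odot>\<^bsub>H\<^esub> u" using k(2)[OF u(1)] lin_zero[OF se(1,2,4)] by simp
    then have "\<zero>\<^bsub>H\<^esub> \<ominus>\<^bsub>H\<^esub> x \<odot>\<^bsub>H\<^esub> u = \<zero>\<^bsub>H\<^esub>" using u(2) lin_zero[OF se(3,2) tau(1)] by simp
    then have "\<zero>\<^bsub>H\<^esub> = x \<odot>\<^bsub>H\<^esub> u" using u(1) x by (subst (asm) H.M.diff_zero_iff) simp_all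
    then show "u = \<zero>\<^bsub>H\<^esub>" using reg u(1) by simp
  next
    fix u assume u: "u \<in> carrier H"
    then show "?g (?f u) = \<zero>\<^bsub>M'\<^esub>"
      using lin_closed[OF k(1) u] lin_closed[OF q(5) lin_closed[OF k(1) u]]
      by (simp add: lin_neg[OF q(2,3,5)] rho(2) M'.M.l_neg)
  next
    fix w assume w: "w \<in> carrier (sum_module M Z)" "?g w = \<zero>\<^bsub>M'\<^esub>"
    then obtain m z where mz: "w = (m, z)" "m \<in> carrier M" "z \<in> carrier Z" "pr m \<oplus>\<^bsub>M'\<^esub> rho z = \<zero>\<^bsub>M'\<^esub>" by auto
    obtain u where u: "u \<in> carrier H" "p u = z" using se(9)[OF mz(3)] by blast
    have ku: "k u \<in> carrier M" by (rule lin_closed[OF k(1) u(1)])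
    have "pr (m \<oplus>\<^bsub>M\<^esub> k u) = \<zero>\<^bsub>M'\<^esub>" using mz ku u rho(2)[OF u(1)] by (simp add: lin_add[OF q(5)])
    then obtain m' where m': "m' \<in> carrier M" "x \<odot>\<^bsub>M\<^esub> m' = m \<oplus>\<^bsub>M\<^esub> k u"
      using q(8)[of "m \<oplus>\<^bsub>M\<^esub> k u"] mz(2) ku by auto
    have im: "io m' \<in> carrier H" by (rule lin_closed[OF se(4) m'(1)])
    have "k (u \<oplus>\<^bsub>H\<^esub> io m') = k u \<oplus>\<^bsub>M\<^esub> (\<ominus>\<^bsub>M\<^esub> (m \<oplus>\<^bsub>M\<^esub> k u))"
      using u(1) im by (simp add: lin_add[OF k(1)] kio[OF m'(1)] m'(2))
    also have "\<dots> = \<ominus>\<^bsub>M\<^esub> m" using ku mz(2) by algebra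
    finally have "\<ominus>\<^bsub>M\<^esub> k (u \<oplus>\<^bsub>H\<^esub> io m') = m" using mz(2) by simp
    moreover have "p (u \<oplus>\<^bsub>H\<^esub> io m') = z" using u im mz(3) by (simp add: lin_add[OF se(5)] se(7)[OF m'(1)])
    ultimately show "\<exists>u\<in>carrier H. ?f u = w" using mz(1) u(1) im by (intro bexI[of _ "u \<oplus>\<^bsub>H\<^esub> io m'"]) simp_all
  next
    fix y assume y: "y \<in> carrier M'"
    then obtain m where "m \<in> carrier M" "pr m = y" using q(9) by blast
    then show "\<exists>w\<in>carrier (sum_module M Z). ?g w = y"
      using lin_zero[OF se(3) q(3) rho(1)] y by (intro bexI[of _ "(m, \<zero>\<^bsub>Z\<^esub>)"]) simp_all
  qed
  then show ?thesis by blast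
qed

section \<open>Resolutions and the annihilator of \<open>Ext\<^sup>1\<close>\<close>

abbreviation image_module :: "('a, 'r) ring_scheme \<Rightarrow> (nat \<Rightarrow> nat) \<Rightarrow> (nat \<Rightarrow> (nat \<Rightarrow> 'a) \<Rightarrow> (nat \<Rightarrow> 'a)) \<Rightarrow> nat \<Rightarrow> ('a, nat \<Rightarrow> 'a) module"
  where "image_module R b d j \<equiv> (free_module R (b j))\<lparr>carrier := d (Suc j) ` carrier (free_module R (b (Suc j)))\<rparr>"

lemma resolution_short_exact:
  assumes "cring R" "module R N" "free_resolution R N b d e"
  shows resolution_short_exact_0: "short_exact R (image_module R b d 0) (\<lambda>x. x) (free_module R (b 0)) e N"
    and resolution_short_exact_Suc: "short_exact R (image_module R b d (Suc j)) (\<lambda>x. x)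
      (free_module R (b (Suc j))) (d (Suc j)) (image_module R b d j)"
proof -
  note F = module_free[OF assms(1)]
  have e: "e \<in> lin_maps R (free_module R (b 0)) N" "e ` carrier (free_module R (b 0)) = carrier N"
    and d: "\<And>k. d (Suc k) \<in> lin_maps R (free_module R (b (Suc k))) (free_module R (b k))"
    and k0: "d (Suc 0) ` carrier (free_module R (b (Suc 0))) = a_kernel (free_module R (b 0)) N e"
    and k: "\<And>k. d (Suc (Suc k)) ` carrier (free_module R (b (Suc (Suc k))))
      = a_kernel (free_module R (b (Suc k))) (free_module R (b k)) (d (Suc k))"
    using assms(3) by (auto simp: free_resolution_def Let_def)
  show "short_exact R (image_module R b d 0) (\<lambda>x. x) (free_module R (b 0)) e N"
    unfolding k0 using short_exact_kernel[OF F assms(2) e] by (simp add: kernel_module_def)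
  have im: "module R (image_module R b d j)" for j
    by (rule submodule.submodule_is_module[OF submodule_image[OF F F d] F])
  let ?F = "free_module R (b (Suc j))" and ?I = "image_module R b d j" and ?J = "image_module R b d (Suc j)"
  have d': "d (Suc j) \<in> lin_maps R ?F ?I"
    by (rule lin_mapsI) (simp_all add: lin_add[OF d] lin_smult[OF d])
  have "short_exact R (kernel_module ?F ?I (d (Suc j))) (\<lambda>x. x)
      ?F (d (Suc j)) ?I"
    by (rule short_exact_kernel[OF F im d']) simp
  moreover have "kernel_module ?F ?I (d (Suc j))
      = image_module R b d (Suc j)"
    unfolding k by (simp add: kernel_module_def a_kernel_def kernel_def)
  ultimately show "short_exact R ?J (\<lambda>x. x)
      ?F (d (Suc j)) ?I"
    by simp
qed

definition syzygy_chain :: "('a, 'r) ring_scheme \<Rightarrow> ('a, 'b, 'm) module_scheme \<Rightarrow> (nat \<Rightarrow> nat)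
    \<Rightarrow> (nat \<Rightarrow> ('a, (nat \<Rightarrow> 'a) set) module) \<Rightarrow> bool"
  where "syzygy_chain R N b K \<longleftrightarrow> module_iso R N (K 0) \<and>
    (\<forall>k. \<exists>f g. short_exact R (K (Suc k)) f (free_module R (b k)) g (K k))"

lemma resolution_syzygy_chain:
  fixes R :: "('a, 'r) ring_scheme"
  assumes "cring R" "module R N" "free_resolution R N b d e"
  obtains K where "syzygy_chain R N b K" "\<And>j. module_iso R (image_module R b d j) (K (Suc j))"
proof -
  note F = module_free[OF assms(1)]
  note e0 = resolution_short_exact_0[OF assms] and es = resolution_short_exact_Suc[OF assms]
  note e = short_exactD[OF e0]
  have "e ` carrier (free_module R (b 0)) = carrier N" using e0 by (simp add: short_exact_def)
  then obtain Z0 :: "('a, (nat \<Rightarrow> 'a) set) module" where Z0: "module_iso R N Z0"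
    using quotient_rep[OF F assms(2) e(5)] by blast
  have "\<exists>Z :: ('a, (nat \<Rightarrow> 'a) set) module. module_iso R (image_module R b d j) Z" for j
  proof (cases j)
    case 0
    show ?thesis unfolding 0 using submodule_rep[OF e0] by blast
  next
    case (Suc i)
    show ?thesis unfolding Suc using submodule_rep[OF es] by blast
  qed
  then obtain Z :: "nat \<Rightarrow> ('a, (nat \<Rightarrow> 'a) set) module" where Z: "\<And>j. module_iso R (image_module R b d j) (Z j)"
    by metis
  define K where "K = case_nat Z0 Z"
  have "\<exists>f g. short_exact R (K (Suc k)) f (free_module R (b k)) g (K k)" for k
  proof (cases k)
    case 0
    obtain f g where "short_exact R (Z 0) f (free_module R (b 0)) g Z0"
      by (rule short_exact_iso[OF e0 Z module_iso_refl[OF F] Z0])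
    then show ?thesis by (auto simp: K_def 0)
  next
    case (Suc i)
    obtain f g where "short_exact R (Z (Suc i)) f (free_module R (b (Suc i))) g (Z i)"
      by (rule short_exact_iso[OF es Z module_iso_refl[OF F] Z])
    then show ?thesis by (auto simp: K_def Suc)
  qed
  then have "syzygy_chain R N b K" using Z0 by (simp add: syzygy_chain_def K_def)
  then show thesis using Z by (intro that[of K]) (simp_all add: K_def)
qed

lemma is_syzygy_chain:
  fixes R :: "('a, 'r) ring_scheme"
  assumes "cring R" "module R N" "is_syzygy R n N X" and "free_resolution R N b0 d0 e0"
  obtains b K where "syzygy_chain R N b K" "module_iso R X (K n)"
proof (cases n)
  case 0
  obtain K where K: "syzygy_chain R N b0 K"
    using resolution_syzygy_chain[OF assms(1,2,4)] by blast
  have "module_iso R X N" using assms(3) by (simp add: is_syzygy_def 0 module_iso_sym)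
  also have "module_iso R N (K 0)" using K by (simp add: syzygy_chain_def)
  finally show thesis using K that by (simp add: 0)
next
  case (Suc j)
  obtain b d e where r: "free_resolution R N b d e" "module_iso R (image_module R b d j) X"
    using assms(3) by (auto simp: is_syzygy_def Suc minimal_free_resolution_def)
  obtain K where K: "syzygy_chain R N b K" "\<And>j. module_iso R (image_module R b d j) (K (Suc j))"
    by (rule resolution_syzygy_chain[OF assms(1,2) r(1)]) (rule that)
  have "module_iso R X (K n)" unfolding Suc by (rule module_iso_trans[OF module_iso_sym[OF r(2)] K(2)])
  with K(1) show thesis by (rule that)
qed

lemma syzygy_chain_nth: "syzygy_chain R N b K \<Longrightarrow> nth_syzygy R N k (K k)"
  by (induction k) (auto simp: syzygy_chain_def intro: nth_syzygy.intros)

text \<open>The hypothesis is applied to a single class, that of \<open>0 \<rightarrow> Y \<rightarrow> G \<rightarrow> N \<rightarrow> 0\<close>. That \<open>x\<close> kills it means that its pullback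
  along \<open>x : N \<rightarrow> N\<close> splits, so \<open>x\<close> lifts to a map \<open>N \<rightarrow> G\<close>.\<close>

lemma ext_annihilator_factors_free:
  fixes R :: "('a, 'r) ring_scheme"
  assumes R: "cring R" and N: "module R N" and Y: "is_syzygy R 1 N Y" and x: "x \<in> carrier R"
    and ann: "annihilates x (ext_module R 1 N Y)"
  shows "factors_free R x N"
proof -
  note F = module_free[OF R]
  obtain b' d' e' where r': "free_resolution R N b' d' e'" and iso: "module_iso R (image_module R b' d' 0) Y"
    using Y by (auto simp: is_syzygy_def minimal_free_resolution_def)
  let ?res = "\<lambda>(b, d, e). free_resolution R N b d e"
  obtain b d e where bde: "(SOME p. ?res p) = (b, d, e)" by (metis prod_cases3)
  have "?res (SOME p. ?res p)" by (rule someI[of ?res "(b', d', e')"]) (simp add: r')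
  then have r: "free_resolution R N b d e" by (simp add: bde)
  note s = resolution_short_exact_0[OF R N r] and s' = resolution_short_exact_0[OF R N r']
  note t = short_exactD[OF s] and t' = short_exactD[OF s']
  obtain \<phi> \<psi> where Im: "module R (image_module R b' d' 0)" and Ym: "module R Y"
    and \<phi>: "\<phi> \<in> lin_maps R (image_module R b' d' 0) Y" and \<psi>: "\<psi> \<in> lin_maps R Y (image_module R b' d' 0)"
    and \<psi>\<phi>: "\<And>u. u \<in> carrier (image_module R b' d' 0) \<Longrightarrow> \<psi> (\<phi> u) = u"
    and \<phi>\<psi>: "\<And>y. y \<in> carrier Y \<Longrightarrow> \<phi> (\<psi> y) = y"
    by (rule module_isoE[OF iso]) (rule that)
  let ?F0 = "free_module R (b 0)" and ?F1 = "free_module R (b (Suc 0))" and ?F2 = "free_module R (b (Suc (Suc 0)))"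
  let ?G0 = "free_module R (b' 0)"
  interpret Y: module R Y by (rule Ym)
  interpret G: module R ?G0 by (rule F)
  interpret N: module R N by (rule N)
  have d: "d (Suc 0) \<in> lin_maps R ?F1 ?F0" "d (Suc (Suc 0)) \<in> lin_maps R ?F2 ?F1"
    and d2: "d (Suc (Suc 0)) ` carrier ?F2 = a_kernel ?F1 ?F0 (d (Suc 0))"
    and d1: "d (Suc 0) ` carrier ?F1 = a_kernel ?F0 N e"
    using r by (auto simp: free_resolution_def Let_def)
  have d1': "d' (Suc 0) ` carrier (free_module R (b' (Suc 0))) = a_kernel ?G0 N e'"
    using r' by (auto simp: free_resolution_def Let_def)
  obtain c where c: "c \<in> lin_maps R ?F0 ?G0" "\<And>u. u \<in> carrier ?F0 \<Longrightarrow> e' (c u) = e u"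
    using free_module_lift[OF t'(2,3,5,9) t(5)] by blast
  have ed: "e (d (Suc 0) u) = \<zero>\<^bsub>N\<^esub>" if "u \<in> carrier ?F1" for u
  proof -
    have "d (Suc 0) u \<in> a_kernel ?F0 N e" using that d1 by blast
    then show ?thesis by (simp add: mem_a_kernel)
  qed
  \<comment> \<open>\<open>Ext\<close> is computed with an arbitrary resolution \<open>(b, d, e)\<close>, while \<open>Y\<close> comes from \<open>(b', d', e')\<close>. The
    comparison map \<open>F\<^sub>1 \<rightarrow> Y\<close> is a cocycle for the extension \<open>0 \<rightarrow> Y \<rightarrow> G\<^sub>0 \<rightarrow> N \<rightarrow> 0\<close>.\<close>
  have cd: "(\<lambda>u. c (d (Suc 0) u)) \<in> lin_maps R ?F1 (image_module R b' d' 0)"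
  proof (rule lin_mapsI)
    fix u assume u: "u \<in> carrier ?F1"
    have "c (d (Suc 0) u) \<in> a_kernel ?G0 N e'"
      using lin_closed[OF d(1) u] ed[OF u] by (simp add: mem_a_kernel c(2) lin_closed[OF c(1)])
    then show "c (d (Suc 0) u) \<in> carrier (image_module R b' d' 0)" by (simp add: d1')
  qed (simp_all add: lin_simps[OF c(1)] lin_simps[OF d(1)])
  define h where "h = (\<lambda>u\<in>carrier ?F1. \<phi> (c (d (Suc 0) u)))"
  note pcd = lin_comp[OF cd \<phi>]
  have h_lin: "h \<in> lin_maps R ?F1 Y"
    by (rule lin_cong[OF pcd F]) (simp add: h_def)
  have "h \<in> ext_cocycles R b d (Suc 0) Y"
  proof -
    have "h (d (Suc (Suc 0)) u) = \<zero>\<^bsub>Y\<^esub>" if u: "u \<in> carrier ?F2" for u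
    proof -
      have "d (Suc (Suc 0)) u \<in> a_kernel ?F1 ?F0 (d (Suc 0))" using u d2 by blast
      then have "d (Suc (Suc 0)) u \<in> carrier ?F1" "d (Suc 0) (d (Suc (Suc 0)) u) = \<zero>\<^bsub>?F0\<^esub>"
        by (simp_all add: mem_a_kernel)
      then show ?thesis
        using lin_zero[OF F F c(1)] lin_zero[OF Im Ym \<phi>] by (simp add: h_def)
    qed
    then have "compose (carrier ?F2) h (d (Suc (Suc 0))) = \<zero>\<^bsub>hom_module R ?F2 Y\<^esub>"
      by (simp add: hom_module_def compose_def cong: restrict_cong)
    then show ?thesis
      using h_lin by (simp add: ext_cocycles_def hom_module_def h_def)
  qed
  define H where "H = (hom_module R ?F1 Y)\<lparr>carrier := ext_cocycles R b d (Suc 0) Y\<rparr>"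
  define B where "B = ext_coboundaries R b d (Suc 0) Y"
  have ext: "ext_module R 1 N Y = quot_module H B"
    by (simp add: ext_module_def bde H_def B_def)
  have addH: "u \<oplus>\<^bsub>H\<^esub> v = (\<lambda>w\<in>carrier ?F1. u w \<oplus>\<^bsub>Y\<^esub> v w)"
    and smultH: "x \<odot>\<^bsub>H\<^esub> u = (\<lambda>w\<in>carrier ?F1. x \<odot>\<^bsub>Y\<^esub> u w)" for u v
    by (simp_all add: H_def hom_module_def)
  have zeroB: "(\<lambda>w\<in>carrier ?F1. \<zero>\<^bsub>Y\<^esub>) \<in> B"
  proof -
    have "(\<lambda>w\<in>carrier ?F0. \<zero>\<^bsub>Y\<^esub>) \<in> lin_maps R ?F0 Y"
      by (rule lin_cong[OF lin_zero_map[OF Ym] F]) simp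
    then have "(\<lambda>w\<in>carrier ?F0. \<zero>\<^bsub>Y\<^esub>) \<in> carrier (hom_module R ?F0 Y)"
      by (simp add: hom_module_def)
    moreover have "compose (carrier ?F1) (\<lambda>w\<in>carrier ?F0. \<zero>\<^bsub>Y\<^esub>) (d (Suc 0)) = (\<lambda>w\<in>carrier ?F1. \<zero>\<^bsub>Y\<^esub>)"
      by (simp add: compose_def lin_closed[OF d(1)] cong: restrict_cong)
    ultimately show ?thesis unfolding B_def ext_coboundaries_def by (simp add: image_iff) metis
  qed
  have coset: "u \<in> B +>\<^bsub>H\<^esub> u" if u: "u \<in> lin_maps R ?F1 Y" "u \<in> extensional (carrier ?F1)" for u
  proof -
    have "(\<lambda>w\<in>carrier ?F1. (\<lambda>w\<in>carrier ?F1. \<zero>\<^bsub>Y\<^esub>) w \<oplus>\<^bsub>Y\<^esub> u w) = (\<lambda>w\<in>carrier ?F1. u w)"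
      by (rule restrict_ext) (simp add: lin_closed[OF u(1)])
    also have "\<dots> = u" using u(2) by (rule extensional_restrict)
    finally have eq: "(\<lambda>w\<in>carrier ?F1. (\<lambda>w\<in>carrier ?F1. \<zero>\<^bsub>Y\<^esub>) w \<oplus>\<^bsub>Y\<^esub> u w) = u" .
    show ?thesis
      unfolding a_r_coset_def' addH by (rule UN_I[OF zeroB]) (simp only: eq singleton_iff)
  qed
  have "B +>\<^bsub>H\<^esub> h \<in> carrier (quot_module H B)"
    using \<open>h \<in> ext_cocycles R b d (Suc 0) Y\<close> by (auto simp: A_RCOSETS_def' H_def)
  then have xB: "(\<Union>u\<in>B +>\<^bsub>H\<^esub> h. B +>\<^bsub>H\<^esub> (x \<odot>\<^bsub>H\<^esub> u)) = B"
    using ann unfolding ext annihilates_def by simp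
  have hh: "h \<in> B +>\<^bsub>H\<^esub> h" by (rule coset[OF h_lin]) (simp add: h_def)
  have "x \<odot>\<^bsub>H\<^esub> h \<in> B +>\<^bsub>H\<^esub> (x \<odot>\<^bsub>H\<^esub> h)"
  proof (rule coset)
    show "x \<odot>\<^bsub>H\<^esub> h \<in> lin_maps R ?F1 Y"
      unfolding smultH by (rule lin_cong[OF lin_scale[OF Ym h_lin x] F]) simp
  qed (simp add: smultH)
  then have "x \<odot>\<^bsub>H\<^esub> h \<in> B" using xB hh by blast
  then obtain g where g: "g \<in> lin_maps R ?F0 Y" "x \<odot>\<^bsub>H\<^esub> h = compose (carrier ?F1) g (d (Suc 0))"
    by (auto simp: B_def ext_coboundaries_def hom_module_def)
  have gd: "g (d (Suc 0) u) = x \<odot>\<^bsub>Y\<^esub> \<phi> (c (d (Suc 0) u))" if "u \<in> carrier ?F1" for u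
    using fun_cong[OF g(2), of u] that by (simp add: smultH compose_def h_def)
  \<comment> \<open>Hence \<open>x c - \<psi> g\<close> vanishes on the image of \<open>F\<^sub>1\<close> and descends to a lift of \<open>x : N \<rightarrow> N\<close>.\<close>
  have inc: "(\<lambda>u. u) \<in> lin_maps R (image_module R b' d' 0) ?G0" by (rule t'(4))
  note \<psi>' = lin_comp[OF \<psi> inc]
  have psig: "(\<lambda>u. \<psi> (g u)) \<in> lin_maps R ?F0 ?G0" by (rule lin_comp[OF g(1) \<psi>'])
  have k: "(\<lambda>u. x \<odot>\<^bsub>?G0\<^esub> c u \<ominus>\<^bsub>?G0\<^esub> \<psi> (g u)) \<in> lin_maps R ?F0 ?G0"
    by (rule lin_diff[OF F lin_scale[OF F c(1) x] psig])
  have "x \<odot>\<^bsub>?G0\<^esub> c v \<ominus>\<^bsub>?G0\<^esub> \<psi> (g v) = \<zero>\<^bsub>?G0\<^esub>" if v: "v \<in> carrier (image_module R b d 0)" for v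
  proof -
    obtain u where u: "u \<in> carrier ?F1" "v = d (Suc 0) u" using v by auto
    have cu: "c v \<in> carrier (image_module R b' d' 0)" using lin_closed[OF cd u(1)] u(2) by simp
    have "\<psi> (g v) = x \<odot>\<^bsub>?G0\<^esub> c v"
      using gd[OF u(1)] u(2) lin_smult[OF \<psi> x lin_closed[OF \<phi> cu]] \<psi>\<phi>[OF cu] by simp
    moreover have "x \<odot>\<^bsub>?G0\<^esub> c v \<in> carrier ?G0" using lin_closed[OF inc cu] x by simp
    ultimately show ?thesis by (simp add: G.M.diff_zero_iff)
  qed
  then obtain k' where k': "k' \<in> lin_maps R N ?G0" "\<And>u. u \<in> carrier ?F0 \<Longrightarrow> k' (e u) = x \<odot>\<^bsub>?G0\<^esub> c u \<ominus>\<^bsub>?G0\<^esub> \<psi> (g u)"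
    using short_exact_factor_quot[OF s F k] by blast
  have "e' (k' y) = x \<odot>\<^bsub>N\<^esub> y" if y: "y \<in> carrier N" for y
  proof -
    obtain u where u: "u \<in> carrier ?F0" "e u = y" using t(9)[OF y] by blast
    have cu: "c u \<in> carrier ?G0" "\<psi> (g u) \<in> carrier ?G0"
      using lin_closed[OF c(1) u(1)] lin_closed[OF psig u(1)] by auto
    have "e' (\<psi> (g u)) = \<zero>\<^bsub>N\<^esub>" by (rule t'(7)[OF lin_closed[OF \<psi> lin_closed[OF g(1) u(1)]]])
    then show ?thesis
      using k'(2)[OF u(1)] u cu x y
      by (simp add: lin_minus[OF F N t'(5)] lin_smult[OF t'(5)] c(2) N.M.diff_eq_iff)
  qed
  then show ?thesis unfolding factors_free_def using k'(1) t'(5) by blast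
qed

section \<open>Regular sequences on syzygies\<close>

text \<open>The submodule \<open>(x\<^sub>1, \<dots>, x\<^sub>j) X\<close>, built one element at a time. Over \<open>R\<close> itself it is the ideal
  \<open>(x\<^sub>1, \<dots>, x\<^sub>j)\<close>.\<close>

primrec seq_smult :: "('a, 'b, 'm) module_scheme \<Rightarrow> 'a list \<Rightarrow> nat \<Rightarrow> 'b set"
  where "seq_smult X xs 0 = {\<zero>\<^bsub>X\<^esub>}"
  | "seq_smult X xs (Suc j) = {u \<oplus>\<^bsub>X\<^esub> xs ! j \<odot>\<^bsub>X\<^esub> m | u m. u \<in> seq_smult X xs j \<and> m \<in> carrier X}"

lemma seq_smult_SucI:
  "\<lbrakk>u \<in> seq_smult X xs j; m \<in> carrier X\<rbrakk> \<Longrightarrow> u \<oplus>\<^bsub>X\<^esub> xs ! j \<odot>\<^bsub>X\<^esub> m \<in> seq_smult X xs (Suc j)"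
  by auto

lemma seq_smult_SucE:
  assumes "v \<in> seq_smult X xs (Suc j)"
  obtains u m where "u \<in> seq_smult X xs j" "m \<in> carrier X" "v = u \<oplus>\<^bsub>X\<^esub> xs ! j \<odot>\<^bsub>X\<^esub> m"
  using assms by auto

lemma submodule_seq_smult:
  assumes "module R X" "set xs \<subseteq> carrier R" "j \<le> length xs"
  shows "submodule (seq_smult X xs j) R X"
  using assms(3)
proof (induction j)
  interpret X: module R X by fact
  {
    case 0
    have "\<ominus>\<^bsub>X\<^esub> \<zero>\<^bsub>X\<^esub> = \<zero>\<^bsub>X\<^esub>" by (rule X.M.minus_equality) simp_all
    then show ?case by (intro X.submoduleI) simp_all
  next
    case (Suc j)
    let ?U = "X\<lparr>carrier := seq_smult X xs j\<rparr>"
    have sub: "submodule (seq_smult X xs j) R X" and x: "xs ! j \<in> carrier R"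
      using Suc assms(2) by (auto simp: subset_iff)
    note U = submodule.submodule_is_module[OF sub assms(1)]
    \<comment> \<open>The sum \<open>(x\<^sub>1, \<dots>, x\<^sub>j) X + x\<^sub>j\<^sub>+\<^sub>1 X\<close> is the image of \<open>(u, m) \<mapsto> u + x\<^sub>j\<^sub>+\<^sub>1 m\<close>.\<close>
    have "(\<lambda>w. fst w \<oplus>\<^bsub>X\<^esub> xs ! j \<odot>\<^bsub>X\<^esub> snd w) \<in> lin_maps R (sum_module ?U X) X"
      using X.submoduleE(1)[OF sub] x
      by (intro lin_plus[OF assms(1)] lin_scale[OF assms(1)] lin_mapsI) auto
    from submodule_image[OF module_sum[OF U assms(1)] assms(1) this]
    show ?case by (rule back_subst[of "\<lambda>H. submodule H R X"]) force
  }
qed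

lemma seq_smultD:
  assumes "module R X" "set xs \<subseteq> carrier R" "j \<le> length xs"
  shows seq_smult_carrier: "u \<in> seq_smult X xs j \<Longrightarrow> u \<in> carrier X"
    and seq_smult_zero: "\<zero>\<^bsub>X\<^esub> \<in> seq_smult X xs j"
    and seq_smult_add: "\<lbrakk>u \<in> seq_smult X xs j; v \<in> seq_smult X xs j\<rbrakk> \<Longrightarrow> u \<oplus>\<^bsub>X\<^esub> v \<in> seq_smult X xs j"
    and seq_smult_neg: "u \<in> seq_smult X xs j \<Longrightarrow> \<ominus>\<^bsub>X\<^esub> u \<in> seq_smult X xs j"
    and seq_smult_smult: "\<lbrakk>a \<in> carrier R; u \<in> seq_smult X xs j\<rbrakk> \<Longrightarrow> a \<odot>\<^bsub>X\<^esub> u \<in> seq_smult X xs j"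
  using module.submoduleE[OF assms(1) submodule_seq_smult[OF assms]]
    subgroup.one_closed[OF submodule.axioms(1)[OF submodule_seq_smult[OF assms]]]
  by (auto simp: subset_iff)

lemma seq_smult_lin:
  assumes "module R X" "module R Y" "f \<in> lin_maps R X Y" "set xs \<subseteq> carrier R" "j \<le> length xs"
    and "u \<in> seq_smult X xs j"
  shows "f u \<in> seq_smult Y xs j"
  using assms(5,6)
proof (induction j arbitrary: u)
  case 0
  then show ?case using lin_zero[OF assms(1-3)] by simp
next
  case (Suc j)
  interpret X: module R X by fact
  obtain v m where v: "v \<in> seq_smult X xs j" "m \<in> carrier X" "u = v \<oplus>\<^bsub>X\<^esub> xs ! j \<odot>\<^bsub>X\<^esub> m"
    using Suc.prems(2) by (rule seq_smult_SucE)
  have j: "j \<le> length xs" and x: "xs ! j \<in> carrier R" using Suc.prems(1) assms(4) by (auto simp: subset_iff)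
  have "v \<in> carrier X" by (rule seq_smult_carrier[OF assms(1,4) j v(1)])
  then have "f u = f v \<oplus>\<^bsub>Y\<^esub> xs ! j \<odot>\<^bsub>Y\<^esub> f m"
    using v x by (simp add: lin_add[OF assms(3)] lin_smult[OF assms(3)])
  then show ?case using seq_smult_SucI[OF Suc.IH[OF j v(1)] lin_closed[OF assms(3) v(2)]] by simp
qed

lemma seq_smult_lin_surj:
  assumes "module R X" "module R Y" "f \<in> lin_maps R X Y" "set xs \<subseteq> carrier R" "j \<le> length xs"
    and surj: "\<And>y. y \<in> carrier Y \<Longrightarrow> \<exists>x\<in>carrier X. f x = y" and "w \<in> seq_smult Y xs j"
  shows "\<exists>u\<in>seq_smult X xs j. f u = w"
  using assms(5,7)
proof (induction j arbitrary: w)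
  case 0
  then show ?case using lin_zero[OF assms(1-3)] by simp
next
  case (Suc j)
  interpret X: module R X by fact
  have j: "j \<le> length xs" and x: "xs ! j \<in> carrier R" using Suc.prems(1) assms(4) by (auto simp: subset_iff)
  obtain v m where v: "v \<in> seq_smult Y xs j" "m \<in> carrier Y" "w = v \<oplus>\<^bsub>Y\<^esub> xs ! j \<odot>\<^bsub>Y\<^esub> m"
    using Suc.prems(2) by (rule seq_smult_SucE)
  obtain u where u: "u \<in> seq_smult X xs j" "f u = v" using Suc.IH[OF j v(1)] by blast
  obtain n where n: "n \<in> carrier X" "f n = m" using surj[OF v(2)] by blast
  have "u \<in> carrier X" by (rule seq_smult_carrier[OF assms(1,4) j u(1)])
  then have "f (u \<oplus>\<^bsub>X\<^esub> xs ! j \<odot>\<^bsub>X\<^esub> n) = w"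
    using u n v x by (simp add: lin_add[OF assms(3)] lin_smult[OF assms(3)])
  then show ?case using seq_smult_SucI[OF u(1) n(1)] by blast
qed

lemma seq_smult_free:
  assumes "cring R" "set xs \<subseteq> carrier R" "j \<le> length xs"
  shows "u \<in> seq_smult (free_module R b) xs j \<longleftrightarrow>
    u \<in> carrier (free_module R b) \<and> (\<forall>i<b. u i \<in> seq_smult (ring_module R) xs j)"
    (is "u \<in> seq_smult ?F _ _ \<longleftrightarrow> _ \<and> (\<forall>i<b. u i \<in> seq_smult ?R _ _)")
  using assms(3)
proof (induction j arbitrary: u)
  case 0
  interpret R: cring R by fact
  show ?case
  proof
    assume "u \<in> seq_smult ?F xs 0"
    then have "u = (\<lambda>i\<in>{..<b}. \<zero>\<^bsub>R\<^esub>)" by (simp add: free_module_def)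
    then show "u \<in> carrier ?F \<and> (\<forall>i<b. u i \<in> seq_smult ?R xs 0)"
      by (simp add: free_module_def)
  next
    assume "u \<in> carrier ?F \<and> (\<forall>i<b. u i \<in> seq_smult ?R xs 0)"
    then have "(\<lambda>i\<in>{..<b}. \<zero>\<^bsub>R\<^esub>) = u"
      by (intro restrict_eqI[of u "{..<b}" "\<lambda>_. carrier R"]) (simp_all add: free_module_def)
    then show "u \<in> seq_smult ?F xs 0" by (simp add: free_module_def)
  qed
next
  case (Suc j)
  then have IH: "u \<in> seq_smult ?F xs j \<longleftrightarrow>
      u \<in> carrier ?F \<and> (\<forall>i<b. u i \<in> seq_smult ?R xs j)" for u
    by simp
  interpret R: cring R by fact
  have x: "xs ! j \<in> carrier R" using Suc.prems assms(2) by (auto simp: subset_iff)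
  show ?case
  proof
    assume "u \<in> seq_smult ?F xs (Suc j)"
    then obtain v m where v: "v \<in> seq_smult ?F xs j" "m \<in> carrier ?F"
      "u = v \<oplus>\<^bsub>?F\<^esub> xs ! j \<odot>\<^bsub>?F\<^esub> m"
      by (rule seq_smult_SucE)
    have vi: "v i \<in> seq_smult ?R xs j" and mi: "m i \<in> carrier R" and vc: "v i \<in> carrier R" if "i < b" for i
      using v(1,2) that unfolding IH by (auto simp: free_module_def)
    have "u i \<in> seq_smult ?R xs (Suc j)" if "i < b" for i
      using seq_smult_SucI[OF vi[OF that], of "m i"] mi[OF that] that v(3) by (simp add: free_module_def)
    moreover have "u \<in> carrier ?F"
      using v(3) x mi vc by (simp add: free_module_def)
    ultimately show "u \<in> carrier ?F \<and> (\<forall>i<b. u i \<in> seq_smult ?R xs (Suc j))" by blast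
  next
    assume u: "u \<in> carrier ?F \<and> (\<forall>i<b. u i \<in> seq_smult ?R xs (Suc j))"
    have "\<forall>i. \<exists>v m. i < b \<longrightarrow> v \<in> seq_smult ?R xs j \<and> m \<in> carrier R \<and> u i = v \<oplus>\<^bsub>R\<^esub> xs ! j \<otimes>\<^bsub>R\<^esub> m"
      using u by auto
    then obtain v m where vm: "\<And>i. i < b \<Longrightarrow> v i \<in> seq_smult ?R xs j"
      "\<And>i. i < b \<Longrightarrow> m i \<in> carrier R" "\<And>i. i < b \<Longrightarrow> u i = v i \<oplus>\<^bsub>R\<^esub> xs ! j \<otimes>\<^bsub>R\<^esub> m i"
      by metis
    have vc: "v i \<in> carrier R" if "i < b" for i
      using seq_smult_carrier[OF module_ring[OF assms(1)] assms(2) _ vm(1)[OF that]] Suc.prems by simp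
    have "restrict v {..<b} \<in> seq_smult ?F xs j"
      unfolding IH using vm(1) vc by (simp add: free_module_def)
    moreover have "restrict m {..<b} \<in> carrier ?F" using vm(2) by (simp add: free_module_def)
    moreover have "restrict v {..<b} \<oplus>\<^bsub>?F\<^esub> xs ! j \<odot>\<^bsub>?F\<^esub> restrict m {..<b} = u"
      unfolding free_module_def finite_sum_module_simps
      by (rule restrict_eqI) (use u vm(3) in \<open>auto simp: free_module_def\<close>)
    ultimately show "u \<in> seq_smult ?F xs (Suc j)" using seq_smult_SucI by metis
  qed
qed

lemma seq_smult_ring:
  assumes "cring R" "set xs \<subseteq> carrier R" "j \<le> length xs"
  shows "seq_smult (ring_module R) xs j = genideal R (set (take j xs))"
proof
  let ?J = "seq_smult (ring_module R) xs" and ?I = "\<lambda>j. genideal R (set (take j xs))"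
  interpret R: cring R by fact
  have sub: "set (take j xs) \<subseteq> carrier R" for j using assms(2) set_take_subset by (rule order_trans[rotated])
  show "?J j \<subseteq> genideal R (set (take j xs))"
    using assms(3)
  proof (induction j)
    case 0
    interpret I: ideal "genideal R (set (take 0 xs))" R by (rule R.genideal_ideal[OF sub])
    show ?case using I.zero_closed by simp
  next
    case (Suc j)
    interpret I: ideal "?I (Suc j)" R by (rule R.genideal_ideal[OF sub])
    have xj: "xs ! j \<in> ?I (Suc j)"
      using R.genideal_self[OF sub, of "Suc j"] Suc.prems by (simp add: take_Suc_conv_app_nth)
    have "set (take j xs) \<subseteq> set (take (Suc j) xs)" by (rule set_take_subset_set_take) simp
    then have "genideal R (set (take j xs)) \<subseteq> ?I (Suc j)"
      using R.genideal_self[OF sub, of "Suc j"] by (intro R.genideal_minimal I.ideal_axioms) blast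
    then have "?J j \<subseteq> ?I (Suc j)"
      using Suc by simp
    then show ?case using xj by (auto intro!: I.a_closed I.I_r_closed)
  qed
  note m = module_ring[OF assms(1)]
  have gen: "xs ! i \<in> ?J j" if "i < j" "j \<le> length xs" for i j
    using that
  proof (induction j)
    case (Suc j)
    note S = seq_smultD[OF m assms(2), of j]
    have xj: "xs ! j \<in> carrier R" using Suc.prems assms(2) by (auto simp: subset_iff)
    show ?case
    proof (cases "i = j")
      case True
      then show ?thesis
        using seq_smult_SucI[OF S(2), of "\<one>\<^bsub>R\<^esub>"] Suc.prems xj by simp
    next
      case False
      then have i: "xs ! i \<in> ?J j" using Suc by simp
      then have "xs ! i \<in> carrier R" using S(1) Suc.prems by simp
      then show ?thesis
        using seq_smult_SucI[OF i, of "\<zero>\<^bsub>R\<^esub>"] Suc.prems xj by simp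
    qed
  qed simp
  note S = seq_smultD[OF m assms(2,3)]
  have "ideal (?J j) R"
  proof (rule idealI)
    show "ring R" ..
    show "subgroup (?J j) (add_monoid R)"
    proof (rule R.add.subgroupI)
      show "?J j \<subseteq> carrier R" using S(1) by auto
      show "?J j \<noteq> {}" using S(2) by blast
      fix a assume a: "a \<in> ?J j"
      then have ac: "a \<in> carrier R" using S(1) by simp
      show "\<ominus>\<^bsub>R\<^esub> a \<in> ?J j"
        using S(5)[of "\<ominus>\<^bsub>R\<^esub> \<one>\<^bsub>R\<^esub>" a] a ac by (simp add: R.l_minus)
      fix b assume "b \<in> ?J j"
      then show "a \<oplus>\<^bsub>R\<^esub> b \<in> ?J j" using S(3)[OF a] by simp
    qed
    fix a r assume a: "a \<in> ?J j" and r: "r \<in> carrier R"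
    show "r \<otimes>\<^bsub>R\<^esub> a \<in> ?J j" using S(5)[OF r a] by simp
    moreover have "a \<in> carrier R" using S(1)[OF a] by simp
    ultimately show "a \<otimes>\<^bsub>R\<^esub> r \<in> ?J j" using r by (simp add: R.m_comm)
  qed
  then show "genideal R (set (take j xs)) \<subseteq> ?J j"
  proof (rule R.genideal_minimal)
    show "set (take j xs) \<subseteq> ?J j"
      using gen assms(3) by (auto simp: in_set_conv_nth)
  qed
qed

lemma ideal_smult_eq_seq_smult:
  assumes "module R X" "set xs \<subseteq> carrier R"
  shows "ideal_smult R (genideal R (set xs)) X = seq_smult X xs (length xs)"
proof
  interpret X: module R X by fact
  note S = seq_smultD[OF assms order_refl]
  let ?P = "{a \<odot>\<^bsub>X\<^esub> u | a u. a \<in> genideal R (set xs) \<and> u \<in> carrier X}"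
  show "ideal_smult R (genideal R (set xs)) X \<subseteq> seq_smult X xs (length xs)"
  proof -
    have "a \<odot>\<^bsub>X\<^esub> u \<in> seq_smult X xs (length xs)" if a: "a \<in> genideal R (set xs)" and u: "u \<in> carrier X" for a u
    proof -
      have "(\<lambda>a. a \<odot>\<^bsub>X\<^esub> u) \<in> lin_maps R (ring_module R) X"
        by (rule lin_mapsI) (simp_all add: u X.smult_l_distr X.smult_assoc1)
      moreover have "a \<in> seq_smult (ring_module R) xs (length xs)"
        using a seq_smult_ring[OF X.R.is_cring assms(2) order_refl] by simp
      ultimately show ?thesis
        using seq_smult_lin[OF module_ring[OF X.R.is_cring] assms(1) _ assms(2) order_refl] by blast
    qed
    then show ?thesis
      unfolding ideal_smult_def module_span_def using submodule_seq_smult[OF assms order_refl] by blast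
  qed
  show "seq_smult X xs (length xs) \<subseteq> ideal_smult R (genideal R (set xs)) X"
    unfolding ideal_smult_def module_span_def
  proof (rule Inter_greatest)
    fix H assume H: "H \<in> {H. submodule H R X \<and> ?P \<subseteq> H}"
    then have H': "submodule H R X" "?P \<subseteq> H" by auto
    have "seq_smult X xs j \<subseteq> H" if "j \<le> length xs" for j
      using that
    proof (induction j)
      case 0
      show ?case using subgroup.one_closed[OF submodule.axioms(1)[OF H'(1)]] by simp
    next
      case (Suc j)
      have "xs ! j \<in> genideal R (set xs)" using X.R.genideal_self[OF assms(2)] Suc.prems by (simp add: subset_iff)
      then have "xs ! j \<odot>\<^bsub>X\<^esub> m \<in> H" if "m \<in> carrier X" for m using that H'(2) by blast
      then show ?case using Suc X.submoduleE(5)[OF H'(1)] by (auto simp: subset_iff)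
    qed
    then show "seq_smult X xs (length xs) \<subseteq> H" by simp
  qed
qed

lemma regular_seq_ring:
  assumes "cring R" "regular_seq R xs" "j < length xs" "r \<in> carrier R"
    "xs ! j \<otimes>\<^bsub>R\<^esub> r \<in> seq_smult (ring_module R) xs j"
  shows "r \<in> seq_smult (ring_module R) xs j"
  using assms seq_smult_ring[OF assms(1), of xs j] by (auto simp: regular_seq_def)

lemma regular_seq_free:
  assumes "cring R" "regular_seq R xs" "j < length xs" "u \<in> carrier (free_module R b)"
    "xs ! j \<odot>\<^bsub>free_module R b\<^esub> u \<in> seq_smult (free_module R b) xs j"
  shows "u \<in> seq_smult (free_module R b) xs j"
proof -
  have xs: "set xs \<subseteq> carrier R" using assms(2) by (simp add: regular_seq_def)
  have j: "j \<le> length xs" using assms(3) by simp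
  have "u i \<in> seq_smult (ring_module R) xs j" if i: "i < b" for i
  proof (rule regular_seq_ring[OF assms(1-3)])
    show "u i \<in> carrier R" using assms(4) i by (auto simp: free_module_def)
    show "xs ! j \<otimes>\<^bsub>R\<^esub> u i \<in> seq_smult (ring_module R) xs j"
      using assms(5) i unfolding seq_smult_free[OF assms(1) xs j] by (simp add: free_module_def)
  qed
  then show ?thesis using assms(4) by (simp add: seq_smult_free[OF assms(1) xs j])
qed

text \<open>A \<open>(k+1)\<close>-st syzygy \<open>K\<^sub>k\<^sub>+\<^sub>1 \<subseteq> F\<^sub>k\<close> satisfies \<open>K\<^sub>k\<^sub>+\<^sub>1 \<inter> (x\<^sub>1, \<dots>, x\<^sub>j) F\<^sub>k = (x\<^sub>1, \<dots>, x\<^sub>j) K\<^sub>k\<^sub>+\<^sub>1\<close> for \<open>j \<le> k\<close>, which says that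
  \<open>Tor\<^sub>1(R/(x\<^sub>1, \<dots>, x\<^sub>j), K\<^sub>k) = 0\<close>. Hence the next element \<open>x\<^sub>j\<^sub>+\<^sub>1\<close>, being regular on \<open>F\<^sub>k\<close> modulo
  \<open>(x\<^sub>1, \<dots>, x\<^sub>j)\<close>, is regular on \<open>K\<^sub>k\<^sub>+\<^sub>1\<close> modulo the same elements, and this in turn feeds the step from
  \<open>j\<close> to \<open>j + 1\<close>.\<close>

lemma regular_seq_syzygy:
  assumes R: "cring R" and reg: "regular_seq R xs"
    and ch: "\<And>k. short_exact R (K (Suc k)) (f k) (free_module R (b k)) (g k) (K k)"
    and "j < length xs" "j \<le> k" "m \<in> carrier (K (Suc k))" "xs ! j \<odot>\<^bsub>K (Suc k)\<^esub> m \<in> seq_smult (K (Suc k)) xs j"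
  shows "m \<in> seq_smult (K (Suc k)) xs j"
proof -
  have xs: "set xs \<subseteq> carrier R" using reg by (simp add: regular_seq_def)
  have x: "xs ! j \<in> carrier R" if "j < length xs" for j using xs that by (auto simp: subset_iff)
  note se = short_exactD[OF ch]
  have intersect: "m \<in> seq_smult (K (Suc k)) xs j"
    if "j < length xs" "j \<le> k" "m \<in> carrier (K (Suc k))" "f k m \<in> seq_smult (free_module R (b k)) xs j" for j k m
    using that
  proof (induction j arbitrary: k m)
    case 0
    then show ?case using se(6) by simp
  next
    case (Suc j)
    from Suc.prems(2) obtain i where k: "k = Suc i" "j \<le> i" by (auto dest: Suc_le_D)
    have j: "j < length xs" "j \<le> length xs" using Suc.prems(1) by auto
    note xj = x[OF j(1)]
    let ?F = "free_module R (b k)" and ?L = "K (Suc k)" and ?x = "xs ! j"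
    let ?JF = "seq_smult ?F xs j"
    interpret F: module R ?F by (rule se)
    interpret K: module R "K k" by (rule se)
    interpret L: module R "?L" by (rule se)
    note SF = seq_smultD[OF se(2)[of k] xs j(2)] and SK = seq_smultD[OF se(3)[of k] xs j(2)]
    obtain y w where yw: "y \<in> ?JF" "w \<in> carrier ?F" "f k m = y \<oplus>\<^bsub>?F\<^esub> ?x \<odot>\<^bsub>?F\<^esub> w"
      using Suc.prems(4) by (rule seq_smult_SucE)
    have y: "y \<in> carrier ?F" by (rule SF(1)[OF yw(1)])
    have gw: "g k w \<in> carrier (K k)" and gy: "g k y \<in> carrier (K k)" using lin_closed[OF se(5)] yw(2) y by auto
    have "g k y \<oplus>\<^bsub>K k\<^esub> ?x \<odot>\<^bsub>K k\<^esub> g k w = \<zero>\<^bsub>K k\<^esub>"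
      using se(7)[OF Suc.prems(3)] y yw(2) xj unfolding yw(3)
      by (simp add: lin_add[OF se(5)] lin_smult[OF se(5)])
    then have "?x \<odot>\<^bsub>K k\<^esub> g k w = \<ominus>\<^bsub>K k\<^esub> g k y"
      using gw gy xj by (intro K.M.minus_equality[symmetric]) (simp_all add: K.M.a_comm)
    then have xgw: "?x \<odot>\<^bsub>K k\<^esub> g k w \<in> seq_smult (K k) xs j"
      using SK(4)[OF seq_smult_lin[OF se(2,3,5) xs j(2) yw(1)]] by simp
    \<comment> \<open>The element \<open>x\<^sub>j\<^sub>+\<^sub>1\<close> is regular on \<open>K\<^sub>k\<close> modulo \<open>(x\<^sub>1, \<dots>, x\<^sub>j)\<close> by the induction hypothesis for \<open>i = k - 1\<close>.\<close>
    have "g k w \<in> seq_smult (K k) xs j"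
    proof -
      have gw': "g k w \<in> carrier (K (Suc i))" using gw k by simp
      have "?x \<odot>\<^bsub>free_module R (b i)\<^esub> f i (g k w) \<in> seq_smult (free_module R (b i)) xs j"
        using seq_smult_lin[OF se(1,2,4)[of i] xs j(2), of "?x \<odot>\<^bsub>K k\<^esub> g k w"] xgw
        by (simp add: k(1)[symmetric] lin_smult[OF se(4)[of i, folded k(1)] xj gw])
      then have "f i (g k w) \<in> seq_smult (free_module R (b i)) xs j"
        by (rule regular_seq_free[OF R reg j(1) lin_closed[OF se(4) gw']])
      then show ?thesis using Suc.IH[OF j(1) k(2) gw'] k by simp
    qed
    then obtain y' where y': "y' \<in> ?JF" "g k y' = g k w"
      using seq_smult_lin_surj[OF se(2,3,5) xs j(2) se(9)] by blast
    have y'c: "y' \<in> carrier ?F" by (rule SF(1)[OF y'(1)])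
    have "g k (w \<ominus>\<^bsub>?F\<^esub> y') = \<zero>\<^bsub>K k\<^esub>"
      using yw(2) y'c y'(2) gw by (simp add: lin_minus[OF se(2,3,5)] K.M.diff_zero_iff)
    then obtain z where z: "z \<in> carrier ?L" "f k z = w \<ominus>\<^bsub>?F\<^esub> y'"
      using se(8)[of "w \<ominus>\<^bsub>?F\<^esub> y'" k] yw(2) y'c by auto
    have mz: "m \<ominus>\<^bsub>?L\<^esub> ?x \<odot>\<^bsub>?L\<^esub> z \<in> carrier ?L" using Suc.prems(3) z(1) xj by simp
    have "f k (m \<ominus>\<^bsub>?L\<^esub> ?x \<odot>\<^bsub>?L\<^esub> z) = f k m \<ominus>\<^bsub>?F\<^esub> ?x \<odot>\<^bsub>?F\<^esub> (w \<ominus>\<^bsub>?F\<^esub> y')"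
      using Suc.prems(3) z xj by (simp add: lin_minus[OF se(1,2,4)] lin_smult[OF se(4)])
    also have "\<dots> = y \<oplus>\<^bsub>?F\<^esub> ?x \<odot>\<^bsub>?F\<^esub> y'"
      unfolding yw(3) using y yw(2) y'c xj by algebra
    also have "\<dots> \<in> ?JF" by (rule SF(3)[OF yw(1) SF(5)[OF xj y'(1)]])
    finally have "m \<ominus>\<^bsub>?L\<^esub> ?x \<odot>\<^bsub>?L\<^esub> z \<in> seq_smult ?L xs j"
      using Suc.prems(2) by (intro Suc.IH[OF j(1) _ mz]) simp_all
    from seq_smult_SucI[OF this z(1)]
    show ?case using Suc.prems(3) z(1) xj by (simp add: L.M.minus_eq L.M.a_assoc L.M.l_neg)
  qed
  show ?thesis
  proof (rule intersect[OF assms(4-6)])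
    have "xs ! j \<odot>\<^bsub>free_module R (b k)\<^esub> f k m \<in> seq_smult (free_module R (b k)) xs j"
      using seq_smult_lin[OF se(1,2,4) xs _ assms(7)] assms(4)
      by (simp add: lin_smult[OF se(4) x[OF assms(4)] assms(6)])
    then show "f k m \<in> seq_smult (free_module R (b k)) xs j"
      by (rule regular_seq_free[OF R reg assms(4) lin_closed[OF se(4) assms(6)]])
  qed
qed

text \<open>The modules \<open>A\<close> and \<open>C\<close> stand for \<open>M / (x\<^sub>1, \<dots>, x\<^sub>j) M\<close> and \<open>M / (x\<^sub>1, \<dots>, x\<^sub>j\<^sub>+\<^sub>1) M\<close>. Only the kernels of the
  projections are prescribed, so that for \<open>j = 0\<close> one may take \<open>A = M\<close>.\<close>

lemma short_exact_seq_quotient: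
  assumes M: "module R M" and A: "module R A" and C: "module R C"
    and xs: "set xs \<subseteq> carrier R" and j: "j < length xs"
    and p: "p \<in> lin_maps R M A" "p ` carrier M = carrier A"
      "\<And>m. m \<in> carrier M \<Longrightarrow> p m = \<zero>\<^bsub>A\<^esub> \<longleftrightarrow> m \<in> seq_smult M xs j"
    and q: "q \<in> lin_maps R M C" "q ` carrier M = carrier C"
      "\<And>m. m \<in> carrier M \<Longrightarrow> q m = \<zero>\<^bsub>C\<^esub> \<longleftrightarrow> m \<in> seq_smult M xs (Suc j)"
    and reg: "\<And>m. \<lbrakk>m \<in> carrier M; xs ! j \<odot>\<^bsub>M\<^esub> m \<in> seq_smult M xs j\<rbrakk> \<Longrightarrow> m \<in> seq_smult M xs j"
  obtains r where "short_exact R A (\<lambda>a. xs ! j \<odot>\<^bsub>A\<^esub> a) A r C"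
proof -
  let ?x = "xs ! j" and ?J = "seq_smult M xs j"
  interpret M: module R M by fact
  interpret A: module R A by fact
  have x: "?x \<in> carrier R" using xs j by (auto simp: subset_iff)
  note S = seq_smultD[OF M xs less_imp_le[OF j]]
  have surj: "\<exists>m\<in>carrier M. p m = a" if "a \<in> carrier A" for a using p(2) that by (metis (no_types, lifting) imageE)
  have "q m = \<zero>\<^bsub>C\<^esub>" if "m \<in> carrier (kernel_module M A p)" for m
  proof -
    have m: "m \<in> carrier M" "m \<in> ?J" using that p(3) by (auto simp: mem_a_kernel)
    then show ?thesis using seq_smult_SucI[OF m(2), of "\<zero>\<^bsub>M\<^esub>"] x q(3) by simp
  qed
  then obtain r where r: "r \<in> lin_maps R A C" "\<And>m. m \<in> carrier M \<Longrightarrow> r (p m) = q m"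
    using short_exact_factor_quot[OF short_exact_kernel[OF M A p(1,2)] C q(1)] by blast
  have "short_exact R A (\<lambda>a. ?x \<odot>\<^bsub>A\<^esub> a) A r C"
  proof (rule short_exactI[OF A A C lin_scalar[OF A x] r(1)])
    fix a assume a: "a \<in> carrier A"
    obtain m where m: "m \<in> carrier M" "p m = a" using surj[OF a] by blast
    have xm: "?x \<odot>\<^bsub>M\<^esub> m \<in> carrier M" using m(1) x by simp
    have pxm: "p (?x \<odot>\<^bsub>M\<^esub> m) = ?x \<odot>\<^bsub>A\<^esub> a" using m x by (simp add: lin_smult[OF p(1)])
    show "r (?x \<odot>\<^bsub>A\<^esub> a) = \<zero>\<^bsub>C\<^esub>"
      using q(3)[OF xm] seq_smult_SucI[OF S(2) m(1)] r(2)[OF xm] xm unfolding pxm by simp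
    { assume "?x \<odot>\<^bsub>A\<^esub> a = \<zero>\<^bsub>A\<^esub>"
      then have "?x \<odot>\<^bsub>M\<^esub> m \<in> ?J" using p(3)[OF xm] pxm by simp
      then show "a = \<zero>\<^bsub>A\<^esub>" using reg[OF m(1)] p(3)[OF m(1)] m(2) by simp }
    { assume "r a = \<zero>\<^bsub>C\<^esub>"
      then have "m \<in> seq_smult M xs (Suc j)" using q(3)[OF m(1)] r(2)[OF m(1)] m(2) by simp
      then obtain u n where u: "u \<in> ?J" "n \<in> carrier M" "m = u \<oplus>\<^bsub>M\<^esub> ?x \<odot>\<^bsub>M\<^esub> n"
        by (rule seq_smult_SucE)
      have uc: "u \<in> carrier M" by (rule S(1)[OF u(1)])
      have "p u = \<zero>\<^bsub>A\<^esub>" using p(3)[OF uc] u(1) by simp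
      then have "a = ?x \<odot>\<^bsub>A\<^esub> p n"
        using m(2) u(2) uc x lin_closed[OF p(1) u(2)] unfolding u(3)
        by (simp add: lin_add[OF p(1)] lin_smult[OF p(1)] eq_commute[of a])
      then show "\<exists>a'\<in>carrier A. ?x \<odot>\<^bsub>A\<^esub> a' = a" using lin_closed[OF p(1) u(2)] by blast }
  next
    fix c assume "c \<in> carrier C"
    then obtain m where "m \<in> carrier M" "q m = c" using q(2) by (metis (no_types, lifting) imageE)
    then show "\<exists>a\<in>carrier A. r a = c" using r(2) lin_closed[OF p(1)] by (intro bexI[of _ "p m"]) simp_all
  qed
  then show thesis by (rule that)
qed

section \<open>The binomial decomposition\<close>

lemma finite_sum_module_empty:
  assumes "cring R"
  shows "module_iso R (free_module R 0) (finite_sum_module {} A)"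
proof (rule module_isoI[where f = "\<lambda>_ _. undefined" and g = "\<lambda>_ _. undefined"])
  show "module R (finite_sum_module {} A)" by (intro module_finite_sum assms) simp
qed (use module_free[OF assms, of 0] in \<open>auto simp: free_module_def intro!: lin_mapsI\<close>)

lemma first_syzygy_finite_sum:
  assumes "cring R" "finite I" "\<And>i. i \<in> I \<Longrightarrow> first_syzygy R (A i) (L i)"
  shows "first_syzygy R (finite_sum_module I A) (finite_sum_module I L)"
  using assms(2,3)
proof (induction I rule: finite_induct)
  case empty
  show ?case
    by (rule first_syzygy_iso[OF first_syzygy_free[OF assms(1), of 0]]) (rule finite_sum_module_empty[OF assms(1)])+
next
  case (insert i I)
  note m = first_syzygy_modules[OF insert.prems]
  have "first_syzygy R (sum_module (A i) (finite_sum_module I A)) (sum_module (L i) (finite_sum_module I L))"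
    using insert by (intro first_syzygy_sum) auto
  then show ?case
    by (rule first_syzygy_iso[OF _ module_iso_sym[OF finite_sum_module_insert] module_iso_sym[OF finite_sum_module_insert]])
      (use assms(1) m insert.hyps in auto)
qed

text \<open>Pascal's rule: the subsets of \<open>{0, \<dots>, j}\<close> that contain \<open>j\<close>, followed by those that do not. Indexing the
  summands by subsets makes this a disjoint union, with no arithmetic of binomial coefficients.\<close>

lemma subset_sum_Suc:
  assumes "cring R" "\<And>i. i \<le> Suc j \<Longrightarrow> module R (S i)"
  shows "module_iso R (finite_sum_module (Pow {..<Suc j}) (\<lambda>A. S (card A)))
    (sum_module (finite_sum_module (Pow {..<j}) (\<lambda>A. S (Suc (card A))))
      (finite_sum_module (Pow {..<j}) (\<lambda>A. S (card A))))"
proof -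
  let ?P = "Pow {..<j}"
  let ?E = "finite_sum_module ?P (\<lambda>A. S (card A))"
    and ?D = "finite_sum_module (insert j ` ?P) (\<lambda>A. S (card A))"
    and ?D' = "finite_sum_module ?P (\<lambda>A. S (card (insert j A)))"
  have card: "card A \<le> j" "finite A" "j \<notin> A" if "A \<in> ?P" for A
    using that card_mono[of "{..<j}" A] by (auto intro: finite_subset)
  have cardS: "card A \<le> Suc j" if "A \<in> Pow {..<Suc j}" for A
    using that card_mono[of "{..<Suc j}" A] by auto
  have P: "module R ?E"
    by (intro module_finite_sum assms) (use card(1) in \<open>simp add: le_SucI\<close>)
  have split: "Pow {..<Suc j} = insert j ` ?P \<union> ?P"
    by (simp add: lessThan_Suc Pow_insert Un_commute)
  have re: "module_iso R ?D' ?D"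
  proof (rule finite_sum_module_reindex[OF assms(1)])
    show "bij_betw (insert j) ?P (insert j ` ?P)"
      by (rule bij_betw_imageI) (auto simp: inj_on_def dest!: card(3))
    show "module R (S (card A))" if "A \<in> insert j ` ?P" for A
      using cardS that unfolding split by (intro assms(2)) blast
  qed
  have "module_iso R (finite_sum_module (Pow {..<Suc j}) (\<lambda>A. S (card A)))
      (sum_module ?D ?E)"
    unfolding split
  proof (rule finite_sum_module_Un[OF assms(1)])
    show "module R (S (card A))" if "A \<in> insert j ` ?P \<union> ?P" for A
      using cardS that unfolding split by (intro assms(2)) blast
  qed auto
  also have "module_iso R (sum_module ?D ?E)
    (sum_module ?D' ?E)"
    by (rule module_iso_sum[OF module_iso_sym[OF re] module_iso_refl[OF P]])
  also have "module_iso R \<dots> (sum_module (finite_sum_module ?P (\<lambda>A. S (Suc (card A)))) ?E)"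
  proof (intro module_iso_sum)
    show "module_iso R ?D' (finite_sum_module ?P (\<lambda>A. S (Suc (card A))))"
      by (rule finite_sum_module_iso[OF assms(1)]) (use card in \<open>auto intro!: module_iso_refl assms(2)\<close>)
    show "module_iso R ?E ?E"
      by (rule module_iso_refl[OF P])
  qed
  finally show ?thesis .
qed

text \<open>There is exactly one empty subset, so a free summand can be absorbed into the only copy of \<open>S 0\<close> without
  changing any summand that occurs several times.\<close>

lemma subset_sum_binomial:
  assumes "cring R" "\<And>i. i \<le> n \<Longrightarrow> module R (S i)"
  shows "module_iso R (sum_module (finite_sum_module (Pow {..<n}) (\<lambda>A. S (card A))) (free_module R t))
    (finite_sum_module (SIGMA i:{0..n}. {..<n choose i})
      (\<lambda>(i, j). sum_module (S i) (free_module R (if i = 0 then t else 0))))"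
proof -
  let ?I = "SIGMA i:{0..n}. {..<n choose i}"
  let ?J = "?I - {(0, 0)}"
  let ?B = "\<lambda>u :: nat \<times> nat. sum_module (S (fst u)) (free_module R (if fst u = 0 then t else 0))"
  note F = module_free[OF assms(1)]
  let ?E = "finite_sum_module (Pow {..<n}) (\<lambda>A. S (card A))"
    and ?D = "finite_sum_module ?J (\<lambda>u. S (fst u))" and ?T = "free_module R t"
  have "\<exists>h. bij_betw h {..<n choose i} {A. A \<subseteq> {..<n} \<and> card A = i}" for i
    by (rule finite_same_card_bij) (simp_all add: n_subsets)
  then obtain h where h: "\<And>i. bij_betw (h i) {..<n choose i} {A. A \<subseteq> {..<n} \<and> card A = i}" by metis
  have hS: "h i j \<subseteq> {..<n}" "card (h i j) = i" if "j < n choose i" for i j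
    using h[of i] that by (auto simp: bij_betw_def)
  have bij: "bij_betw (\<lambda>u. h (fst u) (snd u)) ?I (Pow {..<n})"
  proof (rule bij_betw_imageI)
    show "inj_on (\<lambda>u. h (fst u) (snd u)) ?I"
    proof (rule inj_onI)
      fix u v assume u: "u \<in> ?I" and v: "v \<in> ?I" and eq: "h (fst u) (snd u) = h (fst v) (snd v)"
      have "fst u = fst v" using hS(2)[of "snd u" "fst u"] hS(2)[of "snd v" "fst v"] u v eq by auto
      moreover from this have "snd u = snd v"
        using h[of "fst u"] u v eq by (auto simp: bij_betw_def inj_on_def)
      ultimately show "u = v" by (simp add: prod_eq_iff)
    qed
    show "(\<lambda>u. h (fst u) (snd u)) ` ?I = Pow {..<n}"
    proof
      show "(\<lambda>u. h (fst u) (snd u)) ` ?I \<subseteq> Pow {..<n}" using hS(1) by (auto simp: subset_iff)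
      show "Pow {..<n} \<subseteq> (\<lambda>u. h (fst u) (snd u)) ` ?I"
      proof
        fix A assume A: "A \<in> Pow {..<n}"
        then have "card A \<le> n" using card_mono[of "{..<n}" A] by auto
        have "A \<in> h (card A) ` {..<n choose card A}" using h[of "card A"] A by (auto simp: bij_betw_def)
        then obtain j where "j < n choose card A" "h (card A) j = A" by auto
        then show "A \<in> (\<lambda>u. h (fst u) (snd u)) ` ?I"
          using \<open>card A \<le> n\<close> by (intro image_eqI[of _ _ "(card A, j)"]) auto
      qed
    qed
  qed
  have S: "module R (S (fst u))" if "u \<in> ?I" for u using that by (auto intro: assms(2))
  have I: "insert (0, 0) ?J = ?I" by auto
  have J: "fst u \<noteq> 0" if "u \<in> ?J" for u using that by (auto simp: mem_Sigma_iff)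
  have "module_iso R (finite_sum_module ?I (\<lambda>u. S (card (h (fst u) (snd u))))) ?E"
  proof (rule finite_sum_module_reindex[OF assms(1) _ bij])
    show "module R (S (card A))" if "A \<in> Pow {..<n}" for A
      using that card_mono[of "{..<n}" A] by (intro assms(2)) auto
  qed
  then have "module_iso R ?E (finite_sum_module ?I (\<lambda>u. S (card (h (fst u) (snd u)))))"
    by (rule module_iso_sym)
  also have "module_iso R \<dots> (finite_sum_module ?I (\<lambda>u. S (fst u)))"
    by (rule finite_sum_module_iso[OF assms(1)]) (use hS(2) S in \<open>auto intro!: module_iso_refl\<close>)
  also have "module_iso R \<dots> (sum_module (S 0) ?D)"
    using finite_sum_module_insert[OF assms(1), of "(0, 0)" ?J "\<lambda>u. S (fst u)"] S unfolding I by simp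
  finally have "module_iso R (sum_module ?E ?T)
      (sum_module (sum_module (S 0) ?D) ?T)"
    by (intro module_iso_sum module_iso_refl F)
  also have "module_iso R \<dots> (sum_module (sum_module (S 0) ?D) (sum_module ?T (free_module R 0)))"
    using S by (intro module_iso_sum module_iso_refl module_sum module_finite_sum assms module_iso_sym[OF module_iso_sum_free_0] F) auto
  also have "module_iso R \<dots> (sum_module (sum_module (S 0) ?T) (sum_module ?D (free_module R 0)))"
    using S by (intro module_iso_sum_interchange module_finite_sum assms F) auto
  also have "module_iso R \<dots> (sum_module (?B (0, 0)) (finite_sum_module ?J ?B))"
  proof (rule module_iso_sum)
    show "module_iso R (sum_module (S 0) ?T) (?B (0, 0))"
      using assms by (auto intro!: module_iso_refl module_sum F)
    have "module_iso R (sum_module ?D (free_module R 0)) ?D"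
      using S by (intro module_iso_sum_free_0 module_finite_sum assms) auto
    also have "module_iso R \<dots> (finite_sum_module ?J ?B)"
    proof (rule finite_sum_module_iso[OF assms(1)])
      show "module_iso R (S (fst u)) (?B u)" if "u \<in> ?J" for u
        using module_iso_sym[OF module_iso_sum_free_0[OF S, of u]] J[OF that] that by simp
    qed
    finally show "module_iso R (sum_module ?D (free_module R 0)) (finite_sum_module ?J ?B)" .
  qed
  also have "module_iso R \<dots> (finite_sum_module ?I ?B)"
    using module_iso_sym[OF finite_sum_module_insert[OF assms(1), of "(0, 0)" ?J ?B]] S F unfolding I
    by (simp add: module_sum)
  finally show ?thesis by (simp only: case_prod_beta')
qed

text \<open>A free summand added to the middle term can be mapped to zero, which merely enlarges the free kernel.\<close>

lemma short_exact_stable_mid: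
  assumes "short_exact R (free_module R r) f B g Z" "stably_iso R B B'"
  shows "\<exists>q r' f' g'. short_exact R (free_module R r') f' (sum_module B' (free_module R q)) g' Z"
proof -
  note se = short_exactD[OF assms(1)]
  interpret B: module R B by (rule se)
  note F = module_free[OF B.R.is_cring]
  obtain a c where ac: "module_iso R (sum_module B (free_module R a)) (sum_module B' (free_module R c))"
    using assms(2) unfolding stably_iso_def by blast
  obtain f2 g2 where "short_exact R (free_module R (r + a)) f2 (sum_module B' (free_module R c)) g2 Z"
    by (rule short_exact_iso[OF short_exact_sum[OF assms(1) short_exact_id_sub[OF F]]
          free_module_add[OF B.R.is_cring] ac module_iso_sum_free_0[OF se(3)]])
  then show ?thesis by blast
qed

text \<open>Dividing \<open>X\<close> by a further regular element adjoins to \<open>B\<close> its own syzygy \<open>L\<close>: the next syzygy of \<open>X / xX\<close> is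
  the pullback of a cover of \<open>Z\<close> along \<open>x\<close>, and if the cover is chosen to factor through \<open>B\<close>, its kernel is
  \<open>L \<oplus> R\<^sup>r\<close>.\<close>

lemma nth_syzygy_resolution_step:
  assumes x: "x \<in> carrier R" and quot: "short_exact R X (\<lambda>m. x \<odot>\<^bsub>X\<^esub> m) X p X'"
    and Z: "nth_syzygy R X k Z" and B: "short_exact R (free_module R r) al B be Z"
    and L: "first_syzygy R B L" and ff: "factors_free R x B"
  shows "\<exists>Z' f g. nth_syzygy R X' (Suc k) Z' \<and>
    short_exact R (free_module R r) f (sum_module (sum_module L (free_module R r)) B) g Z'"
proof -
  obtain a l q where cov: "short_exact R L l (free_module R a) q B" using L unfolding first_syzygy_def by blast
  let ?H = "free_module R a" and ?F = "free_module R r"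
  obtain tau where tau: "tau \<in> lin_maps R B ?H" "\<And>y. y \<in> carrier B \<Longrightarrow> q (tau y) = x \<odot>\<^bsub>B\<^esub> y"
    using factors_free_lift[OF ff cov] by blast
  let ?C = "kernel_module ?H Z (\<lambda>h. be (q h))"
  obtain k' where C: "short_exact R ?C (\<lambda>h. h) ?H (\<lambda>h. be (q h)) Z"
    and C': "short_exact R L l ?C k' ?F"
    by (rule short_exact_compose[OF cov B])
  have surj: "(\<lambda>h. be (q h)) ` carrier ?H = carrier Z" using C by (simp add: short_exact_def)
  obtain Z' where Z': "nth_syzygy R X' (Suc k) Z'"
    "module_iso R (fiber_prod ?H Z (\<lambda>h. be (q h)) (\<lambda>z. x \<odot>\<^bsub>Z\<^esub> z)) Z'"
    using nth_syzygy_quotient[OF x quot Z short_exactD(5)[OF C] surj] by blast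
  have C'': "module_iso R (sum_module ?C B) (sum_module (sum_module L ?F) B)"
    by (intro module_iso_sum short_exact_split[OF C'] module_iso_refl short_exactD(2)[OF B])
  obtain f g where "short_exact R ?F f (sum_module (sum_module L ?F) B) g Z'"
    by (rule short_exact_iso[OF short_exact_pullback_multiplication[where q = q and tau = tau, OF B cov tau x]
          module_iso_refl[OF short_exactD(1)[OF B]] C'' Z'(2)])
  with Z'(1) show ?thesis by blast
qed

lemma is_syzygy_stable:
  assumes "cring R" "module R X" "is_syzygy R k X C" "nth_syzygy R X k Z"
  shows "stably_iso R C Z"
proof (cases k)
  case 0
  from assms(4) have "module_iso R X Z" unfolding 0 by cases
  moreover have "module_iso R X C" using assms(3) by (simp add: is_syzygy_def 0)
  ultimately show ?thesis using module_iso_sym module_iso_trans module_iso_imp_stably_iso by metis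
next
  case (Suc j)
  obtain b0 d0 e0 where r: "free_resolution R X b0 d0 e0"
    using assms(3) by (auto simp: is_syzygy_def Suc minimal_free_resolution_def)
  obtain b K where K: "syzygy_chain R X b K" "module_iso R C (K k)"
    by (rule is_syzygy_chain[OF assms(1-3) r]) (rule that)
  have "stably_iso R C (K k)" by (rule module_iso_imp_stably_iso[OF K(2)])
  also have "stably_iso R (K k) Z"
    by (rule nth_syzygy_stable[OF syzygy_chain_nth[OF K(1)] assms(4) stably_iso_refl[OF assms(2)]])
  finally show ?thesis .
qed

section \<open>The exact sequence\<close>

text \<open>The induction over the regular sequence, for \<open>M\<^sub>j = M / (x\<^sub>1, \<dots>, x\<^sub>j) M\<close>. The statement for \<open>j\<close> concerns \<open>M\<^sub>j\<^sub>+\<^sub>1\<close> and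
  its \<open>j\<close>-th syzygy, since \<open>M\<^sub>1\<close> itself is the quotient in the pushout sequence for \<open>x\<^sub>1\<close>. Each further element
  replaces the middle term \<open>B\<close> by \<open>\<Omega>B \<oplus> B\<close>. The syzygies \<open>L i\<close> of \<open>S i\<close> are kept apart from \<open>S (i+1)\<close>, to which
  they are only stably isomorphic.\<close>

lemma regular_quotient_syzygy_sequence:
  fixes R :: "('a, 'r) ring_scheme" and K :: "nat \<Rightarrow> ('a, (nat \<Rightarrow> 'a) set) module"
    and S :: "nat \<Rightarrow> ('a, 's, 't) module_scheme" and L :: "nat \<Rightarrow> ('a, 'l, 'u) module_scheme"
  assumes R: "cring R" and reg: "regular_seq R xs" and len: "length xs = Suc k"
    and ch: "\<And>i. short_exact R (K (Suc i)) (f i) (free_module R (b i)) (g i) (K i)"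
    and M: "module_iso R M (K (Suc k))"
    and ff: "\<And>x. x \<in> set xs \<Longrightarrow> factors_free R x (K k)"
    and S: "\<And>i. i \<le> Suc k \<Longrightarrow> stably_iso R (S i) (K (i + k))"
    and L: "\<And>i. i \<le> k \<Longrightarrow> first_syzygy R (S i) (L i)"
    and "j \<le> k"
  shows "\<exists>Z q r f g. nth_syzygy R (quot_module M (seq_smult M xs (Suc j))) j Z \<and>
    short_exact R (free_module R r) f
      (sum_module (finite_sum_module (Pow {..<Suc j}) (\<lambda>A. S (card A))) (free_module R q)) g Z"
  using \<open>j \<le> k\<close>
proof (induction j)
  note F = module_free[OF R] and chD = short_exactD[OF ch]
  have xs: "set xs \<subseteq> carrier R" using reg by (simp add: regular_seq_def)
  have x: "xs ! j \<in> carrier R" "xs ! j \<in> set xs" if "j \<le> k" for j using xs len that by (auto simp: subset_iff)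
  obtain \<phi> \<psi> where Mm: "module R M" and "module R (K (Suc k))"
    and \<phi>: "\<phi> \<in> lin_maps R M (K (Suc k))" and \<psi>: "\<psi> \<in> lin_maps R (K (Suc k)) M"
    and \<psi>\<phi>: "\<And>m. m \<in> carrier M \<Longrightarrow> \<psi> (\<phi> m) = m" and \<phi>\<psi>: "\<And>m. m \<in> carrier (K (Suc k)) \<Longrightarrow> \<phi> (\<psi> m) = m"
    by (rule module_isoE[OF M]) (rule that)
  interpret M: module R M by (rule Mm)
  let ?J = "seq_smult M xs"
  let ?Q = "\<lambda>j. quot_module M (seq_smult M xs j)"
  note Q = quot_module[OF Mm submodule_seq_smult[OF Mm xs]]
  have regM: "m \<in> ?J j" if "j \<le> k" "m \<in> carrier M" "xs ! j \<odot>\<^bsub>M\<^esub> m \<in> ?J j" for j m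
  proof -
    have j: "j < length xs" "j \<le> length xs" using that(1) len by auto
    have "xs ! j \<odot>\<^bsub>K (Suc k)\<^esub> \<phi> m \<in> seq_smult (K (Suc k)) xs j"
      using seq_smult_lin[OF Mm chD(1) \<phi> xs j(2) that(3)] by (simp add: lin_smult[OF \<phi> x(1)[OF that(1)] that(2)])
    then have "\<phi> m \<in> seq_smult (K (Suc k)) xs j"
      by (rule regular_seq_syzygy[OF R reg ch j(1) that(1) lin_closed[OF \<phi> that(2)]])
    from seq_smult_lin[OF chD(1) Mm \<psi> xs j(2) this] show ?thesis by (simp add: \<psi>\<phi> that(2))
  qed
  have ffK: "factors_free R y (K (i + k))" if "y \<in> set xs" for y i
  proof (induction i)
    case 0
    show ?case using ff[OF that] by simp
  next
    case (Suc i)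
    show ?case
      using factors_free_first_syzygy[OF Suc first_syzygyI[OF ch]] xs that by auto
  qed
  have ffS: "factors_free R y (S i)" if "y \<in> set xs" "i \<le> Suc k" for y i
    using factors_free_stable[OF S[OF that(2)] ffK[OF that(1)]] xs that(1) by blast
  have SL: "stably_iso R (L i) (S (Suc i))" if "i \<le> k" for i
  proof -
    have "stably_iso R (L i) (K (Suc (i + k)))"
      using that by (intro first_syzygy_stable[OF L first_syzygyI[OF ch] S]) simp_all
    then show ?thesis using stably_iso_trans[OF _ stably_iso_sym[OF S[of "Suc i"]]] that by simp
  qed
  have Sm: "module R (S i)" if "i \<le> Suc k" for i by (rule stably_iso_modules[OF S[OF that]])
  {
    case 0
    let ?F = "free_module R (b k)" and ?Ez = "finite_sum_module (Pow {..<Suc 0}) (\<lambda>A. S (card A))"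
    have x0: "xs ! 0 \<in> carrier R" "xs ! 0 \<in> set xs" using x by auto
    have len0: "0 \<le> length xs" "Suc 0 \<le> length xs" "0 < length xs" using len by auto
    obtain io p where io: "short_exact R M io ?F p (K k)"
      by (rule short_exact_iso[OF ch module_iso_sym[OF M] module_iso_refl[OF F] module_iso_refl[OF chD(3)]])
    obtain pr where pr: "short_exact R M (\<lambda>m. xs ! 0 \<odot>\<^bsub>M\<^esub> m) M pr (?Q (Suc 0))"
    proof (rule short_exact_seq_quotient[OF Mm Mm Q(1)[OF len0(2)] xs len0(3) lin_id image_ident _ Q(2,3)[OF len0(2)]])
      show "m = \<zero>\<^bsub>M\<^esub> \<longleftrightarrow> m \<in> ?J 0" for m by simp
      show "?J (Suc 0) +>\<^bsub>M\<^esub> m = \<zero>\<^bsub>?Q (Suc 0)\<^esub> \<longleftrightarrow> m \<in> ?J (Suc 0)" if "m \<in> carrier M" for m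
        using Q(4)[OF len0(2) that] by simp
    qed (use regM[of 0] in auto)
    obtain tau where tau: "tau \<in> lin_maps R (K k) ?F"
      "\<And>z. z \<in> carrier (K k) \<Longrightarrow> p (tau z) = xs ! 0 \<odot>\<^bsub>K k\<^esub> z"
      using factors_free_lift[OF ff[OF x0(2)] io] by blast
    have free_reg: "u = \<zero>\<^bsub>?F\<^esub>"
      if "u \<in> carrier ?F" "xs ! 0 \<odot>\<^bsub>?F\<^esub> u = \<zero>\<^bsub>?F\<^esub>" for u
      using regular_seq_free[OF R reg len0(3) that(1)] that(2) by simp
    obtain f1 g1 where fg1: "short_exact R ?F f1 (sum_module M (K k)) g1 (?Q (Suc 0))"
      using short_exact_pushout_multiplication[where p = p and tau = tau, OF io pr tau x0(1) free_reg] by blast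
    have "stably_iso R (sum_module M (K k)) (sum_module (S (Suc 0)) (S 0))"
    proof (rule stably_iso_sum)
      show "stably_iso R M (S (Suc 0))"
      proof (rule stably_iso_trans[OF module_iso_imp_stably_iso[OF M]])
        show "stably_iso R (K (Suc k)) (S (Suc 0))" using stably_iso_sym[OF S[of "Suc 0"]] by simp
      qed
      show "stably_iso R (K k) (S 0)" using stably_iso_sym[OF S[of 0]] by simp
    qed
    also have "stably_iso R \<dots> ?Ez"
    proof (rule module_iso_imp_stably_iso, rule module_iso_sym)
      have "module_iso R ?Ez
          (sum_module (finite_sum_module (Pow {..<0 :: nat}) (\<lambda>A. S (Suc (card A)))) (finite_sum_module (Pow {..<0 :: nat}) (\<lambda>A. S (card A))))"
        by (rule subset_sum_Suc[OF R]) (simp add: Sm)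
      also have "module_iso R \<dots> (sum_module (S (Suc 0)) (S 0))"
        using finite_sum_module_single[of R "\<lambda>A. S (Suc (card A))" "{} :: nat set"]
          finite_sum_module_single[of R "\<lambda>A. S (card A)" "{} :: nat set"] Sm
        by (intro module_iso_sum) simp_all
      finally show "module_iso R ?Ez (sum_module (S (Suc 0)) (S 0))" .
    qed
    finally obtain q r f2 g2 where fg2: "short_exact R (free_module R r) f2
        (sum_module ?Ez (free_module R q)) g2 (?Q (Suc 0))"
      using short_exact_stable_mid[OF fg1] by blast
    obtain i2 p2 where i2: "short_exact R (K (Suc (Suc k))) i2 (free_module R (b (Suc k))) p2 M"
      by (rule short_exact_iso[OF ch module_iso_refl[OF chD(1)] module_iso_refl[OF F] module_iso_sym[OF M]])
    have cov: "short_exact R (kernel_module (free_module R (b (Suc k))) (?Q (Suc 0)) (\<lambda>u. pr (p2 u))) (\<lambda>u. u)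
        (free_module R (b (Suc k))) (\<lambda>u. pr (p2 u)) (?Q (Suc 0))"
      by (rule short_exact_compose[OF i2 pr])
    then have "(\<lambda>u. pr (p2 u)) ` carrier (free_module R (b (Suc k))) = carrier (?Q (Suc 0))"
      by (simp only: short_exact_def)
    then obtain Z :: "('a, (nat \<Rightarrow> 'a) set) module" where Z: "module_iso R (?Q (Suc 0)) Z"
      using quotient_rep[OF F Q(1)[OF len0(2)] short_exactD(5)[OF cov]] by blast
    note m2 = short_exactD(1,2)[OF fg2]
    obtain f3 g3 where "short_exact R (free_module R r) f3 (sum_module ?Ez (free_module R q)) g3 Z"
      by (rule short_exact_iso[OF fg2 module_iso_refl[OF m2(1)] module_iso_refl[OF m2(2)] Z])
    with nth_syzygy.zero[OF Z] show ?case by (intro exI conjI)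
  next
    case (Suc j)
    then have j: "Suc j \<le> length xs" "Suc j < length xs" "Suc (Suc j) \<le> length xs" "j \<le> k" using len by auto
    note xj = x[OF Suc.prems]
    let ?P = "Pow {..<Suc j}"
    let ?E = "finite_sum_module ?P (\<lambda>A. S (card A))" and ?L = "finite_sum_module ?P (\<lambda>A. L (card A))"
      and ?D = "finite_sum_module ?P (\<lambda>A. S (Suc (card A)))"
    obtain Z q r al be where Z: "nth_syzygy R (?Q (Suc j)) j Z"
      and B: "short_exact R (free_module R r) al
        (sum_module ?E (free_module R q)) be Z"
      using Suc.IH[OF j(4)] by blast
    have card: "card A \<le> k" if "A \<in> ?P" for A
      using that card_mono[of "{..<Suc j}" A] Suc.prems by auto
    have Pm: "module R ?E"
      by (intro module_finite_sum R Sm) (use card in \<open>simp add: le_SucI\<close>)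
    obtain pr where pr: "short_exact R (?Q (Suc j)) (\<lambda>m. xs ! Suc j \<odot>\<^bsub>?Q (Suc j)\<^esub> m) (?Q (Suc j)) pr (?Q (Suc (Suc j)))"
    proof (rule short_exact_seq_quotient[OF Mm Q(1)[OF j(1)] Q(1)[OF j(3)] xs j(2) Q(2,3)[OF j(1)] _ Q(2,3)[OF j(3)]])
      show "?J (Suc j) +>\<^bsub>M\<^esub> m = \<zero>\<^bsub>?Q (Suc j)\<^esub> \<longleftrightarrow> m \<in> ?J (Suc j)" if "m \<in> carrier M" for m
        using Q(4)[OF j(1) that] by simp
      show "?J (Suc (Suc j)) +>\<^bsub>M\<^esub> m = \<zero>\<^bsub>?Q (Suc (Suc j))\<^esub> \<longleftrightarrow> m \<in> ?J (Suc (Suc j))"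
        if "m \<in> carrier M" for m
        using Q(4)[OF j(3) that] by simp
    qed (use regM[OF Suc.prems] in auto)
    have LP: "first_syzygy R (sum_module ?E (free_module R q))
        ?L"
      by (intro first_syzygy_sum_free first_syzygy_finite_sum R L card) simp_all
    have ffB: "factors_free R (xs ! Suc j) (sum_module ?E (free_module R q))"
      using card
      by (intro factors_free_sum Pm F factors_free_finite_sum R xj factors_free_free ffS Sm) (simp_all add: le_SucI)
    obtain Z' f' g' where Z': "nth_syzygy R (?Q (Suc (Suc j))) (Suc j) Z'"
      and fg': "short_exact R (free_module R r) f'
        (sum_module (sum_module ?L (free_module R r))
          (sum_module ?E (free_module R q))) g' Z'"
      using nth_syzygy_resolution_step[OF xj(1) pr Z B LP ffB] by blast
    have "stably_iso R (sum_module ?L (free_module R r))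
        ?D"
    proof -
      have "stably_iso R ?L ?D"
        by (rule stably_iso_finite_sum[OF R]) (use SL card in simp_all)
      from stably_iso_trans[OF stably_iso_sum_free[OF stably_iso_modules(1)[OF this]] this] show ?thesis .
    qed
    from stably_iso_sum[OF this stably_iso_sum_free[OF Pm]]
    have "stably_iso R
        (sum_module (sum_module ?L (free_module R r))
          (sum_module ?E (free_module R q)))
        (sum_module ?D ?E)" .
    also have "stably_iso R \<dots> (finite_sum_module (Pow {..<Suc (Suc j)}) (\<lambda>A. S (card A)))"
      by (rule module_iso_imp_stably_iso, rule module_iso_sym, rule subset_sum_Suc[OF R])
        (use Suc.prems in \<open>simp add: Sm\<close>)
    finally obtain q' r' f3 g3 where "short_exact R (free_module R r') f3
        (sum_module (finite_sum_module (Pow {..<Suc (Suc j)}) (\<lambda>A. S (card A))) (free_module R q')) g3 Z'"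
      using short_exact_stable_mid[OF fg'] by blast
    with Z' show ?case by (intro exI conjI)
  }
qed

theorem proposition2p8:
  fixes R :: "('a, 'r) ring_scheme"
    and N :: "('a, 'b) module"
    and n :: nat
    and M :: "('a, 'm) module"
    and Y :: "('a, 'y) module"
    and xs :: "'a list"
    and S :: "nat \<Rightarrow> ('a, 's) module"
    and C :: "('a, 'c) module"
  assumes "noetherian_local_ring R"
    and "module R N" and "fin_gen R N" and "carrier N \<noteq> {\<zero>\<^bsub>N\<^esub>}"
    and "n \<ge> 1"
    and "is_syzygy R n N M"
    and "is_syzygy R 1 N Y"
    and "regular_seq R xs" and "length xs = n"
    and "\<forall>x\<in>set xs. annihilates x (ext_module R 1 N Y)"
    and "\<forall>i\<le>n. is_syzygy R (i + n - 1) N (S i)"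
    and "is_syzygy R (n - 1) (quot_module M (ideal_smult R (genideal R (set xs)) M)) C"
  shows "\<exists>(A :: nat \<Rightarrow> ('a, 's \<times> (nat \<Rightarrow> 'a)) module) (L :: ('a, 'c \<times> (nat \<Rightarrow> 'a)) module) p f g.
    (\<forall>i\<le>n. stably_iso R (A i) (S i)) \<and> stably_iso R L C \<and>
    short_exact R (free_module R p) f
      (finite_sum_module (SIGMA i:{0..n}. {..<n choose i}) (\<lambda>(i, j). A i)) g L"
proof -
  have R: "cring R" using assms(1) by (simp add: noetherian_local_ring_def)
  note F = module_free[OF R]
  obtain k where n: "n = Suc k" using assms(5) by (cases n) auto
  have xs: "set xs \<subseteq> carrier R" using assms(8) by (simp add: regular_seq_def)
  obtain b0 d0 e0 where res: "free_resolution R N b0 d0 e0"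
    using assms(7) by (auto simp: is_syzygy_def minimal_free_resolution_def)
  obtain b K where K: "syzygy_chain R N b K" and M: "module_iso R M (K n)"
    by (rule is_syzygy_chain[OF R assms(2,6) res]) (rule that)
  obtain f g where ch: "\<And>i. short_exact R (K (Suc i)) (f i) (free_module R (b i)) (g i) (K i)"
    using K unfolding syzygy_chain_def by metis
  have S: "stably_iso R (S i) (K (i + k)) \<and> (\<exists>L :: ('a, (nat \<Rightarrow> 'a) set) module. first_syzygy R (S i) L)"
    if "i \<le> Suc k" for i
  proof -
    have "is_syzygy R (i + k) N (S i)" using assms(11) that n by simp
    then obtain b' K' where K': "syzygy_chain R N b' K'" and iso: "module_iso R (S i) (K' (i + k))"
      by (rule is_syzygy_chain[OF R assms(2) _ res]) (rule that)
    have "stably_iso R (S i) (K (i + k))"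
      using stably_iso_trans[OF module_iso_imp_stably_iso[OF iso]
          nth_syzygy_stable[OF syzygy_chain_nth[OF K'] syzygy_chain_nth[OF K] stably_iso_refl[OF assms(2)]]] .
    moreover obtain f' g' where "short_exact R (K' (Suc (i + k))) f' (free_module R (b' (i + k))) g' (K' (i + k))"
      using K' unfolding syzygy_chain_def by blast
    then have "first_syzygy R (S i) (K' (Suc (i + k)))"
      by (intro first_syzygy_iso[OF first_syzygyI module_iso_sym[OF iso] module_iso_refl]) (auto simp: short_exact_def)
    ultimately show ?thesis by blast
  qed
  then obtain L :: "nat \<Rightarrow> ('a, (nat \<Rightarrow> 'a) set) module" where L: "\<And>i. i \<le> k \<Longrightarrow> first_syzygy R (S i) (L i)"
    by (metis le_SucI)
  have ff: "factors_free R x (K i)" if x: "x \<in> set xs" for x i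
  proof (induction i)
    have xR: "x \<in> carrier R" using x xs by blast
    {
      case 0
      have "module_iso R (K 0) N" using K by (simp add: syzygy_chain_def module_iso_sym)
      moreover have "factors_free R x N"
        by (rule ext_annihilator_factors_free[OF R assms(2,7) xR]) (use assms(10) x in blast)
      ultimately show ?case using xR by (rule factors_free_iso)
    next
      case (Suc i)
      show ?case by (rule factors_free_first_syzygy[OF Suc first_syzygyI[OF ch] xR])
    }
  qed
  let ?E = "finite_sum_module (Pow {..<n}) (\<lambda>A. S (card A))"
  have Mm: "module R M" by (rule module_iso_modules[OF M])
  let ?Q = "quot_module M (ideal_smult R (genideal R (set xs)) M)"
  have Qeq: "ideal_smult R (genideal R (set xs)) M = seq_smult M xs (Suc k)"
    using ideal_smult_eq_seq_smult[OF Mm xs] assms(9) n by simp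
  obtain Z q r al be where Z: "nth_syzygy R ?Q k Z" and B: "short_exact R (free_module R r) al
      (sum_module ?E (free_module R q)) be Z"
    using regular_quotient_syzygy_sequence[OF R assms(8) _ ch M[unfolded n] ff conjunct1[OF S] L order_refl]
      assms(9) unfolding Qeq n by blast
  have Qm: "module R ?Q"
    unfolding Qeq by (rule module_quot[OF Mm submodule_seq_smult[OF Mm xs]]) (simp add: assms(9) n)
  have "stably_iso R C Z"
    using is_syzygy_stable[OF R Qm _ Z] assms(12) n by simp
  then obtain a c where ac: "module_iso R (sum_module C (free_module R a)) (sum_module Z (free_module R c))"
    and Cm: "module R C" and Zm: "module R Z"
    unfolding stably_iso_def by blast
  have Sm: "module R (S i)" if "i \<le> n" for i using stably_iso_modules(1)[OF conjunct1[OF S]] that n by simp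
  have Pm: "module R ?E"
  proof (intro module_finite_sum R Sm)
    show "card A \<le> n" if "A \<in> Pow {..<n}" for A using that card_mono[of "{..<n}" A] by auto
  qed
  \<comment> \<open>Free summands are needed on both sides: \<open>R\<^sup>q\<close> came up along the induction, and \<open>R\<^sup>c\<close> is added to identify
    \<open>Z\<close> with \<open>C\<close>.\<close>
  define A where "A = (\<lambda>i. sum_module (S i) (free_module R (if i = 0 then q + c else 0)))"
  let ?D = "finite_sum_module (SIGMA i:{0..n}. {..<n choose i}) (\<lambda>(i, j). A i)"
    and ?F = "free_module R"
  have "module_iso R (sum_module (sum_module ?E (?F q)) (?F c)) (sum_module ?E (?F (q + c)))"
    by (rule module_iso_sum_free_free[OF Pm])
  also have "module_iso R \<dots> ?D"
    unfolding A_def by (rule subset_sum_binomial[OF R Sm])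
  finally have mid: "module_iso R (sum_module (sum_module ?E (?F q)) (?F c)) ?D" .
  obtain f2 g2 where "short_exact R (?F r) f2 ?D g2 (sum_module C (?F a))"
    by (rule short_exact_iso[OF short_exact_sum[OF B short_exact_id_quot[OF F]]
          module_iso_sum_free_0[OF F] mid module_iso_sym[OF ac]])
  moreover have "\<forall>i\<le>n. stably_iso R (A i) (S i)" by (simp add: A_def stably_iso_sum_free Sm)
  moreover have "stably_iso R (sum_module C (?F a)) C" by (rule stably_iso_sum_free[OF Cm])
  ultimately show ?thesis by blast
qed

end
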